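(* Let $\alpha>0$. For any $\epsilon>0$ one has the continuous embeddings $$\mathcal{M}^{\alpha+1+\epsilon}\hookrightarrow E^\alpha_{\mathrm{unif}}\hookrightarrow\mathcal{M}^{\alpha-\epsilon}$$ (for the second one, $\epsilon<\alpha$).
   Context: Notation: $\langle n\rangle=1+|n|$; $\check{\ }$ is the inverse Fourier transform on $\mathbb{R}$. Functions are understood to be bounded and continuous. Let $\phi\in C_c^\infty(\mathbb{R})$ with $\mathrm{supp}\,\phi\subset[-1,1]$, $\phi_n=\phi(\cdot-n)$, $\sum_{n\in\mathbb{Z}}\phi_n=1$ on $\mathbb{R}$ (equidistant partition of unity). Let $\varphi\in C_c^\infty$ with $\mathrm{supp}\,\varphi\subset[\frac12,2]$, $\varphi_n=\varphi(2^{-n}\cdot)$, $\sum_{n\in\mathbb{Z}}\varphi_n=1$ on $(0,\infty)$ (dyadic partition of unity; $\varphi_0=\varphi$). Let $\psi_0,\psi_1\in C_c^\infty(\mathbb{R})$, $\mathrm{supp}\,\psi_1\subset[\frac12,2]$, $\mathrm{supp}\,\psi_0\subset[-1,1]$, $\psi_n=\psi_1(2^{1-n}\cdot)$ for $n\ge2$, $\psi_n=\psi_{-n}(-\cdot)$ for $n\le-1$, with $\sum_{n\in\mathbb{Z}}\psi_n=1$ on $\mathbb{R}$. $E^\alpha_{\mathrm{unif}}$ is the space of $f:(0,\infty)\to\mathbb{C}$ with $\|f\|_{E^\alpha_{\mathrm{unif}}}=\sum_{n\in\mathbb{Z}}\langle n\rangle^\alpha\sup_{k\in\mathbb{Z}}\|[f(2^k\cdot)\varphi_0]*\check\phi_n\|_\infty<\infty$,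 where $f(2^k\cdot)\varphi_0$ is extended by $0$ to $\mathbb{R}$. $\mathcal{B}^\alpha_{\infty,1}$ is the space of bounded continuous $f$ on $\mathbb{R}$ with $\|f\|_{\mathcal{B}^\alpha_{\infty,1}}=\sum_{n\in\mathbb{Z}}2^{|n|\alpha}\|f*\check\psi_n\|_\infty<\infty$. For $\alpha>0$, $\mathcal{M}^\alpha=\{f:(0,\infty)\to\mathbb{C}:f_e\in\mathcal{B}^\alpha_{\infty,1}\}$ where $f_e(s)=f(e^s)$, with norm $\|f\|_{\mathcal{M}^\alpha}=\|f_e\|_{\mathcal{B}^\alpha_{\infty,1}}$. *)

theory Defs
  imports "HOL-Analysis.Analysis"
begin

section \<open>Test functions and partitions of unity\<close>

definition fun_support :: "(real \<Rightarrow> complex) \<Rightarrow> real set" where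
  "fun_support f = closure {x. f x \<noteq> 0}"

definition smooth :: "(real \<Rightarrow> complex) \<Rightarrow> bool" where
  "smooth f \<longleftrightarrow>
     (\<forall>(k::nat) x. ((\<lambda>g t. vector_derivative g (at t)) ^^ k) f differentiable (at x))"

definition test_functions :: "(real \<Rightarrow> complex) set" where
  "test_functions = {f. smooth f \<and> compact (fun_support f)}"

definition equidistant_block :: "(real \<Rightarrow> complex) \<Rightarrow> int \<Rightarrow> real \<Rightarrow> complex" where
  "equidistant_block \<phi> n = (\<lambda>x. \<phi> (x - of_int n))"

definition equidistant_partition :: "(real \<Rightarrow> complex) \<Rightarrow> bool" where
  "equidistant_partition \<phi> \<longleftrightarrow>
     \<phi> \<in> test_functions \<and> fun_support \<phi> \<subseteq> {-1..1} \<and>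
     (\<forall>x. ((\<lambda>n. equidistant_block \<phi> n x) has_sum 1) UNIV)"

definition dyadic_block :: "(real \<Rightarrow> complex) \<Rightarrow> int \<Rightarrow> real \<Rightarrow> complex" where
  "dyadic_block \<phi> n = (\<lambda>x. \<phi> (2 powi (- n) * x))"

definition dyadic_partition :: "(real \<Rightarrow> complex) \<Rightarrow> bool" where
  "dyadic_partition \<phi> \<longleftrightarrow>
     \<phi> \<in> test_functions \<and> fun_support \<phi> \<subseteq> {1/2..2} \<and>
     (\<forall>x>0. ((\<lambda>n. dyadic_block \<phi> n x) has_sum 1) UNIV)"

definition fourier_block ::
  "(real \<Rightarrow> complex) \<Rightarrow> (real \<Rightarrow> complex) \<Rightarrow> int \<Rightarrow> real \<Rightarrow> complex" where
  "fourier_block \<psi>0 \<psi>1 n =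
     (if n = 0 then \<psi>0
      else if n > 0 then (\<lambda>x. \<psi>1 (2 powi (1 - n) * x))
      else (\<lambda>x. \<psi>1 (2 powi (1 - (- n)) * (- x))))"

definition fourier_partition :: "(real \<Rightarrow> complex) \<Rightarrow> (real \<Rightarrow> complex) \<Rightarrow> bool" where
  "fourier_partition \<psi>0 \<psi>1 \<longleftrightarrow>
     \<psi>0 \<in> test_functions \<and> fun_support \<psi>0 \<subseteq> {-1..1} \<and>
     \<psi>1 \<in> test_functions \<and> fun_support \<psi>1 \<subseteq> {1/2..2} \<and>
     (\<forall>x. ((\<lambda>n. fourier_block \<psi>0 \<psi>1 n x) has_sum 1) UNIV)"

section \<open>Fourier analysis on the real line\<close>

text \<open>The normalization is the one for which convolution with the inverse transform of a
  symbol is the Fourier multiplier with that symbol; in particular convolving with the inverse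
  transforms of a partition of unity decomposes a function.\<close>

definition inv_fourier :: "(real \<Rightarrow> complex) \<Rightarrow> real \<Rightarrow> complex" where
  "inv_fourier g x = 1 / (2 * of_real pi) * (\<integral>\<xi>. cis (x * \<xi>) * g \<xi> \<partial>lborel)"

definition convolve :: "(real \<Rightarrow> complex) \<Rightarrow> (real \<Rightarrow> complex) \<Rightarrow> real \<Rightarrow> complex" where
  "convolve g h x = (\<integral>y. g y * h (x - y) \<partial>lborel)"

definition sup_norm :: "(real \<Rightarrow> complex) \<Rightarrow> ennreal" where
  "sup_norm g = (SUP x. ennreal (norm (g x)))"

section \<open>The function spaces\<close>

text \<open>Norms take values in \<open>[0, \<infinity>]\<close>, so that sums and suprema are always meaningful and
  finiteness of the norm is the membership condition. A function on \<open>(0, \<infinity>)\<close> is represented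
  by its extension by \<open>0\<close> to the real line.\<close>

definition half_line_functions :: "(real \<Rightarrow> complex) set" where
  "half_line_functions = {f. \<forall>x\<le>0. f x = 0}"

definition E_unif_norm ::
  "(real \<Rightarrow> complex) \<Rightarrow> (real \<Rightarrow> complex) \<Rightarrow> real \<Rightarrow> (real \<Rightarrow> complex) \<Rightarrow> ennreal" where
  "E_unif_norm \<phi> \<phi>' \<alpha> f =
     (\<Sum>\<^sub>\<infinity>n\<in>(UNIV :: int set). ennreal ((1 + of_int \<bar>n\<bar>) powr \<alpha>) *
        (SUP k :: int. sup_norm
           (convolve (\<lambda>x. if 0 < x then f (2 powi k * x) * dyadic_block \<phi>' 0 x else 0)
                     (inv_fourier (equidistant_block \<phi> n)))))"

definition E_unif ::
  "(real \<Rightarrow> complex) \<Rightarrow> (real \<Rightarrow> complex) \<Rightarrow> real \<Rightarrow> (real \<Rightarrow> complex) set" where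
  "E_unif \<phi> \<phi>' \<alpha> =
     {f \<in> half_line_functions. continuous_on {0<..} f \<and> bounded (f ` {0<..}) \<and>
        E_unif_norm \<phi> \<phi>' \<alpha> f < \<infinity>}"

definition B_norm ::
  "(real \<Rightarrow> complex) \<Rightarrow> (real \<Rightarrow> complex) \<Rightarrow> real \<Rightarrow> (real \<Rightarrow> complex) \<Rightarrow> ennreal" where
  "B_norm \<psi>0 \<psi>1 \<alpha> f =
     (\<Sum>\<^sub>\<infinity>n\<in>(UNIV :: int set). ennreal (2 powr (of_int \<bar>n\<bar> * \<alpha>)) *
        sup_norm (convolve f (inv_fourier (fourier_block \<psi>0 \<psi>1 n))))"

definition B_space ::
  "(real \<Rightarrow> complex) \<Rightarrow> (real \<Rightarrow> complex) \<Rightarrow> real \<Rightarrow> (real \<Rightarrow> complex) set" where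
  "B_space \<psi>0 \<psi>1 \<alpha> = {f \<in> bcontfun. B_norm \<psi>0 \<psi>1 \<alpha> f < \<infinity>}"

definition M_space ::
  "(real \<Rightarrow> complex) \<Rightarrow> (real \<Rightarrow> complex) \<Rightarrow> real \<Rightarrow> (real \<Rightarrow> complex) set" where
  "M_space \<psi>0 \<psi>1 \<alpha> = {f \<in> half_line_functions. (\<lambda>s. f (exp s)) \<in> B_space \<psi>0 \<psi>1 \<alpha>}"

definition M_norm ::
  "(real \<Rightarrow> complex) \<Rightarrow> (real \<Rightarrow> complex) \<Rightarrow> real \<Rightarrow> (real \<Rightarrow> complex) \<Rightarrow> ennreal" where
  "M_norm \<psi>0 \<psi>1 \<alpha> f = B_norm \<psi>0 \<psi>1 \<alpha> (\<lambda>s. f (exp s))"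

definition continuously_embedded ::
  "'a set \<Rightarrow> ('a \<Rightarrow> ennreal) \<Rightarrow> 'a set \<Rightarrow> ('a \<Rightarrow> ennreal) \<Rightarrow> bool" where
  "continuously_embedded X N\<^sub>X Y N\<^sub>Y \<longleftrightarrow>
     X \<subseteq> Y \<and> (\<exists>C::real. C \<ge> 0 \<and> (\<forall>f\<in>X. N\<^sub>Y f \<le> ennreal C * N\<^sub>X f))"

end

theory Submission
  imports Defs "HOL-Probability.Probability"
begin

text \<open>Both embeddings come from one estimate. Let \<open>(q\<^sub>i)\<close> be a partition of unity on the frequency
  side with \<open>supp q\<^sub>i \<subseteq> [-R\<^sub>i, R\<^sub>i]\<close>, let \<open>\<theta>\<close> be a smooth change of variables, \<open>\<eta>\<close> a cutoff and \<open>w\<close> a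
  kernel. In \<open>\<integral> \<eta> (g \<circ> \<theta>) w\<close> decompose \<open>g\<close> into its frequency pieces
  along \<open>(q\<^sub>i)\<close> and integrate by parts \<open>N\<close> times: every derivative falling on a piece costs a factor \<open>R\<^sub>i\<close> (Bernstein), while \<open>w\<close> is
  replaced by its \<open>N\<close>-th antiderivative, again an inverse Fourier transform, of the symbol of \<open>w\<close>
  divided by \<open>(\<i>\<xi>)\<^sup>N\<close>, hence small when \<open>w\<close> oscillates at a frequency \<open>\<lambda>\<close>. Doing this
  either \<open>N\<close> times or not at all bounds the contribution of the piece by
  \<open>min 1 ((R\<^sub>i / \<lambda>)\<^sup>N) \<le> (R\<^sub>i / \<lambda>)\<^sup>\<beta>\<close> for any \<open>0 \<le> \<beta> \<le> N\<close>.

  For the first embedding take \<open>\<theta> = ln\<close>, the dyadic frequency partition, \<open>\<lambda> = \<langle>n\<rangle>\<close> and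
  \<open>\<beta> = \<alpha> + 1 + \<epsilon>\<close>; the sum over \<open>n\<close> of \<open>\<langle>n\<rangle>\<^sup>\<alpha> \<langle>n\<rangle>\<^sup>-\<^sup>\<beta>\<close> converges. For the second take \<open>\<theta> = exp\<close>, the
  equidistant partition, \<open>\<lambda> = 2 ^ |m|\<close> and \<open>\<beta> = \<alpha>\<close>, and sum over the dyadic pieces of \<open>f\<close>, whose
  logarithmic supports overlap boundedly; here the factor \<open>2 powr - (\<epsilon> |m|)\<close> makes the sum
  over \<open>m\<close> converge.\<close>

text \<open>A merely bounded continuous \<open>g\<close> comes without derivatives and without a
  Fourier transform given by an integral, so all work is shifted to kernels: only convolutions of
  \<open>g\<close> with inverse transforms of compactly supported symbols are formed. A frequency
  piece of \<open>g\<close> is reproduced by convolving it again with the kernel of a cutoff that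
  equals 1 on the support of \<open>q\<^sub>i\<close>, and the derivatives fall on this second
  kernel. Integration by parts is skipped where the kernel has frequencies near 0, since the
  antiderivatives are then missing. Dilations of \<open>f\<close> by \<open>2 powi k\<close> become
  translations by \<open>k ln 2\<close> in logarithmic coordinates. In the first embedding the
  supremum over \<open>k\<close> is thus harmless, and the loss of \<open>1 + \<epsilon>\<close> is
  the price of estimating each \<open>n\<close> on its own. In the second the pieces indexed by
  \<open>k\<close> must be added, which forces the kernel to be measured in L1 on windows instead of
  in the sup norm.\<close>

section \<open>Finite differentiability\<close>

text \<open>\<open>smooth\<close> iterates a derivative on the whole line, whereas the proof also
  needs functions such as \<open>1 / x\<close> on an open set, and finite orders. The derivative is
  existentially quantified because it is prescribed only on \<open>U\<close>; its values elsewhere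
  are irrelevant.\<close>

primrec times_diff_on :: "real set \<Rightarrow> nat \<Rightarrow> (real \<Rightarrow> complex) \<Rightarrow> bool" where
  "times_diff_on U 0 f \<longleftrightarrow> continuous_on U f"
| "times_diff_on U (Suc n) f \<longleftrightarrow>
     (\<exists>f'. (\<forall>x\<in>U. (f has_vector_derivative f' x) (at x)) \<and> times_diff_on U n f')"

lemma has_vector_derivative_transform_open:
  assumes "(f has_vector_derivative f') (at x)" "open U" "x \<in> U" "\<And>y. y \<in> U \<Longrightarrow> f y = g y"
  shows "(g has_vector_derivative f') (at x)"
  using assms has_vector_derivative_transform_within_open by blast

lemma times_diff_on_continuous: "times_diff_on U n f \<Longrightarrow> continuous_on U f"
  by (cases n) (auto intro!: continuous_at_imp_continuous_on intro: has_vector_derivative_continuous)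

lemma times_diff_on_Suc: "times_diff_on U (Suc n) f \<Longrightarrow> times_diff_on U n f"
proof (induction n arbitrary: f)
  case 0
  then show ?case using times_diff_on_continuous by (metis times_diff_on.simps(1))
next
  case (Suc n)
  then show ?case by (metis times_diff_on.simps(2))
qed

lemma times_diff_on_subset: "times_diff_on U n f \<Longrightarrow> V \<subseteq> U \<Longrightarrow> times_diff_on V n f"
  by (induction n arbitrary: f) (auto intro: continuous_on_subset)

lemma times_diff_on_cong:
  assumes "open U" "\<And>x. x \<in> U \<Longrightarrow> f x = g x" "times_diff_on U n f"
  shows "times_diff_on U n g"
proof (cases n)
  case 0
  then show ?thesis using assms by (simp cong: continuous_on_cong)
next
  case (Suc m)
  then obtain f' where "\<forall>x\<in>U. (f has_vector_derivative f' x) (at x)" "times_diff_on U m f'"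
    using assms by auto
  then have "\<forall>x\<in>U. (g has_vector_derivative f' x) (at x)"
    using has_vector_derivative_transform_open[where f = f and g = g, OF _ assms(1) _ assms(2)]
    by blast
  then show ?thesis using \<open>times_diff_on U m f'\<close> Suc by auto
qed

lemma times_diff_on_const [simp]: "times_diff_on U n (\<lambda>x. c)"
proof (induction n arbitrary: c)
  case (Suc n)
  show ?case using Suc[of 0] by (auto intro!: exI[of _ "\<lambda>x. 0"])
qed simp

lemma times_diff_on_add:
  "times_diff_on U n f \<Longrightarrow> times_diff_on U n g \<Longrightarrow> times_diff_on U n (\<lambda>x. f x + g x)"
proof (induction n arbitrary: f g)
  case 0 then show ?case by (simp add: continuous_on_add)
next
  case (Suc n)
  then obtain f' g' where "\<forall>x\<in>U. (f has_vector_derivative f' x) (at x)" "times_diff_on U n f'"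
    "\<forall>x\<in>U. (g has_vector_derivative g' x) (at x)" "times_diff_on U n g'" by auto
  then show ?case using Suc.IH[of f' g']
    by (auto intro!: exI[of _ "\<lambda>x. f' x + g' x"] has_vector_derivative_add)
qed

lemma times_diff_on_mult:
  "times_diff_on U n f \<Longrightarrow> times_diff_on U n g \<Longrightarrow> times_diff_on U n (\<lambda>x. f x * g x)"
proof (induction n arbitrary: f g)
  case 0 then show ?case by (simp add: continuous_on_mult)
next
  case (Suc n)
  then obtain f' g' where *: "\<forall>x\<in>U. (f has_vector_derivative f' x) (at x)" "times_diff_on U n f'"
    "\<forall>x\<in>U. (g has_vector_derivative g' x) (at x)" "times_diff_on U n g'" by auto
  have "times_diff_on U n (\<lambda>x. f x * g' x + f' x * g x)"
    using Suc.IH[OF times_diff_on_Suc[OF Suc.prems(1)] *(4)]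
      Suc.IH[OF *(2) times_diff_on_Suc[OF Suc.prems(2)]] by (rule times_diff_on_add)
  with * show ?case
    by (auto intro!: exI[of _ "\<lambda>x. f x * g' x + f' x * g x"] has_vector_derivative_mult)
qed

lemma times_diff_on_sum:
  "(\<And>i. i \<in> I \<Longrightarrow> times_diff_on U n (f i)) \<Longrightarrow> times_diff_on U n (\<lambda>x. \<Sum>i\<in>I. f i x)"
  by (induction I rule: infinite_finite_induct) (auto intro: times_diff_on_add)

lemma times_diff_on_power: "times_diff_on U n f \<Longrightarrow> times_diff_on U n (\<lambda>x. f x ^ k)"
  by (induction k) (auto intro: times_diff_on_mult)

lemma times_diff_on_of_real [simp]: "times_diff_on U n of_real"
proof (cases n)
  case 0 then show ?thesis by (simp add: continuous_on_of_real_id)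
next
  case (Suc m)
  have "(of_real has_vector_derivative 1) (at x)" for x :: real
    by (rule has_vector_derivative_eq_rhs[OF has_vector_derivative_of_real[OF DERIV_ident]]) simp
  then show ?thesis unfolding Suc by (auto intro!: exI[of _ "\<lambda>x. 1"])
qed

text \<open>Since \<open>\<theta>'\<close> is controlled to every order, the induction runs on the
  order of \<open>f\<close> alone: the chain rule produces \<open>\<theta>'\<close> times a
  composite of one order less.\<close>

lemma times_diff_on_compose:
  assumes "\<And>x. x \<in> V \<Longrightarrow> (\<theta> has_real_derivative \<theta>' x) (at x)"
    and "\<And>m. times_diff_on V m (\<lambda>x. of_real (\<theta>' x))" and "\<And>x. x \<in> V \<Longrightarrow> \<theta> x \<in> U"
  shows "times_diff_on U n f \<Longrightarrow> times_diff_on V n (\<lambda>x. f (\<theta> x))"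
proof (induction n arbitrary: f)
  case 0
  have "continuous_on V \<theta>"
    using assms(1) by (auto intro!: continuous_at_imp_continuous_on DERIV_isCont)
  with 0 assms(3) show ?case by (auto intro: continuous_on_compose2)
next
  case (Suc n)
  then obtain f' where f': "\<forall>x\<in>U. (f has_vector_derivative f' x) (at x)" "times_diff_on U n f'"
    by auto
  have "times_diff_on V n (\<lambda>x. of_real (\<theta>' x) * f' (\<theta> x))"
    using assms(2) Suc.IH[OF f'(2)] by (rule times_diff_on_mult)
  moreover have "((\<lambda>x. f (\<theta> x)) has_vector_derivative of_real (\<theta>' x) * f' (\<theta> x)) (at x)"
    if "x \<in> V" for x
    using vector_diff_chain_at[of \<theta> "\<theta>' x" x f "f' (\<theta> x)"] assms f'(1) that
    by (auto simp: o_def has_real_derivative_iff_has_vector_derivative scaleR_conv_of_real)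
  ultimately show ?case by (auto intro!: exI[of _ "\<lambda>x. of_real (\<theta>' x) * f' (\<theta> x)"])
qed

lemma times_diff_on_affine:
  assumes "times_diff_on UNIV n f"
  shows "times_diff_on UNIV n (\<lambda>x. f (c * x + d))"
  by (rule times_diff_on_compose[OF _ _ _ assms, where \<theta>' = "\<lambda>_. c"])
    (auto intro!: derivative_eq_intros)

lemma times_diff_on_exp: "times_diff_on UNIV n (\<lambda>x. of_real (exp x))"
proof (induction n)
  case 0 then show ?case by (auto intro!: continuous_intros)
next
  case (Suc n)
  have "((\<lambda>x. complex_of_real (exp x)) has_vector_derivative of_real (exp x)) (at x)" for x
    by (rule has_vector_derivative_of_real) (auto intro!: derivative_eq_intros)
  with Suc show ?case by (auto intro!: exI[of _ "\<lambda>x. of_real (exp x)"])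
qed

lemma times_diff_on_compose_exp:
  "times_diff_on {0<..} n f \<Longrightarrow> times_diff_on UNIV n (\<lambda>x. f (exp x))"
  by (rule times_diff_on_compose[where \<theta>' = exp]) (auto intro: times_diff_on_exp)

lemma times_diff_on_inverse: "times_diff_on (- {0}) n (\<lambda>x. inverse (of_real x))"
proof (induction n)
  case 0 then show ?case by (auto intro!: continuous_intros)
next
  case (Suc n)
  have "((\<lambda>x::real. inverse (complex_of_real x)) has_vector_derivative
     - 1 * (inverse (of_real x) * inverse (of_real x))) (at x)" if "x \<noteq> 0" for x
  proof -
    have "(inverse has_real_derivative - (inverse x * inverse x)) (at x)"
      using that by (auto intro!: derivative_eq_intros simp: power2_eq_square)
    then have "((\<lambda>x. complex_of_real (inverse x)) has_vector_derivative
        of_real (- (inverse x * inverse x))) (at x)"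
      by (rule has_vector_derivative_of_real)
    then show ?thesis by simp
  qed
  moreover have "times_diff_on (- {0}) n
      (\<lambda>x. - 1 * (inverse (complex_of_real x) * inverse (of_real x)))"
    by (intro times_diff_on_mult Suc times_diff_on_const)
  ultimately show ?case
    unfolding times_diff_on.simps
    by (intro exI[of _ "\<lambda>x. - 1 * (inverse (of_real x) * inverse (of_real x))"]) blast
qed

text \<open>The open sets \<open>U\<close> and \<open>- K\<close> cover the line, and the derivative
  vanishes off \<open>K\<close> again, so the statement reproduces itself one order lower. It
  removes the singularity at 0 when a symbol is divided by a power of the frequency.\<close>

lemma times_diff_on_extend:
  assumes "open U" "closed K" "K \<subseteq> U"
  shows "times_diff_on U n f \<Longrightarrow> (\<And>x. x \<notin> K \<Longrightarrow> f x = 0) \<Longrightarrow> times_diff_on UNIV n f"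
proof (induction n arbitrary: f)
  case 0
  have "continuous_on (U \<union> - K) f"
  proof (rule continuous_on_open_Un)
    show "continuous_on (- K) f"
      using 0(2) by (metis ComplD continuous_on_cong continuous_on_const)
  qed (use assms 0 in auto)
  moreover have "U \<union> - K = UNIV" using assms by auto
  ultimately show ?case by simp
next
  case (Suc n)
  then obtain f' where f': "\<forall>x\<in>U. (f has_vector_derivative f' x) (at x)" "times_diff_on U n f'"
    by auto
  have zero: "(f has_vector_derivative 0) (at x)" if "x \<notin> K" for x
    by (rule has_vector_derivative_transform_open[of "\<lambda>_. 0" _ _ "- K"])
      (use assms Suc that in auto)
  define g where "g x = (if x \<in> U then f' x else 0)" for x
  have "g x = 0" if "x \<notin> K" for x
    using vector_derivative_unique_at[OF zero[OF that]] f'(1) by (cases "x \<in> U") (auto simp: g_def)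
  moreover have "times_diff_on U n g"
    by (rule times_diff_on_cong[OF assms(1) _ f'(2)]) (simp add: g_def)
  ultimately have "times_diff_on UNIV n g" using Suc.IH by blast
  moreover have "(f has_vector_derivative g x) (at x)" for x
    using f'(1) zero assms by (auto simp: g_def)
  ultimately show ?case by auto
qed

lemma smooth_imp_times_diff_on: "smooth f \<Longrightarrow> times_diff_on UNIV n f"
proof (induction n arbitrary: f)
  case 0
  then have "f differentiable (at x)" for x
    unfolding smooth_def by (auto dest: spec[of _ "0::nat"])
  then show ?case
    by (auto intro!: continuous_at_imp_continuous_on differentiable_imp_continuous_within)
next
  case (Suc n)
  let ?D = "\<lambda>t. vector_derivative f (at t)"
  have "f differentiable (at x)" for x
    using Suc.prems unfolding smooth_def by (auto dest: spec[of _ "0::nat"])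
  moreover have "smooth ?D"
    unfolding smooth_def
  proof (intro allI)
    fix k x
    show "((\<lambda>g t. vector_derivative g (at t)) ^^ k) ?D differentiable at x"
      using Suc.prems unfolding smooth_def
      by (metis comp_apply funpow_Suc_right)
  qed
  ultimately show ?case using Suc.IH
    by (auto intro!: exI[of _ ?D] simp: vector_derivative_works[symmetric])
qed

section \<open>Symbols and their inverse Fourier transforms\<close>

definition bounded_support :: "(real \<Rightarrow> complex) \<Rightarrow> bool" where
  "bounded_support a \<longleftrightarrow> (\<exists>M. \<forall>x. \<bar>x\<bar> > M \<longrightarrow> a x = 0)"

lemma bounded_supportE:
  assumes "bounded_support a"
  obtains M where "M > 0" "\<And>x. \<bar>x\<bar> \<ge> M \<Longrightarrow> a x = 0"
proof -
  obtain M where "\<forall>x. \<bar>x\<bar> > M \<longrightarrow> a x = 0" using assms unfolding bounded_support_def by auto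
  then show ?thesis by (intro that[of "\<bar>M\<bar> + 1"]) auto
qed

lemma bounded_support_mult: "bounded_support a \<Longrightarrow> bounded_support (\<lambda>x. b x * a x)"
  by (auto simp: bounded_support_def)

lemma bounded_support_scale:
  assumes "bounded_support a" "c \<noteq> 0"
  shows "bounded_support (\<lambda>x. a (c * x))"
proof -
  obtain M where M: "M > 0" "\<And>x. \<bar>x\<bar> \<ge> M \<Longrightarrow> a x = 0" using assms bounded_supportE by blast
  have "a (c * x) = 0" if "\<bar>x\<bar> > M / \<bar>c\<bar>" for x
    using that assms M(2)[of "c * x"] by (auto simp: field_simps abs_mult)
  then show ?thesis unfolding bounded_support_def by blast
qed

text \<open>Two derivatives make the inverse transform decay like \<open>1 / (1 + x^2)\<close>,
  hence integrable; bounded support makes it differentiable, with derivatives again given by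
  symbols.\<close>

definition symbol :: "(real \<Rightarrow> complex) \<Rightarrow> bool" where
  "symbol a \<longleftrightarrow> times_diff_on UNIV 2 a \<and> bounded_support a"

lemma symbol_continuous: "symbol a \<Longrightarrow> continuous_on UNIV a"
  using times_diff_on_continuous unfolding symbol_def by blast

lemma symbol_mult_left: "symbol a \<Longrightarrow> times_diff_on UNIV 2 b \<Longrightarrow> symbol (\<lambda>x. b x * a x)"
  unfolding symbol_def using times_diff_on_mult bounded_support_mult by blast

lemma symbol_mult: "symbol a \<Longrightarrow> symbol b \<Longrightarrow> symbol (\<lambda>x. a x * b x)"
  using symbol_mult_left unfolding symbol_def by blast

lemma symbol_scale: "symbol a \<Longrightarrow> c \<noteq> 0 \<Longrightarrow> symbol (\<lambda>x. a (c * x))"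
  unfolding symbol_def using times_diff_on_affine[of 2 a c 0] bounded_support_scale by auto

lemma times_diff_on_iota_power: "times_diff_on U n (\<lambda>x. (\<i> * of_real x) ^ k)"
  by (intro times_diff_on_power times_diff_on_mult) auto

lemma symbol_iota_power: "symbol a \<Longrightarrow> symbol (\<lambda>x. (\<i> * of_real x) ^ k * a x)"
  by (intro symbol_mult_left times_diff_on_iota_power)

lemma integrable_bounded_support:
  fixes a :: "real \<Rightarrow> complex"
  assumes "continuous_on UNIV a" "bounded_support a"
  shows "integrable lborel a"
proof -
  obtain M where M: "M > 0" "\<And>x. \<bar>x\<bar> \<ge> M \<Longrightarrow> a x = 0" using assms bounded_supportE by blast
  have "set_integrable lborel {-M..M} a"
    using assms continuous_on_subset by (intro borel_integrable_atLeastAtMost') blast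
  moreover have "(\<lambda>x. indicator {-M..M} x *\<^sub>R a x) = a"
    using M by (force simp: indicator_def)
  ultimately show ?thesis by (simp add: set_integrable_def)
qed

lemma norm_inv_fourier_le: "norm (inv_fourier a x) \<le> (\<integral>\<xi>. norm (a \<xi>) \<partial>lborel)"
proof -
  have *: "1 / (2 * pi) \<le> 1" using pi_ge_two by (simp add: field_simps)
  have "norm (inv_fourier a x) = 1 / (2 * pi) * norm (\<integral>\<xi>. cis (x * \<xi>) * a \<xi> \<partial>lborel)"
    by (simp add: inv_fourier_def norm_mult norm_divide)
  also have "norm (\<integral>\<xi>. cis (x * \<xi>) * a \<xi> \<partial>lborel) \<le> (\<integral>\<xi>. norm (cis (x * \<xi>) * a \<xi>) \<partial>lborel)"
    by (rule integral_norm_bound)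
  also have "\<dots> = (\<integral>\<xi>. norm (a \<xi>) \<partial>lborel)" by (simp add: norm_mult)
  finally have "norm (inv_fourier a x) \<le> 1 / (2 * pi) * (\<integral>\<xi>. norm (a \<xi>) \<partial>lborel)"
    by (simp add: divide_right_mono)
  also have "\<dots> \<le> 1 * (\<integral>\<xi>. norm (a \<xi>) \<partial>lborel)"
    using * by (intro mult_right_mono) auto
  finally show ?thesis by simp
qed

lemma continuous_cis [continuous_intros]:
  "continuous_on S f \<Longrightarrow> continuous_on S (\<lambda>x. cis (f x))"
  by (simp add: cis_conv_exp) (intro continuous_intros)

lemma cis_measurable [measurable]: "cis \<in> borel_measurable borel"
  by (intro borel_measurable_continuous_onI continuous_intros)

lemma inv_fourier_eq_integral:
  assumes "continuous_on UNIV a" "\<And>x. \<bar>x\<bar> \<ge> M \<Longrightarrow> a x = 0"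
  shows "(\<integral>\<xi>. cis (x * \<xi>) * a \<xi> \<partial>lborel) = integral {-M..M} (\<lambda>\<xi>. cis (x * \<xi>) * a \<xi>)"
proof -
  have "(\<integral>\<xi>. cis (x * \<xi>) * a \<xi> \<partial>lborel) = (LINT \<xi>:{-M..M}|lborel. cis (x * \<xi>) * a \<xi>)"
    unfolding set_lebesgue_integral_def using assms(2)
    by (intro Bochner_Integration.integral_cong) (force simp: indicator_def)+
  also have "\<dots> = integral {-M..M} (\<lambda>\<xi>. cis (x * \<xi>) * a \<xi>)"
    by (intro set_borel_integral_eq_integral(2) borel_integrable_atLeastAtMost' continuous_intros
        continuous_on_subset[OF assms(1)]) auto
  finally show ?thesis .
qed

lemma has_vector_derivative_cis:
  "((\<lambda>x. cis (c * x + d)) has_vector_derivative (\<i> * of_real c) * cis (c * x + d)) (at x)"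
proof -
  have "((\<lambda>x. exp (\<i> * (of_real c * x + of_real d))) has_field_derivative
      (\<i> * of_real c) * exp (\<i> * (of_real c * of_real x + of_real d))) (at (of_real x))"
    by (auto intro!: derivative_eq_intros)
  from has_vector_derivative_real_field[OF this] show ?thesis
    by (simp add: cis_conv_exp)
qed

text \<open>Bounded support reduces the integral to a compact interval, where the Leibniz rule
  applies. Read backwards, dividing the symbol by \<open>\<i> \<xi>\<close> gives an antiderivative
  of the kernel.\<close>

lemma has_vector_derivative_inv_fourier:
  assumes "continuous_on UNIV a" "bounded_support a"
  shows "(inv_fourier a has_vector_derivative inv_fourier (\<lambda>\<xi>. \<i> * of_real \<xi> * a \<xi>) x) (at x)"
proof -
  obtain M where M: "M > 0" "\<And>x. \<bar>x\<bar> \<ge> M \<Longrightarrow> a x = 0" using assms bounded_supportE by blast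
  have cont: "continuous_on S a" for S using assms(1) continuous_on_subset by blast
  have D: "((\<lambda>x. integral (cbox (-M) M) (\<lambda>\<xi>. cis (x * \<xi>) * a \<xi>)) has_vector_derivative
      integral (cbox (-M) M) (\<lambda>\<xi>. \<i> * of_real \<xi> * cis (x * \<xi>) * a \<xi>)) (at x within UNIV)"
  proof (rule leibniz_rule_vector_derivative)
    fix x t :: real
    show "((\<lambda>x. cis (x * t) * a t) has_vector_derivative \<i> * of_real t * cis (x * t) * a t)
        (at x within UNIV)"
      using has_vector_derivative_mult_left[OF has_vector_derivative_cis[of t 0 x], of "a t"]
      by (simp add: mult_ac)
    show "(\<lambda>\<xi>. cis (x * \<xi>) * a \<xi>) integrable_on cbox (- M) M"
      by (intro integrable_continuous continuous_intros cont)
    show "continuous_on (UNIV \<times> cbox (- M) M) (\<lambda>(x, t). \<i> * of_real t * cis (x * t) * a t)"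
      unfolding split_beta
      by (intro continuous_intros continuous_on_compose2[OF assms(1)]) auto
  qed auto
  have "inv_fourier a = (\<lambda>x. 1 / (2 * of_real pi) * integral (cbox (-M) M) (\<lambda>\<xi>. cis (x * \<xi>) * a \<xi>))"
    using inv_fourier_eq_integral[OF assms(1) M(2)] by (auto simp: inv_fourier_def)
  moreover have "inv_fourier (\<lambda>\<xi>. \<i> * of_real \<xi> * a \<xi>) x
     = 1 / (2 * of_real pi) * integral (cbox (-M) M) (\<lambda>\<xi>. \<i> * of_real \<xi> * cis (x * \<xi>) * a \<xi>)"
  proof -
    have "(\<integral>\<xi>. cis (x * \<xi>) * (\<i> * of_real \<xi> * a \<xi>) \<partial>lborel)
       = integral {-M..M} (\<lambda>\<xi>. cis (x * \<xi>) * (\<i> * of_real \<xi> * a \<xi>))"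
      by (rule inv_fourier_eq_integral) (auto intro!: continuous_intros cont M)
    also have "\<dots> = integral (cbox (-M) M) (\<lambda>\<xi>. \<i> * of_real \<xi> * cis (x * \<xi>) * a \<xi>)"
      by (simp add: mult_ac)
    finally show ?thesis by (simp add: inv_fourier_def)
  qed
  ultimately show ?thesis
    using has_vector_derivative_mult_right[OF D, of "1 / (2 * of_real pi)"] by simp
qed

lemma inv_fourier_continuous:
  "continuous_on UNIV a \<Longrightarrow> bounded_support a \<Longrightarrow> continuous_on S (inv_fourier a)"
  using has_vector_derivative_inv_fourier has_vector_derivative_continuous
  by (meson continuous_at_imp_continuous_on)

lemma inv_fourier_measurable [measurable (raw)]:
  "symbol a \<Longrightarrow> inv_fourier a \<in> borel_measurable borel"
  by (intro borel_measurable_continuous_onI inv_fourier_continuous)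
     (auto simp: symbol_def dest: times_diff_on_continuous)

text \<open>The derivative of \<open>cis (x * \<xi>) * a \<xi>\<close> in \<open>\<xi>\<close>
  integrates to 0, because \<open>a\<close> vanishes at both ends of a large interval.\<close>

lemma inv_fourier_deriv_symbol:
  assumes D: "\<And>\<xi>. (a has_vector_derivative a' \<xi>) (at \<xi>)" and cont: "continuous_on UNIV a'"
    and "bounded_support a"
  shows "inv_fourier a' x = - (\<i> * of_real x) * inv_fourier a x" and "bounded_support a'"
proof -
  obtain M where M: "M > 0" "\<And>x. \<bar>x\<bar> \<ge> M \<Longrightarrow> a x = 0" using assms bounded_supportE by blast
  have "(a has_vector_derivative 0) (at \<xi>)" if "\<bar>\<xi>\<bar> > M" for \<xi>
    by (rule has_vector_derivative_transform_open[of "\<lambda>_. 0" _ _ "{\<xi>. \<bar>\<xi>\<bar> > M}"])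
      (use M that in \<open>auto intro!: open_Collect_less continuous_intros\<close>)
  then have z: "a' \<xi> = 0" if "\<bar>\<xi>\<bar> > M" for \<xi>
    using that D vector_derivative_unique_at by blast
  then show "bounded_support a'" by (auto simp: bounded_support_def)
  have conta: "continuous_on S a" for S
    by (meson D continuous_at_imp_continuous_on has_vector_derivative_continuous)
  have conta': "continuous_on S a'" for S using cont continuous_on_subset by blast
  have deriv: "((\<lambda>\<xi>. cis (x * \<xi>) * a \<xi>) has_vector_derivative
      cis (x * \<xi>) * a' \<xi> + \<i> * of_real x * cis (x * \<xi>) * a \<xi>) (at \<xi>)" for \<xi>
    using has_vector_derivative_mult[OF has_vector_derivative_cis[of x 0] D, of \<xi>] by simp
  \<comment> \<open>The interval reaches to \<open>M + 1\<close> because \<open>a'\<close> has been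
    shown to vanish only for \<open>\<bar>\<xi>\<bar> > M\<close>, not at the endpoints.\<close>
  have "((\<lambda>\<xi>. cis (x * \<xi>) * a' \<xi> + \<i> * of_real x * cis (x * \<xi>) * a \<xi>) has_integral
      (cis (x * (M + 1)) * a (M + 1) - cis (x * (- (M + 1))) * a (- (M + 1)))) {-(M+1)..M+1}"
    using M(1) by (intro fundamental_theorem_of_calculus)
      (auto intro!: has_vector_derivative_at_within deriv)
  then have "integral {-(M+1)..M+1} (\<lambda>\<xi>. cis (x * \<xi>) * a' \<xi> + \<i> * of_real x * cis (x * \<xi>) * a \<xi>) = 0"
    using M by (simp add: integral_unique)
  also have "integral {-(M+1)..M+1} (\<lambda>\<xi>. cis (x * \<xi>) * a' \<xi> + \<i> * of_real x * cis (x * \<xi>) * a \<xi>)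
    = integral {-(M+1)..M+1} (\<lambda>\<xi>. cis (x * \<xi>) * a' \<xi>)
      + integral {-(M+1)..M+1} (\<lambda>\<xi>. \<i> * of_real x * (cis (x * \<xi>) * a \<xi>))"
    unfolding mult.assoc
    by (intro Henstock_Kurzweil_Integration.integral_add integrable_continuous_interval
        continuous_intros conta conta')
  finally have "integral {-(M+1)..M+1} (\<lambda>\<xi>. cis (x * \<xi>) * a' \<xi>)
      = - (\<i> * of_real x * integral {-(M+1)..M+1} (\<lambda>\<xi>. cis (x * \<xi>) * a \<xi>))"
    by (simp add: eq_neg_iff_add_eq_0)
  moreover have "(\<integral>\<xi>. cis (x * \<xi>) * a' \<xi> \<partial>lborel) = integral {-(M+1)..M+1} (\<lambda>\<xi>. cis (x * \<xi>) * a' \<xi>)"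
    by (rule inv_fourier_eq_integral) (auto intro!: conta' z)
  moreover have "(\<integral>\<xi>. cis (x * \<xi>) * a \<xi> \<partial>lborel) = integral {-(M+1)..M+1} (\<lambda>\<xi>. cis (x * \<xi>) * a \<xi>)"
    by (rule inv_fourier_eq_integral) (auto intro!: conta M)
  ultimately show "inv_fourier a' x = - (\<i> * of_real x) * inv_fourier a x"
    by (simp add: inv_fourier_def)
qed

lemma integrable_inverse_one_plus_square: "integrable lborel (\<lambda>x::real. inverse (1 + x\<^sup>2))"
  using integrable_inverse_1_plus_square by (simp add: set_integrable_def einterval_def)

text \<open>Two applications of the preceding rule identify \<open>x^2\<close> times the kernel with
  minus the transform of the second derivative. Both transforms are bounded, so the kernel is
  dominated by a multiple of \<open>1 / (1 + x^2)\<close>.\<close>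

lemma integrable_inv_fourier:
  assumes "symbol a"
  shows "integrable lborel (inv_fourier a)"
proof -
  obtain a' a'' where D: "\<And>\<xi>. (a has_vector_derivative a' \<xi>) (at \<xi>)"
    "\<And>\<xi>. (a' has_vector_derivative a'' \<xi>) (at \<xi>)" "continuous_on UNIV a''"
    using assms unfolding symbol_def by (auto simp: numeral_2_eq_2)
  have c': "continuous_on UNIV a'"
    by (meson D continuous_at_imp_continuous_on has_vector_derivative_continuous)
  have b: "bounded_support a" using assms symbol_def by blast
  note 1 = inv_fourier_deriv_symbol[OF D(1) c' b]
  note 2 = inv_fourier_deriv_symbol[OF D(2,3) 1(2)]
  define C where "C = (\<integral>\<xi>. norm (a \<xi>) \<partial>lborel) + (\<integral>\<xi>. norm (a'' \<xi>) \<partial>lborel)"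
  have bound: "norm (inv_fourier a x) \<le> norm (C * inverse (1 + x\<^sup>2))" for x
  proof -
    have "inv_fourier a'' x = - of_real (x\<^sup>2) * inv_fourier a x"
      using 1(1)[of x] 2(1)[of x] by (simp add: power2_eq_square algebra_simps)
    then have "norm (inv_fourier a'' x) = x\<^sup>2 * norm (inv_fourier a x)"
      by (simp add: norm_mult norm_power)
    then have "(1 + x\<^sup>2) * norm (inv_fourier a x) \<le> C"
      using norm_inv_fourier_le[of a x] norm_inv_fourier_le[of a'' x]
      by (simp add: C_def algebra_simps)
    moreover have "1 + x\<^sup>2 > 0" by (simp add: add_pos_nonneg)
    ultimately show ?thesis by (simp add: field_simps abs_mult)
  qed
  show ?thesis
    by (rule Bochner_Integration.integrable_bound[of _ "\<lambda>x. C * inverse (1 + x\<^sup>2)"])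
      (use bound integrable_inverse_one_plus_square inv_fourier_measurable[OF assms] in auto)
qed

section \<open>Fourier inversion and convolution\<close>

text \<open>The L1 norm of the convolution kernel, which bounds the operator norm of the Fourier
  multiplier on bounded functions.\<close>

definition inv_fourier_L1 :: "(real \<Rightarrow> complex) \<Rightarrow> real" where
  "inv_fourier_L1 a = (\<integral>x. norm (inv_fourier a x) \<partial>lborel)"

lemma inv_fourier_L1_nonneg [simp]: "inv_fourier_L1 a \<ge> 0"
  by (simp add: inv_fourier_L1_def)

lemma inv_fourier_scale:
  assumes "c \<noteq> 0"
  shows "inv_fourier (\<lambda>\<xi>. a (c * \<xi>)) x = of_real (1 / \<bar>c\<bar>) * inv_fourier a (x / c)"
  using assms unfolding inv_fourier_def
  by (subst lborel_integral_real_affine[of c _ 0]) (auto simp: scaleR_conv_of_real)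

text \<open>This invariance makes all later constants uniform in the frequency radius and in the
  mollification scale. Negative factors cover the reflected dyadic blocks.\<close>

lemma inv_fourier_L1_scale:
  assumes "c \<noteq> 0"
  shows "inv_fourier_L1 (\<lambda>\<xi>. a (c * \<xi>)) = inv_fourier_L1 a"
  using assms unfolding inv_fourier_L1_def inv_fourier_scale[OF assms]
  by (subst lborel_integral_real_affine[of c _ 0]) (auto simp: norm_mult norm_divide)

lemma integral_reflect_shift:
  fixes f :: "real \<Rightarrow> 'a :: {banach, second_countable_topology}"
  shows "(\<integral>y. f (x - y) \<partial>lborel) = (\<integral>y. f y \<partial>lborel)"
  using lborel_integral_real_affine[of "-1" f x] by simp

lemma integrable_reflect_shift:
  fixes f :: "real \<Rightarrow> 'a :: {banach, second_countable_topology}"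
  shows "integrable lborel f \<Longrightarrow> integrable lborel (\<lambda>y. f (x - y))"
  using lborel_integrable_real_affine[of f "-1" x] by simp

lemma integral_shift:
  fixes f :: "real \<Rightarrow> 'a :: {banach, second_countable_topology}"
  shows "(\<integral>y. f (y + x) \<partial>lborel) = (\<integral>y. f y \<partial>lborel)"
  using lborel_integral_real_affine[of 1 f x] by (simp add: add.commute)

text \<open>For fixed \<open>y\<close> the integral of \<open>norm (u (\<theta> y - s))\<close> over
  \<open>s\<close> is the L1 norm of \<open>u\<close>, whatever \<open>\<theta>\<close> is. The free
  \<open>\<theta>\<close> and the bounded factor \<open>k\<close> let one lemma serve Fourier
  inversion, products of symbols, associativity and the pairing with a change of variables.\<close>

lemma integrable_kernel:
  fixes u v :: "real \<Rightarrow> complex" and k :: "real \<times> real \<Rightarrow> complex"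
  assumes u: "integrable lborel u" and v: "integrable lborel v"
    and [measurable]: "\<theta> \<in> borel_measurable borel" "k \<in> borel_measurable borel"
    and k: "\<And>p. norm (k p) \<le> B"
  shows "integrable (lborel \<Otimes>\<^sub>M lborel) (\<lambda>(y, s). v y * u (\<theta> y - s) * k (y, s))"
proof -
  have [measurable]: "u \<in> borel_measurable borel" "v \<in> borel_measurable borel"
    using u v by (auto dest: borel_measurable_integrable)
  have [measurable]: "k \<in> borel_measurable (borel \<Otimes>\<^sub>M borel)"
    by (simp add: borel_prod)
  have "integrable (lborel \<Otimes>\<^sub>M lborel) (\<lambda>(y, s). B * (norm (v y) * norm (u (\<theta> y - s))))"
  proof (rule lborel_pair.Fubini_integrable)
    have "(\<lambda>y. \<integral>s. norm (case (y, s) of (y, s) \<Rightarrow> B * (norm (v y) * norm (u (\<theta> y - s)))) \<partial>lborel)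
      = (\<lambda>y. norm (v y) * (\<bar>B\<bar> * (\<integral>s. norm (u s) \<partial>lborel)))"
      using integral_reflect_shift[of "\<lambda>s. norm (u s)"] by (simp add: abs_mult mult_ac)
    then show "integrable lborel
        (\<lambda>y. \<integral>s. norm (case (y, s) of (y, s) \<Rightarrow> B * (norm (v y) * norm (u (\<theta> y - s)))) \<partial>lborel)"
      using v by simp
    show "AE y in lborel. integrable lborel
        (\<lambda>s. case (y, s) of (y, s) \<Rightarrow> B * (norm (v y) * norm (u (\<theta> y - s))))"
      using integrable_reflect_shift[OF integrable_norm[OF u]] by simp
  qed (simp add: split_beta)
  then show ?thesis
  proof (rule Bochner_Integration.integrable_bound)
    show "AE p in lborel \<Otimes>\<^sub>M lborel. norm (case p of (y, s) \<Rightarrow> v y * u (\<theta> y - s) * k (y, s))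
        \<le> norm (case p of (y, s) \<Rightarrow> B * (norm (v y) * norm (u (\<theta> y - s))))"
    proof (rule AE_I2, clarify)
      fix y s
      have "norm (k (y, s)) \<le> \<bar>B\<bar>" using k[of "(y, s)"] by linarith
      then show "norm (v y * u (\<theta> y - s) * k (y, s))
          \<le> norm (B * (norm (v y) * norm (u (\<theta> y - s))))"
        by (simp add: norm_mult abs_mult mult_mono mult.commute)
    qed
  qed (simp add: split_beta)
qed

lemma Fubini_kernel:
  fixes u v :: "real \<Rightarrow> complex" and k :: "real \<times> real \<Rightarrow> complex"
  assumes "integrable lborel u" "integrable lborel v"
    and "\<theta> \<in> borel_measurable borel" "k \<in> borel_measurable borel" "\<And>p. norm (k p) \<le> B"
  shows "(\<integral>y. (\<integral>s. v y * u (\<theta> y - s) * k (y, s) \<partial>lborel) \<partial>lborel)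
       = (\<integral>s. (\<integral>y. v y * u (\<theta> y - s) * k (y, s) \<partial>lborel) \<partial>lborel)"
  using lborel_pair.Fubini_integral[OF integrable_kernel[OF assms]] by simp

text \<open>After the substitution \<open>z = \<delta> x\<close> this is the characteristic function
  of the standard normal distribution.\<close>

lemma integral_gaussian:
  assumes "\<delta> > 0"
  shows "(\<integral>x. cis (x * \<eta>) * of_real (exp (- (\<delta> * x)\<^sup>2 / 2)) \<partial>lborel)
       = of_real (2 * pi / \<delta> * std_normal_density (\<eta> / \<delta>))"
proof -
  have char: "(\<integral>z. of_real (std_normal_density z) * cis (t * z) \<partial>lborel) = of_real (exp (- t\<^sup>2 / 2))"
    for t
  proof -
    have "char std_normal_distribution t = (\<integral>z. std_normal_density z *\<^sub>R cis (t * z) \<partial>lborel)"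
      unfolding char_def by (subst integral_density) (auto simp: cis_conv_exp)
    then show ?thesis by (simp add: char_std_normal_distribution scaleR_conv_of_real)
  qed
  have e: "exp (- z\<^sup>2 / 2) = sqrt (2 * pi) * std_normal_density z" for z
    by (simp add: std_normal_density_def)
  define f where "f z = of_real (sqrt (2 * pi)) * (of_real (std_normal_density z) * cis (\<eta> / \<delta> * z))" for z
  have "cis (x * \<eta>) * of_real (exp (- (\<delta> * x)\<^sup>2 / 2)) = f (0 + \<delta> * x)" for x
    using assms by (simp only: e f_def) (simp add: mult_ac)
  then have "(\<integral>x. cis (x * \<eta>) * of_real (exp (- (\<delta> * x)\<^sup>2 / 2)) \<partial>lborel)
      = (\<integral>x. f (0 + \<delta> * x) \<partial>lborel)" by simp
  also have "\<dots> = of_real (1 / \<delta>) * (\<integral>z. f z \<partial>lborel)"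
    using lborel_integral_real_affine[of \<delta> f 0] assms by (simp add: scaleR_conv_of_real)
  also have "\<dots> = of_real (1 / \<delta> * sqrt (2 * pi) * exp (- (\<eta> / \<delta>)\<^sup>2 / 2))"
    using char[of "\<eta> / \<delta>"] unfolding f_def by simp
  also have "1 / \<delta> * sqrt (2 * pi) * exp (- (\<eta> / \<delta>)\<^sup>2 / 2) = 2 * pi / \<delta> * std_normal_density (\<eta> / \<delta>)"
    unfolding e by simp
  finally show ?thesis .
qed

text \<open>Proved by Gaussian regularisation, since the Gaussian is its own Fourier transform.\<close>

lemma fourier_inversion:
  assumes "symbol a"
  shows "(\<integral>x. inv_fourier a x * cis (- (x * \<xi>)) \<partial>lborel) = a \<xi>"
proof -
  have ca: "continuous_on UNIV a" and ba: "bounded_support a"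
    using assms symbol_continuous symbol_def by auto
  have ia: "integrable lborel a" using integrable_bounded_support[OF ca ba] .
  have [measurable]: "a \<in> borel_measurable borel" using ca by (rule borel_measurable_continuous_onI)
  note [measurable] = inv_fourier_measurable[OF assms]
  have iia: "integrable lborel (inv_fourier a)" using integrable_inv_fourier[OF assms] .
  define d where "d n = inverse (real (Suc n))" for n
  have dpos: "d n > 0" for n by (simp add: d_def)
  have dlim: "d \<longlonglongrightarrow> 0" unfolding d_def by (rule LIMSEQ_inverse_real_of_nat)
  \<comment> \<open>The inversion integral damped by a Gaussian. Its limit is computed twice: by
    dominated convergence, and, after exchanging integrals, as a limit of Gaussian averages of
    \<open>a\<close> at scale \<open>d n\<close> around \<open>\<xi>\<close>.\<close>
  define J where "J n = (\<integral>x. inv_fourier a x * cis (- (x * \<xi>)) * of_real (exp (- (d n * x)\<^sup>2 / 2)) \<partial>lborel)"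
    for n
  have "J \<longlonglongrightarrow> (\<integral>x. inv_fourier a x * cis (- (x * \<xi>)) * of_real (exp (- (0 * x)\<^sup>2 / 2)) \<partial>lborel)"
    unfolding J_def
  proof (rule integral_dominated_convergence[where w = "\<lambda>x. norm (inv_fourier a x)"])
    show "AE x in lborel. (\<lambda>n. inv_fourier a x * cis (- (x * \<xi>)) * of_real (exp (- (d n * x)\<^sup>2 / 2)))
        \<longlonglongrightarrow> inv_fourier a x * cis (- (x * \<xi>)) * of_real (exp (- (0 * x)\<^sup>2 / 2))"
      by (intro AE_I2 tendsto_intros dlim) auto
    show "AE x in lborel. norm (inv_fourier a x * cis (- (x * \<xi>)) * of_real (exp (- (d n * x)\<^sup>2 / 2)))
        \<le> norm (inv_fourier a x)" for n
      by (intro AE_I2) (simp add: norm_mult mult_left_le)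
  qed (use iia in auto)
  moreover have J_eq: "J n = (\<integral>z. a (\<xi> + d n * z) * of_real (std_normal_density z) \<partial>lborel)" for n
  proof -
    define v where "v x = complex_of_real (exp (- (d n * x)\<^sup>2 / 2))" for x
    have iv: "integrable lborel v"
    proof -
      have "integrable lborel (\<lambda>x. sqrt (2 * pi) * std_normal_density (0 + d n * x))"
        using dpos[of n] by (intro integrable_mult_right lborel_integrable_real_affine) auto
      then have "integrable lborel (\<lambda>x. complex_of_real (sqrt (2 * pi) * std_normal_density (0 + d n * x)))"
        by (rule integrable_of_real)
      then show ?thesis by (simp add: std_normal_density_def v_def[abs_def])
    qed
    \<comment> \<open>Taking the reflected symbol for \<open>u\<close> and the constant 0 for
      \<open>\<theta>\<close> turns \<open>u (\<theta> y - s)\<close> of the kernel lemma into the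
      symbol at \<open>s\<close>.\<close>
    have "integrable lborel (\<lambda>s. a (- s))"
      using integrable_reflect_shift[OF ia, of 0] by simp
    moreover have "(\<lambda>(x, \<eta>). cis (x * (\<eta> - \<xi>))) \<in> borel_measurable borel"
      unfolding split_beta by (intro borel_measurable_continuous_onI continuous_intros)
    ultimately have Fub: "(\<integral>x. (\<integral>\<eta>. v x * a (- (0 - \<eta>)) * cis (x * (\<eta> - \<xi>)) \<partial>lborel) \<partial>lborel)
        = (\<integral>\<eta>. (\<integral>x. v x * a (- (0 - \<eta>)) * cis (x * (\<eta> - \<xi>)) \<partial>lborel) \<partial>lborel)"
      using Fubini_kernel[OF _ iv, of "\<lambda>s. a (- s)" "\<lambda>_. 0" "\<lambda>(x, \<eta>). cis (x * (\<eta> - \<xi>))" 1]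
      by (simp add: split_beta)
    have "J n = (\<integral>x. (\<integral>\<eta>. v x * a (- (0 - \<eta>)) * cis (x * (\<eta> - \<xi>))
        * (1 / (2 * of_real pi)) \<partial>lborel) \<partial>lborel)"
      unfolding J_def
    proof (rule Bochner_Integration.integral_cong[OF refl])
      fix x
      have "inv_fourier a x * cis (- (x * \<xi>)) * v x
         = (\<integral>\<eta>. cis (x * \<eta>) * a \<eta> * (1 / (2 * of_real pi) * cis (- (x * \<xi>)) * v x) \<partial>lborel)"
        unfolding inv_fourier_def by (subst integral_mult_left_zero) simp
      also have "\<dots> = (\<integral>\<eta>. v x * a (- (0 - \<eta>)) * cis (x * (\<eta> - \<xi>)) * (1 / (2 * of_real pi)) \<partial>lborel)"
      proof (rule Bochner_Integration.integral_cong[OF refl])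
        fix \<eta>
        have "cis (x * (\<eta> - \<xi>)) = cis (x * \<eta>) * cis (- (x * \<xi>))"
          by (simp add: cis_mult algebra_simps)
        then show "cis (x * \<eta>) * a \<eta> * (1 / (2 * of_real pi) * cis (- (x * \<xi>)) * v x)
          = v x * a (- (0 - \<eta>)) * cis (x * (\<eta> - \<xi>)) * (1 / (2 * of_real pi))" by simp
      qed
      finally show "inv_fourier a x * cis (- (x * \<xi>)) * of_real (exp (- (d n * x)\<^sup>2 / 2)) =
          (\<integral>\<eta>. v x * a (- (0 - \<eta>)) * cis (x * (\<eta> - \<xi>))
            * (1 / (2 * of_real pi)) \<partial>lborel)"
        by (simp add: v_def)
    qed
    also have "\<dots> = (\<integral>\<eta>. (\<integral>x. v x * a (- (0 - \<eta>)) * cis (x * (\<eta> - \<xi>)) \<partial>lborel)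
         \<partial>lborel) * (1 / (2 * of_real pi))"
      using Fub by simp
    also have "(\<integral>\<eta>. (\<integral>x. v x * a (- (0 - \<eta>)) * cis (x * (\<eta> - \<xi>)) \<partial>lborel)
         \<partial>lborel) = (\<integral>\<eta>. a \<eta> * of_real (2 * pi / d n * std_normal_density ((\<eta> - \<xi>) / d n)) \<partial>lborel)"
    proof (rule Bochner_Integration.integral_cong[OF refl])
      fix \<eta>
      have "(\<integral>x. v x * a (- (0 - \<eta>)) * cis (x * (\<eta> - \<xi>)) \<partial>lborel)
        = (\<integral>x. a \<eta> * (cis (x * (\<eta> - \<xi>)) * of_real (exp (- (d n * x)\<^sup>2 / 2))) \<partial>lborel)"
        by (simp add: v_def mult_ac)
      then show "(\<integral>x. v x * a (- (0 - \<eta>)) * cis (x * (\<eta> - \<xi>)) \<partial>lborel)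
        = a \<eta> * of_real (2 * pi / d n * std_normal_density ((\<eta> - \<xi>) / d n))"
        by (simp only: integral_mult_right_zero integral_gaussian[OF dpos])
    qed
    also have "\<dots> = of_real (2 * pi) * (\<integral>z. a (\<xi> + d n * z) * of_real (std_normal_density z) \<partial>lborel)"
      using dpos[of n]
      by (subst lborel_integral_real_affine[of "d n" _ \<xi>], linarith,
        simp add: scaleR_conv_of_real mult_ac flip: integral_mult_right_zero, simp)
    finally show ?thesis by simp
  qed
  moreover have "(\<lambda>n. \<integral>z. a (\<xi> + d n * z) * of_real (std_normal_density z) \<partial>lborel)
      \<longlonglongrightarrow> (\<integral>z. a (\<xi> + 0 * z) * of_real (std_normal_density z) \<partial>lborel)"
  proof -
    obtain M where M: "M > 0" "\<And>x. \<bar>x\<bar> \<ge> M \<Longrightarrow> a x = 0" using ba bounded_supportE by blast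
    have "bounded (a ` {-M..M})"
      using ca continuous_on_subset by (intro compact_imp_bounded compact_continuous_image) blast+
    then obtain B where B: "\<And>x. x \<in> {-M..M} \<Longrightarrow> norm (a x) \<le> B" "B > 0"
      unfolding bounded_pos by blast
    have B': "norm (a x) \<le> B" for x
      using B M(2)[of x] by (cases "x \<in> {-M..M}") (auto simp: abs_real_def split: if_splits)
    show ?thesis
    proof (rule integral_dominated_convergence[where w = "\<lambda>z. B * std_normal_density z"])
      show "AE z in lborel. (\<lambda>n. a (\<xi> + d n * z) * of_real (std_normal_density z))
          \<longlonglongrightarrow> a (\<xi> + 0 * z) * of_real (std_normal_density z)"
        using ca by (intro AE_I2 tendsto_intros dlim continuous_on_tendsto_compose[OF ca]) auto
      show "AE z in lborel. norm (a (\<xi> + d n * z) * of_real (std_normal_density z))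
          \<le> B * std_normal_density z" for n
        using B' by (intro AE_I2) (simp add: norm_mult mult_right_mono)
    qed auto
  qed
  moreover have "(\<integral>z. a (\<xi> + 0 * z) * of_real (std_normal_density z) \<partial>lborel) = a \<xi>"
    by simp
  ultimately have "J \<longlonglongrightarrow> (\<integral>x. inv_fourier a x * cis (- (x * \<xi>)) \<partial>lborel)" "(\<lambda>n. J n) \<longlonglongrightarrow> a \<xi>"
    unfolding J_eq by simp_all
  then show ?thesis by (rule LIMSEQ_unique)
qed

lemma symbol_integrable: "symbol a \<Longrightarrow> integrable lborel a"
  using integrable_bounded_support symbol_continuous symbol_def by blast

text \<open>Write the second kernel as an integral over \<open>\<xi>\<close> and exchange the
  integrals: what remains inside is the inversion integral of the first kernel, equal to
  \<open>a \<xi>\<close>.\<close>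

lemma inv_fourier_mult:
  assumes a: "symbol a" and b: "symbol b"
  shows "inv_fourier (\<lambda>\<xi>. a \<xi> * b \<xi>) x = convolve (inv_fourier a) (inv_fourier b) x"
proof -
  have "integrable lborel (\<lambda>s. b (- s))"
    using integrable_reflect_shift[OF symbol_integrable[OF b], of 0] by simp
  moreover have "(\<lambda>(y, \<xi>). cis ((x - y) * \<xi>)) \<in> borel_measurable borel"
    unfolding split_beta by (intro borel_measurable_continuous_onI continuous_intros)
  ultimately have Fub:
    "(\<integral>y. (\<integral>\<xi>. inv_fourier a y * b (- (0 - \<xi>)) * cis ((x - y) * \<xi>) \<partial>lborel) \<partial>lborel)
     = (\<integral>\<xi>. (\<integral>y. inv_fourier a y * b (- (0 - \<xi>)) * cis ((x - y) * \<xi>) \<partial>lborel) \<partial>lborel)"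
    using Fubini_kernel[OF _ integrable_inv_fourier[OF a], of "\<lambda>s. b (- s)" "\<lambda>_. 0"
      "\<lambda>(y, \<xi>). cis ((x - y) * \<xi>)" 1] by (simp add: split_beta)
  have "convolve (inv_fourier a) (inv_fourier b) x
    = (\<integral>y. (\<integral>\<xi>. inv_fourier a y * b (- (0 - \<xi>)) * cis ((x - y) * \<xi>) \<partial>lborel) * (1 / (2 * of_real pi)) \<partial>lborel)"
    unfolding convolve_def
  proof (rule Bochner_Integration.integral_cong[OF refl])
    fix y
    show "inv_fourier a y * inv_fourier b (x - y)
      = (\<integral>\<xi>. inv_fourier a y * b (- (0 - \<xi>)) * cis ((x - y) * \<xi>) \<partial>lborel) * (1 / (2 * of_real pi))"
      unfolding inv_fourier_def[of b] by (simp add: mult.assoc mult.commute[of "cis _"])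
  qed
  also have "\<dots> = (\<integral>y. (\<integral>\<xi>. inv_fourier a y * b (- (0 - \<xi>)) * cis ((x - y) * \<xi>) \<partial>lborel) \<partial>lborel)
      * (1 / (2 * of_real pi))" by simp
  also have "\<dots> = (\<integral>\<xi>. (\<integral>y. inv_fourier a y * b (- (0 - \<xi>)) * cis ((x - y) * \<xi>) \<partial>lborel) \<partial>lborel)
      * (1 / (2 * of_real pi))"
    using Fub by simp
  also have "(\<integral>\<xi>. (\<integral>y. inv_fourier a y * b (- (0 - \<xi>)) * cis ((x - y) * \<xi>) \<partial>lborel) \<partial>lborel)
     = (\<integral>\<xi>. cis (x * \<xi>) * (a \<xi> * b \<xi>) \<partial>lborel)"
  proof (rule Bochner_Integration.integral_cong[OF refl])
    fix \<xi>
    have "inv_fourier a y * b (- (0 - \<xi>)) * cis ((x - y) * \<xi>)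
       = (cis (x * \<xi>) * b \<xi>) * (inv_fourier a y * cis (- (y * \<xi>)))" for y
    proof -
      have "cis ((x - y) * \<xi>) = cis (x * \<xi>) * cis (- (y * \<xi>))"
        by (simp add: cis_mult algebra_simps)
      then show ?thesis by simp
    qed
    then have "(\<integral>y. inv_fourier a y * b (- (0 - \<xi>)) * cis ((x - y) * \<xi>) \<partial>lborel)
      = (\<integral>y. (cis (x * \<xi>) * b \<xi>) * (inv_fourier a y * cis (- (y * \<xi>))) \<partial>lborel)"
      by (simp only:)
    then show "(\<integral>y. inv_fourier a y * b (- (0 - \<xi>)) * cis ((x - y) * \<xi>) \<partial>lborel)
      = cis (x * \<xi>) * (a \<xi> * b \<xi>)"
      by (simp add: fourier_inversion[OF a])
  qed
  finally show ?thesis by (simp add: inv_fourier_def[of "\<lambda>\<xi>. a \<xi> * b \<xi>"])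
qed

text \<open>Young's inequality for the convolution of two integrable kernels.\<close>

lemma inv_fourier_L1_mult:
  assumes a: "symbol a" and b: "symbol b"
  shows "inv_fourier_L1 (\<lambda>\<xi>. a \<xi> * b \<xi>) \<le> inv_fourier_L1 a * inv_fourier_L1 b"
proof -
  let ?f = "\<lambda>y s. inv_fourier a y * inv_fourier b (s - y)"
  have "integrable lborel (\<lambda>s. inv_fourier b (- s))"
    using integrable_reflect_shift[OF integrable_inv_fourier[OF b], of 0] by simp
  note int = integrable_kernel[OF this integrable_inv_fourier[OF a], of "\<lambda>y. y" "\<lambda>_. 1" 1]
  have int: "integrable (lborel \<Otimes>\<^sub>M lborel) (\<lambda>(y, s). ?f y s)" using int by simp
  have intn: "integrable (lborel \<Otimes>\<^sub>M lborel) (\<lambda>(y, s). norm (?f y s))"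
    using integrable_norm[OF int] by (simp add: case_prod_beta')
  have "inv_fourier_L1 (\<lambda>\<xi>. a \<xi> * b \<xi>) = (\<integral>s. norm (\<integral>y. ?f y s \<partial>lborel) \<partial>lborel)"
    unfolding inv_fourier_L1_def inv_fourier_mult[OF a b] convolve_def ..
  also have "\<dots> \<le> (\<integral>s. (\<integral>y. norm (?f y s) \<partial>lborel) \<partial>lborel)"
    using lborel_pair.integrable_snd[OF int] lborel_pair.integrable_snd[OF intn]
    by (intro integral_mono integrable_norm integral_norm_bound) auto
  also have "\<dots> = (\<integral>y. (\<integral>s. norm (?f y s) \<partial>lborel) \<partial>lborel)"
    by (rule lborel_pair.Fubini_integral[OF intn])
  also have "\<dots> = inv_fourier_L1 a * inv_fourier_L1 b"
    using integral_shift[of "\<lambda>s. norm (inv_fourier b s)" "- y" for y]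
    by (simp add: norm_mult inv_fourier_L1_def)
  finally show ?thesis .
qed

lemma norm_convolve_le:
  assumes a: "symbol a" and [measurable]: "g \<in> borel_measurable borel" and B: "\<And>x. norm (g x) \<le> B"
  shows "norm (convolve g (inv_fourier a) x) \<le> B * inv_fourier_L1 a"
proof -
  note ia = integrable_reflect_shift[OF integrable_norm[OF integrable_inv_fourier[OF a]], of x]
  have "norm (convolve g (inv_fourier a) x) \<le> (\<integral>y. norm (g y * inv_fourier a (x - y)) \<partial>lborel)"
    unfolding convolve_def by (rule integral_norm_bound)
  also have "\<dots> \<le> (\<integral>y. B * norm (inv_fourier a (x - y)) \<partial>lborel)"
    using ia B order_trans[OF norm_ge_zero B]
    by (intro integral_mono') (auto simp: norm_mult intro!: mult_right_mono mult_nonneg_nonneg)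
  also have "\<dots> = B * inv_fourier_L1 a"
    using integral_reflect_shift[of "\<lambda>y. norm (inv_fourier a y)" x] by (simp add: inv_fourier_L1_def)
  finally show ?thesis .
qed

lemma convolve_measurable [measurable (raw)]:
  assumes [measurable]: "g \<in> borel_measurable borel" "h \<in> borel_measurable borel"
  shows "convolve g h \<in> borel_measurable borel"
  unfolding convolve_def[abs_def] by measurable

text \<open>Composing multipliers multiplies symbols, also on a \<open>g\<close> that is only
  bounded and measurable; Fubini suffices because both kernels are integrable.\<close>

lemma convolve_assoc:
  assumes a: "symbol a" and b: "symbol b"
    and [measurable]: "g \<in> borel_measurable borel" and B: "\<And>x. norm (g x) \<le> B"
  shows "convolve (convolve g (inv_fourier a)) (inv_fourier b) x
       = convolve g (inv_fourier (\<lambda>\<xi>. a \<xi> * b \<xi>)) x"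
proof -
  have [measurable]: "(\<lambda>p::real \<times> real. g (snd p)) \<in> borel_measurable borel"
    unfolding borel_prod[symmetric] by measurable
  note Fub = Fubini_kernel[OF integrable_inv_fourier[OF a]
    integrable_reflect_shift[OF integrable_inv_fourier[OF b], of x], of "\<lambda>z. z" "\<lambda>p. g (snd p)" B]
  have "convolve (convolve g (inv_fourier a)) (inv_fourier b) x
      = (\<integral>z. (\<integral>y. inv_fourier b (x - z) * inv_fourier a (z - y) * g y \<partial>lborel) \<partial>lborel)"
    unfolding convolve_def by (simp add: mult_ac flip: integral_mult_right_zero)
  also have "\<dots> = (\<integral>y. (\<integral>z. inv_fourier b (x - z) * inv_fourier a (z - y) * g y \<partial>lborel) \<partial>lborel)"
    using Fub B by simp
  also have "\<dots> = (\<integral>y. g y * inv_fourier (\<lambda>\<xi>. a \<xi> * b \<xi>) (x - y) \<partial>lborel)"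
  proof (rule Bochner_Integration.integral_cong[OF refl])
    fix y
    have "(\<integral>z. inv_fourier b (x - z) * inv_fourier a (z - y) * g y \<partial>lborel)
       = (\<integral>z. inv_fourier b (x - (z + y)) * inv_fourier a ((z + y) - y) * g y \<partial>lborel)"
      by (rule integral_shift[symmetric])
    also have "\<dots> = (\<integral>z. inv_fourier a z * inv_fourier b (x - y - z) \<partial>lborel) * g y"
      by (simp add: algebra_simps)
    finally show "(\<integral>z. inv_fourier b (x - z) * inv_fourier a (z - y) * g y \<partial>lborel)
        = g y * inv_fourier (\<lambda>\<xi>. a \<xi> * b \<xi>) (x - y)"
      by (simp add: inv_fourier_mult[OF a b] convolve_def)
  qed
  finally show ?thesis by (simp add: convolve_def)
qed

text \<open>The kernels are dilates of one integrable kernel, whose total mass is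
  \<open>a 0 = 1\<close> by Fourier inversion at 0.\<close>

lemma convolve_approx_identity:
  assumes a: "symbol a" and "a 0 = 1" and g: "continuous_on UNIV g" and B: "\<And>x. norm (g x) \<le> B"
  shows "(\<lambda>n. convolve g (inv_fourier (\<lambda>\<xi>. a (inverse (real (Suc n)) * \<xi>))) x) \<longlonglongrightarrow> g x"
proof -
  define d where "d n = inverse (real (Suc n))" for n
  have dpos: "d n > 0" for n by (simp add: d_def)
  have dlim: "d \<longlonglongrightarrow> 0" unfolding d_def by (rule LIMSEQ_inverse_real_of_nat)
  note ia = integrable_inv_fourier[OF a]
  note [measurable] = borel_measurable_continuous_onI[OF g] inv_fourier_measurable[OF a]
  have "convolve g (inv_fourier (\<lambda>\<xi>. a (d n * \<xi>))) x
      = (\<integral>w. g (x - d n * w) * inv_fourier a w \<partial>lborel)" for n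
  proof -
    have n0: "d n \<noteq> 0" using dpos[of n] by simp
    show ?thesis
      unfolding convolve_def inv_fourier_scale[OF n0]
      using n0 dpos[of n]
      by (subst lborel_integral_real_affine[of "- d n" _ x])
        (auto simp: scaleR_conv_of_real)
  qed
  moreover have "(\<lambda>n. \<integral>w. g (x - d n * w) * inv_fourier a w \<partial>lborel)
      \<longlonglongrightarrow> (\<integral>w. g (x - 0 * w) * inv_fourier a w \<partial>lborel)"
  proof (rule integral_dominated_convergence[where w = "\<lambda>w. B * norm (inv_fourier a w)"])
    show "AE w in lborel. (\<lambda>n. g (x - d n * w) * inv_fourier a w) \<longlonglongrightarrow> g (x - 0 * w) * inv_fourier a w"
      by (intro AE_I2 tendsto_intros dlim continuous_on_tendsto_compose[OF g]) auto
    show "AE w in lborel. norm (g (x - d n * w) * inv_fourier a w) \<le> B * norm (inv_fourier a w)" for n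
      using B by (intro AE_I2) (simp add: norm_mult mult_right_mono)
  qed (use ia in auto)
  moreover have "(\<integral>w. g (x - 0 * w) * inv_fourier a w \<partial>lborel) = g x"
    using fourier_inversion[OF a, of 0] assms by simp
  ultimately have "(\<lambda>n. convolve g (inv_fourier (\<lambda>\<xi>. a (d n * \<xi>))) x) \<longlonglongrightarrow> g x" by (simp only:)
  then show ?thesis by (simp only: d_def)
qed

section \<open>Repeated integration by parts\<close>

text \<open>The definition offers a possibly different derivative for each order. Uniqueness of
  derivatives makes all of them agree on \<open>U\<close> with one function, which therefore serves
  every order.\<close>

lemma times_diff_on_derivative:
  assumes "open U" "\<And>m. times_diff_on U m f"
  obtains f' where "\<And>x. x \<in> U \<Longrightarrow> (f has_vector_derivative f' x) (at x)" "\<And>m. times_diff_on U m f'"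
proof -
  define f' where "f' x = vector_derivative f (at x)" for x
  have "times_diff_on U m f' \<and> (\<forall>x\<in>U. (f has_vector_derivative f' x) (at x))" for m
  proof -
    have "times_diff_on U (Suc m) f" by (rule assms(2))
    then obtain g where g: "\<forall>x\<in>U. (f has_vector_derivative g x) (at x)" "times_diff_on U m g"
      by auto
    then have "g x = f' x" if "x \<in> U" for x
      using that by (metis f'_def vector_derivative_at)
    then show ?thesis using g times_diff_on_cong[OF assms(1), of g f'] by auto
  qed
  then show ?thesis using that by blast
qed

text \<open>The index of \<open>W\<close> grows under integration, while that of \<open>B\<close> in
  the lemmas below grows under differentiation. The chain is finite so that \<open>N = 0\<close>
  covers kernels whose symbol does not vanish near 0.\<close>

definition iterated_antiderivs :: "nat \<Rightarrow> (nat \<Rightarrow> real \<Rightarrow> complex) \<Rightarrow> bool" where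
  "iterated_antiderivs N W \<longleftrightarrow> (\<forall>j\<le>N. continuous_on UNIV (W j)) \<and>
     (\<forall>j<N. \<forall>x. (W (Suc j) has_vector_derivative W j x) (at x))"

lemma iterated_antiderivs_Suc:
  "iterated_antiderivs (Suc N) W \<Longrightarrow> iterated_antiderivs N (\<lambda>j. W (Suc j))"
  by (auto simp: iterated_antiderivs_def)

text \<open>The margins \<open>l < l'\<close> and \<open>r' < r\<close> make all boundary terms vanish, also for the derivatives of \<open>\<eta>\<close>.\<close>

locale localization =
  fixes U :: "real set" and l l' r' r :: real and \<theta> \<theta>' :: "real \<Rightarrow> real" and \<eta> :: "real \<Rightarrow> complex"
  assumes U: "open U" "{l..r} \<subseteq> U" and bounds: "l < l'" "l' \<le> r'" "r' < r"
    and \<theta>: "\<And>x. x \<in> U \<Longrightarrow> (\<theta> has_real_derivative \<theta>' x) (at x)"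
      "\<And>m. times_diff_on U m (\<lambda>x. of_real (\<theta>' x))"
    and \<eta>: "\<And>m. times_diff_on U m \<eta>" "\<And>x. x \<in> U \<Longrightarrow> x \<notin> {l'..r'} \<Longrightarrow> \<eta> x = 0"
begin

lemma continuous_\<theta>: "continuous_on {l..r} \<theta>"
  using \<theta>(1) U by (auto intro!: continuous_at_imp_continuous_on DERIV_isCont)

lemma continuous_compose_\<theta>: "continuous_on UNIV h \<Longrightarrow> continuous_on {l..r} (\<lambda>y. h (\<theta> y))"
  using continuous_\<theta> by (auto intro: continuous_on_compose2)

text \<open>The product of \<open>p\<close>, \<open>B o \<theta>\<close> and \<open>W\<close>
  vanishes at both ends. The two remaining integrals have the original shape, with \<open>p'\<close>
  or \<open>p \<theta>'\<close> as new cutoff, which is what allows iteration.\<close>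

lemma integration_by_parts_step:
  fixes p :: "real \<Rightarrow> complex"
  assumes p: "\<And>x. x \<in> U \<Longrightarrow> (p has_vector_derivative p' x) (at x)" "continuous_on U p'"
    "\<And>x. x \<in> U \<Longrightarrow> x \<notin> {l'..r'} \<Longrightarrow> p x = 0"
    and B: "\<And>x. (B has_vector_derivative B' x) (at x)" "continuous_on UNIV B'"
    and W: "\<And>x. (W has_vector_derivative W' x) (at x)" "continuous_on UNIV W'"
  shows "integral {l..r} (\<lambda>y. p y * B (\<theta> y) * W' y) =
     - (integral {l..r} (\<lambda>y. p' y * B (\<theta> y) * W y)
        + integral {l..r} (\<lambda>y. p y * of_real (\<theta>' y) * B' (\<theta> y) * W y))"
proof -
  have cont: "continuous_on {l..r} p'" "continuous_on {l..r} p" "continuous_on {l..r} (\<lambda>y. B (\<theta> y))"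
    "continuous_on {l..r} (\<lambda>y. B' (\<theta> y))" "continuous_on {l..r} W" "continuous_on {l..r} W'"
    "continuous_on {l..r} (\<lambda>y. complex_of_real (\<theta>' y))"
  proof -
    show "continuous_on {l..r} p'" using p(2) U continuous_on_subset by blast
    show "continuous_on {l..r} p"
      using p(1) U by (auto intro!: continuous_at_imp_continuous_on intro: has_vector_derivative_continuous)
    show "continuous_on {l..r} (\<lambda>y. B (\<theta> y))"
      using B(1) by (intro continuous_compose_\<theta>)
        (auto intro!: continuous_at_imp_continuous_on intro: has_vector_derivative_continuous)
    show "continuous_on {l..r} (\<lambda>y. B' (\<theta> y))" using B(2) by (rule continuous_compose_\<theta>)
    show "continuous_on {l..r} W"
      using W(1) by (auto intro!: continuous_at_imp_continuous_on intro: has_vector_derivative_continuous)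
    show "continuous_on {l..r} W'" using W(2) continuous_on_subset by blast
    show "continuous_on {l..r} (\<lambda>y. complex_of_real (\<theta>' y))"
      using \<theta>(2)[of 0] U continuous_on_subset by auto
  qed
  have deriv: "((\<lambda>y. p y * B (\<theta> y) * W y) has_vector_derivative
      p y * B (\<theta> y) * W' y + (p y * (of_real (\<theta>' y) * B' (\<theta> y)) + p' y * B (\<theta> y)) * W y) (at y)"
    if "y \<in> {l..r}" for y
  proof -
    have y: "y \<in> U" using that U by auto
    have "((\<lambda>y. B (\<theta> y)) has_vector_derivative of_real (\<theta>' y) * B' (\<theta> y)) (at y)"
      using vector_diff_chain_at[of \<theta> "\<theta>' y" y B "B' (\<theta> y)"] \<theta>(1)[OF y] B(1)
      by (auto simp: o_def has_real_derivative_iff_has_vector_derivative scaleR_conv_of_real)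
    then show ?thesis by (intro has_vector_derivative_mult p(1)[OF y] W(1))
  qed
  have "l \<in> {l..r}" "r \<in> {l..r}" using bounds by auto
  then have "l \<in> U" "r \<in> U" using U by blast+
  then have z: "p l = 0" "p r = 0" using p(3)[of l] p(3)[of r] bounds by auto
  have "((\<lambda>y. p y * B (\<theta> y) * W' y + (p y * (of_real (\<theta>' y) * B' (\<theta> y)) + p' y * B (\<theta> y)) * W y)
      has_integral (p r * B (\<theta> r) * W r - p l * B (\<theta> l) * W l)) {l..r}"
    by (rule fundamental_theorem_of_calculus[where f = "\<lambda>y. p y * B (\<theta> y) * W y",
          OF _ has_vector_derivative_at_within[OF deriv]]) (use bounds in simp)
  from integral_unique[OF this]
  have "0 = integral {l..r} (\<lambda>y. p y * B (\<theta> y) * W' y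
      + (p y * (of_real (\<theta>' y) * B' (\<theta> y)) + p' y * B (\<theta> y)) * W y)"
    using z by simp
  also have "\<dots> = integral {l..r} (\<lambda>y. p y * B (\<theta> y) * W' y
      + (p' y * B (\<theta> y) * W y + p y * of_real (\<theta>' y) * B' (\<theta> y) * W y))"
    by (intro arg_cong[of _ _ "integral {l..r}"] ext) (simp add: algebra_simps)
  also have "\<dots> = integral {l..r} (\<lambda>y. p y * B (\<theta> y) * W' y)
      + integral {l..r} (\<lambda>y. p' y * B (\<theta> y) * W y + p y * of_real (\<theta>' y) * B' (\<theta> y) * W y)"
    by (intro Henstock_Kurzweil_Integration.integral_add integrable_continuous_interval
        continuous_intros cont)
  also have "integral {l..r} (\<lambda>y. p' y * B (\<theta> y) * W y + p y * of_real (\<theta>' y) * B' (\<theta> y) * W y)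
      = integral {l..r} (\<lambda>y. p' y * B (\<theta> y) * W y)
        + integral {l..r} (\<lambda>y. p y * of_real (\<theta>' y) * B' (\<theta> y) * W y)"
    by (intro Henstock_Kurzweil_Integration.integral_add integrable_continuous_interval
        continuous_intros cont)
  finally show ?thesis unfolding eq_neg_iff_add_eq_0 by (rule sym)
qed

text \<open>Each step differentiates either the cutoff or the composite, so after \<open>N\<close>
  steps the orders \<open>j \<le> N\<close> of \<open>B\<close> meet \<open>W N\<close>, with
  coefficients bounded on \<open>[l, r]\<close>. The cutoff \<open>p\<close> is kept general because
  the induction replaces it; \<open>C\<close> is fixed before \<open>B\<close> and \<open>W\<close>,
  hence uniform over all kernels.\<close>

lemma repeated_integration_by_parts:
  fixes p :: "real \<Rightarrow> complex"
  assumes "\<And>m. times_diff_on U m p" "\<And>x. x \<in> U \<Longrightarrow> x \<notin> {l'..r'} \<Longrightarrow> p x = 0"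
  shows "\<exists>C\<ge>0. \<forall>B W. (\<forall>j x. (B j has_vector_derivative B (Suc j) x) (at x)) \<longrightarrow>
    iterated_antiderivs N W \<longrightarrow>
    norm (integral {l..r} (\<lambda>y. p y * B 0 (\<theta> y) * W 0 y))
      \<le> C * (\<Sum>j\<le>N. integral {l..r} (\<lambda>y. norm (B j (\<theta> y)) * norm (W N y)))"
  using assms
proof (induction N arbitrary: p)
  case 0
  have contp: "continuous_on {l..r} p" using 0(1)[of 0] U continuous_on_subset by auto
  then have "bounded (p ` {l..r})" by (intro compact_imp_bounded compact_continuous_image) auto
  then obtain C where C: "C > 0" "\<And>y. y \<in> {l..r} \<Longrightarrow> norm (p y) \<le> C"
    unfolding bounded_pos by blast
  show ?case
  proof (intro exI[of _ C] conjI allI impI)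
    fix B W :: "nat \<Rightarrow> real \<Rightarrow> complex"
    assume B: "\<forall>j x. (B j has_vector_derivative B (Suc j) x) (at x)" and W: "iterated_antiderivs 0 W"
    have "continuous_on UNIV (B 0)"
      using B by (auto intro!: continuous_at_imp_continuous_on intro: has_vector_derivative_continuous)
    moreover have "continuous_on UNIV (W 0)" using W by (simp add: iterated_antiderivs_def)
    ultimately have cont: "continuous_on {l..r} (\<lambda>y. B 0 (\<theta> y))" "continuous_on {l..r} (W 0)"
      using continuous_compose_\<theta> continuous_on_subset by blast+
    have "norm (integral {l..r} (\<lambda>y. p y * B 0 (\<theta> y) * W 0 y))
        \<le> integral {l..r} (\<lambda>y. C * (norm (B 0 (\<theta> y)) * norm (W 0 y)))"
      by (intro integral_norm_bound_integral integrable_continuous_interval continuous_intros cont contp)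
        (auto simp: norm_mult mult.assoc intro!: mult_right_mono C)
    then show "norm (integral {l..r} (\<lambda>y. p y * B 0 (\<theta> y) * W 0 y))
        \<le> C * (\<Sum>j\<le>0. integral {l..r} (\<lambda>y. norm (B j (\<theta> y)) * norm (W 0 y)))" by simp
  qed (use C in simp)
next
  case (Suc N)
  obtain p' where p': "\<And>x. x \<in> U \<Longrightarrow> (p has_vector_derivative p' x) (at x)"
    "\<And>m. times_diff_on U m p'"
    using times_diff_on_derivative[OF U(1) Suc.prems(1)] by blast
  have "p' x = 0" if "x \<in> U" "x \<notin> {l'..r'}" for x
  proof -
    have "(p has_vector_derivative 0) (at x)"
      by (rule has_vector_derivative_transform_open[of "\<lambda>_. 0" _ _ "U - {l'..r'}"])
        (use U that Suc.prems(2) in \<open>auto intro!: open_Diff\<close>)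
    then show ?thesis using p'(1)[OF that(1)] vector_derivative_unique_at by blast
  qed
  from Suc.IH[OF p'(2) this] obtain C1 where C1: "C1 \<ge> 0"
    "\<And>B W. (\<forall>j x. (B j has_vector_derivative B (Suc j) x) (at x)) \<Longrightarrow> iterated_antiderivs N W \<Longrightarrow>
      norm (integral {l..r} (\<lambda>y. p' y * B 0 (\<theta> y) * W 0 y))
      \<le> C1 * (\<Sum>j\<le>N. integral {l..r} (\<lambda>y. norm (B j (\<theta> y)) * norm (W N y)))" by blast
  have "times_diff_on U m (\<lambda>x. p x * of_real (\<theta>' x))" for m
    by (intro times_diff_on_mult Suc.prems \<theta>)
  from Suc.IH[OF this] Suc.prems(2) obtain C2 where C2: "C2 \<ge> 0"
    "\<And>B W. (\<forall>j x. (B j has_vector_derivative B (Suc j) x) (at x)) \<Longrightarrow> iterated_antiderivs N W \<Longrightarrow>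
      norm (integral {l..r} (\<lambda>y. p y * of_real (\<theta>' y) * B 0 (\<theta> y) * W 0 y))
      \<le> C2 * (\<Sum>j\<le>N. integral {l..r} (\<lambda>y. norm (B j (\<theta> y)) * norm (W N y)))" by auto
  show ?case
  proof (intro exI[of _ "C1 + C2"] conjI allI impI)
    fix B W :: "nat \<Rightarrow> real \<Rightarrow> complex"
    assume B: "\<forall>j x. (B j has_vector_derivative B (Suc j) x) (at x)"
      and W: "iterated_antiderivs (Suc N) W"
    define S where "S j = integral {l..r} (\<lambda>y. norm (B j (\<theta> y)) * norm (W (Suc N) y))" for j
    have contB: "continuous_on UNIV (B j)" for j
      using B by (auto intro!: continuous_at_imp_continuous_on intro: has_vector_derivative_continuous)
    have Wd: "(W (Suc 0) has_vector_derivative W 0 x) (at x)" for x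
      using W by (auto simp: iterated_antiderivs_def)
    have contW: "continuous_on UNIV (W j)" if "j \<le> Suc N" for j
      using W that by (auto simp: iterated_antiderivs_def)
    have S0: "S j \<ge> 0" for j
      unfolding S_def using contB contW[of "Suc N"]
      by (intro Henstock_Kurzweil_Integration.integral_nonneg integrable_continuous_interval
          continuous_intros continuous_compose_\<theta>) (auto intro: continuous_on_subset)
    have "norm (integral {l..r} (\<lambda>y. p y * B 0 (\<theta> y) * W 0 y))
      = norm (integral {l..r} (\<lambda>y. p' y * B 0 (\<theta> y) * W (Suc 0) y)
        + integral {l..r} (\<lambda>y. p y * of_real (\<theta>' y) * B (Suc 0) (\<theta> y) * W (Suc 0) y))"
      using integration_by_parts_step[OF p'(1) _ Suc.prems(2), of "B 0" "B (Suc 0)" "W (Suc 0)" "W 0"]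
        p'(2)[of 0] B contB contW[of 0] Wd
      by (simp del: minus_add_distrib add_uminus_conv_diff)
    also have "\<dots> \<le> norm (integral {l..r} (\<lambda>y. p' y * B 0 (\<theta> y) * W (Suc 0) y))
        + norm (integral {l..r} (\<lambda>y. p y * of_real (\<theta>' y) * B (Suc 0) (\<theta> y) * W (Suc 0) y))"
      by (rule norm_triangle_ineq)
    \<comment> \<open>The second induction hypothesis is used for the sequence \<open>B\<close>
      shifted by one derivative.\<close>
    also have "\<dots> \<le> C1 * (\<Sum>j\<le>N. S j) + C2 * (\<Sum>j\<le>N. S (Suc j))"
      unfolding S_def
      using C1(2)[OF B iterated_antiderivs_Suc[OF W]]
        C2(2)[of "\<lambda>j. B (Suc j)", OF _ iterated_antiderivs_Suc[OF W]] B
      by (intro add_mono) auto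
    also have "\<dots> \<le> C1 * (\<Sum>j\<le>Suc N. S j) + C2 * (\<Sum>j\<le>Suc N. S j)"
    proof (intro add_mono mult_left_mono)
      show "(\<Sum>j\<le>N. S (Suc j)) \<le> (\<Sum>j\<le>Suc N. S j)"
        unfolding sum.atMost_Suc_shift using S0[of 0] by simp
    qed (use S0 C1 C2 in auto)
    finally show "norm (integral {l..r} (\<lambda>y. p y * B 0 (\<theta> y) * W 0 y))
      \<le> (C1 + C2) * (\<Sum>j\<le>Suc N. integral {l..r} (\<lambda>y. norm (B j (\<theta> y)) * norm (W (Suc N) y)))"
      by (simp add: S_def algebra_simps)
  qed (use C1 C2 in simp)
qed

text \<open>Cutting \<open>\<theta>\<close> off outside \<open>[l, r]\<close> makes it Borel measurable on the whole line.\<close>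

definition clip :: "real \<Rightarrow> real" where
  "clip y = (if y \<in> {l..r} then \<theta> y else 0)"

definition weight :: "(real \<Rightarrow> complex) \<Rightarrow> real \<Rightarrow> complex" where
  "weight w y = (if y \<in> {l..r} then \<eta> y * w y else 0)"

text \<open>For \<open>w y = h (x - y)\<close> this is the value at \<open>x\<close> of the
  convolution of the cut-off composite with \<open>h\<close>. As a Lebesgue integral it admits
  Fubini and dominated convergence; integration by parts uses the equal gauge integral over
  \<open>[l, r]\<close>.\<close>

definition pairing :: "(real \<Rightarrow> complex) \<Rightarrow> (real \<Rightarrow> complex) \<Rightarrow> complex" where
  "pairing w h = (\<integral>y. weight w y * h (clip y) \<partial>lborel)"

definition local_L1 :: "(real \<Rightarrow> complex) \<Rightarrow> real" where
  "local_L1 w = (\<integral>y. indicator {l..r} y * norm (w y) \<partial>lborel)"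

lemma local_L1_nonneg [simp]: "local_L1 w \<ge> 0"
  unfolding local_L1_def by (intro Bochner_Integration.integral_nonneg) auto

lemma clip_measurable [measurable]: "clip \<in> borel_measurable borel"
proof -
  have "clip = (\<lambda>y. indicator {l..r} y *\<^sub>R \<theta> y)" by (auto simp: clip_def)
  then show ?thesis using borel_measurable_continuous_on_indicator[OF _ continuous_\<theta>] by simp
qed

lemma integral_eq_lborel:
  fixes f :: "real \<Rightarrow> 'b::euclidean_space"
  assumes "continuous_on {l..r} f"
  shows "integral {l..r} f = (\<integral>y. indicator {l..r} y *\<^sub>R f y \<partial>lborel)"
    and "integrable lborel (\<lambda>y. indicator {l..r} y *\<^sub>R f y)"
  using set_borel_integral_eq_integral(2)[OF borel_integrable_atLeastAtMost'[OF assms]]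
    borel_integrable_atLeastAtMost'[OF assms]
  by (simp_all add: set_lebesgue_integral_def set_integrable_def)

lemma continuous_\<eta>: "continuous_on {l..r} \<eta>"
  using \<eta>(1)[of 0] U continuous_on_subset by auto

lemma integrable_weight:
  assumes "continuous_on UNIV w"
  shows "integrable lborel (weight w)"
proof -
  have "weight w = (\<lambda>y. indicator {l..r} y *\<^sub>R (\<eta> y * w y))" by (auto simp: weight_def)
  moreover have "continuous_on {l..r} (\<lambda>y. \<eta> y * w y)"
    using continuous_\<eta> continuous_on_subset[OF assms] by (intro continuous_intros) auto
  ultimately show ?thesis using integral_eq_lborel(2) by simp
qed

lemma weight_measurable [measurable (raw)]:
  "continuous_on UNIV w \<Longrightarrow> weight w \<in> borel_measurable borel"
  using integrable_weight borel_measurable_integrable by (metis measurable_lborel2)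

lemma integrable_pairing:
  assumes w: "continuous_on UNIV w" and [measurable]: "h \<in> borel_measurable borel"
    and "\<And>x. norm (h x) \<le> M"
  shows "integrable lborel (\<lambda>y. weight w y * h (clip y))"
proof (rule Bochner_Integration.integrable_bound[OF integrable_mult_right[of M, OF integrable_norm[OF integrable_weight[OF w]]]])
  note [measurable] = weight_measurable[OF w]
  show "(\<lambda>y. weight w y * h (clip y)) \<in> borel_measurable lborel" by measurable
  show "AE y in lborel. norm (weight w y * h (clip y)) \<le> norm (M * norm (weight w y))"
  proof (rule AE_I2)
    fix y
    have "norm (h (clip y)) \<le> \<bar>M\<bar>" using assms(3)[of "clip y"] by linarith
    then show "norm (weight w y * h (clip y)) \<le> norm (M * norm (weight w y))"
      by (simp add: norm_mult abs_mult mult.commute[of "norm (weight w y)"] mult_right_mono)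
  qed
qed

lemma pairing_eq_integral:
  assumes "continuous_on UNIV w" "continuous_on UNIV h"
  shows "pairing w h = integral {l..r} (\<lambda>y. \<eta> y * h (\<theta> y) * w y)"
proof -
  have "continuous_on {l..r} (\<lambda>y. \<eta> y * h (\<theta> y) * w y)"
    using assms by (intro continuous_intros continuous_\<eta> continuous_compose_\<theta>)
      (auto intro: continuous_on_subset)
  from integral_eq_lborel(1)[OF this] show ?thesis
    unfolding pairing_def
    by (auto intro!: Bochner_Integration.integral_cong simp: weight_def clip_def indicator_def)
qed

end

section \<open>Bernstein's inequality and the localized pairing with a frequency cutoff\<close>

lemma inv_fourier_cmult: "inv_fourier (\<lambda>\<xi>. z * a \<xi>) x = z * inv_fourier a x"
proof -
  have "(\<lambda>\<xi>. cis (x * \<xi>) * (z * a \<xi>)) = (\<lambda>\<xi>. z * (cis (x * \<xi>) * a \<xi>))" by auto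
  then show ?thesis by (simp add: inv_fourier_def)
qed

lemma inv_fourier_L1_cmult: "inv_fourier_L1 (\<lambda>\<xi>. z * a \<xi>) = norm z * inv_fourier_L1 a"
  by (simp add: inv_fourier_L1_def inv_fourier_cmult norm_mult)

text \<open>Bernstein's inequality on the level of kernels: since
  \<open>(\<i> \<xi>) ^ j = R ^ j (\<i> \<xi> / R) ^ j\<close>, the symbol is \<open>R ^ j\<close>
  times a dilate of a fixed symbol, multiplied by a second dilate. Dilations are invisible to the L1
  norm.\<close>

lemma inv_fourier_L1_derivative_le:
  assumes \<kappa>: "symbol \<kappa>" and R: "R \<ge> 1" and c: "c > 0"
  shows "inv_fourier_L1 (\<lambda>\<xi>. (\<i> * of_real \<xi>) ^ j * (\<kappa> (inverse R * \<xi>) * \<kappa> (c * \<xi>)))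
    \<le> R ^ j * (inv_fourier_L1 (\<lambda>\<xi>. (\<i> * of_real \<xi>) ^ j * \<kappa> \<xi>) * inv_fourier_L1 \<kappa>)"
proof -
  let ?a = "\<lambda>\<xi>. (\<i> * of_real \<xi>) ^ j * \<kappa> \<xi>"
  have a: "symbol ?a" by (rule symbol_iota_power[OF \<kappa>])
  have "(\<lambda>\<xi>. (\<i> * of_real \<xi>) ^ j * (\<kappa> (inverse R * \<xi>) * \<kappa> (c * \<xi>)))
      = (\<lambda>\<xi>. of_real (R ^ j) * (?a (inverse R * \<xi>) * \<kappa> (c * \<xi>)))"
    using R by (auto simp: power_mult_distrib field_simps)
  then have "inv_fourier_L1 (\<lambda>\<xi>. (\<i> * of_real \<xi>) ^ j * (\<kappa> (inverse R * \<xi>) * \<kappa> (c * \<xi>)))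
     = R ^ j * inv_fourier_L1 (\<lambda>\<xi>. ?a (inverse R * \<xi>) * \<kappa> (c * \<xi>))"
    using R by (simp only: inv_fourier_L1_cmult) (simp add: norm_power)
  also have "\<dots> \<le> R ^ j * (inv_fourier_L1 (\<lambda>\<xi>. ?a (inverse R * \<xi>)) * inv_fourier_L1 (\<lambda>\<xi>. \<kappa> (c * \<xi>)))"
    using R c by (intro mult_left_mono inv_fourier_L1_mult symbol_scale a \<kappa>) auto
  also have "\<dots> = R ^ j * (inv_fourier_L1 ?a * inv_fourier_L1 \<kappa>)"
    using R c inv_fourier_L1_scale[of "inverse R" ?a] inv_fourier_L1_scale[of c \<kappa>] by simp
  finally show ?thesis .
qed

context localization begin

text \<open>Integrating over \<open>s\<close> first, the shift by \<open>clip y\<close> disappears,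
  and with it the change of variables.\<close>

lemma integral_local_kernel:
  assumes a: "symbol a" and w: "continuous_on UNIV w"
  shows "(\<integral>s. (\<integral>y. indicator {l..r} y * (norm (inv_fourier a (clip y - s)) * norm (w y)) \<partial>lborel) \<partial>lborel)
      = inv_fourier_L1 a * local_L1 w" (is ?eq)
    and "integrable lborel (\<lambda>s. (\<integral>y. indicator {l..r} y * (norm (inv_fourier a (clip y - s)) * norm (w y)) \<partial>lborel))"
proof -
  define v where "v y = complex_of_real (indicator {l..r} y * norm (w y))" for y
  have "continuous_on {l..r} (\<lambda>y. complex_of_real (norm (w y)))"
    by (intro continuous_intros continuous_on_subset[OF w]) auto
  from integral_eq_lborel(2)[OF this] have v: "integrable lborel v"
    by (simp add: v_def[abs_def] scaleR_conv_of_real)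
  note int = integrable_norm[OF integrable_kernel[OF integrable_inv_fourier[OF a] v clip_measurable, of "\<lambda>_. 1" 1]]
  have eq: "(\<lambda>(y, s). indicator {l..r} y * (norm (inv_fourier a (clip y - s)) * norm (w y)))
      = (\<lambda>p. norm (case p of (y, s) \<Rightarrow> v y * inv_fourier a (clip y - s) * 1))"
    by (auto simp: v_def norm_mult fun_eq_iff)
  have int: "integrable (lborel \<Otimes>\<^sub>M lborel)
      (\<lambda>(y, s). indicator {l..r} y * (norm (inv_fourier a (clip y - s)) * norm (w y)))"
    unfolding eq using int by simp
  from lborel_pair.integrable_snd[OF this]
  show "integrable lborel (\<lambda>s. (\<integral>y. indicator {l..r} y * (norm (inv_fourier a (clip y - s)) * norm (w y)) \<partial>lborel))"
    by simp
  have "(\<integral>s. indicator {l..r} y * (norm (inv_fourier a (clip y - s)) * norm (w y)) \<partial>lborel)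
      = inv_fourier_L1 a * (indicator {l..r} y * norm (w y))" for y
  proof -
    have "(\<lambda>s. indicator {l..r} y * (norm (inv_fourier a (clip y - s)) * norm (w y)))
       = (\<lambda>s. norm (inv_fourier a (clip y - s)) * (indicator {l..r} y * norm (w y)))" by auto
    then show ?thesis
      using integral_reflect_shift[of "\<lambda>s. norm (inv_fourier a s)" "clip y"]
      by (simp add: inv_fourier_L1_def)
  qed
  then show ?eq
    unfolding lborel_pair.Fubini_integral[OF int] local_L1_def
    by (simp only: integral_mult_right_zero)
qed

text \<open>Fubini moves the integration by parts onto the convolution kernel, so that no derivative of
  the convolution itself is needed.\<close>

lemma pairing_kernel_bound:
  assumes \<kappa>: "symbol \<kappa>"
  shows "\<exists>C\<ge>0. \<forall>R\<ge>1. \<forall>c>0. \<forall>W g M. iterated_antiderivs N W \<longrightarrow> g \<in> borel_measurable borel \<longrightarrow>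
     (\<forall>x. norm (g x) \<le> M) \<longrightarrow>
     norm (pairing (W 0) (convolve g (inv_fourier (\<lambda>\<xi>. \<kappa> (inverse R * \<xi>) * \<kappa> (c * \<xi>)))))
       \<le> M * (C * R ^ N * local_L1 (W N))"
proof -
  obtain C0 where C0: "C0 \<ge> 0"
    "\<And>B W. (\<forall>j x. (B j has_vector_derivative B (Suc j) x) (at x)) \<Longrightarrow> iterated_antiderivs N W \<Longrightarrow>
    norm (integral {l..r} (\<lambda>y. \<eta> y * B 0 (\<theta> y) * W 0 y))
      \<le> C0 * (\<Sum>j\<le>N. integral {l..r} (\<lambda>y. norm (B j (\<theta> y)) * norm (W N y)))"
    using repeated_integration_by_parts[OF \<eta>, of N] by blast
  \<comment> \<open>The Bernstein constants, free of \<open>R\<close> and \<open>c\<close>.\<close>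
  define F where "F j = inv_fourier_L1 (\<lambda>\<xi>. (\<i> * of_real \<xi>) ^ j * \<kappa> \<xi>) * inv_fourier_L1 \<kappa>" for j :: nat
  have F0: "F j \<ge> 0" for j by (simp add: F_def)
  show ?thesis
  proof (intro exI[of _ "C0 * (\<Sum>j\<le>N. F j)"] conjI allI impI)
    fix R c M :: real and W :: "nat \<Rightarrow> real \<Rightarrow> complex" and g :: "real \<Rightarrow> complex"
    assume R: "R \<ge> 1" and c: "c > 0" and W: "iterated_antiderivs N W"
      and g [measurable]: "g \<in> borel_measurable borel" and M: "\<forall>x. norm (g x) \<le> M"
    have M0: "M \<ge> 0" using M norm_ge_zero order_trans by blast
    define K where "K j \<xi> = (\<i> * of_real \<xi>) ^ j * (\<kappa> (inverse R * \<xi>) * \<kappa> (c * \<xi>))" for j \<xi>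
    have K: "symbol (K j)" for j
      unfolding K_def[abs_def] using R c by (intro symbol_iota_power symbol_mult symbol_scale \<kappa>) auto
    have W0: "continuous_on UNIV (W 0)" and WN: "continuous_on UNIV (W N)"
      using W by (auto simp: iterated_antiderivs_def)
    have K0: "(\<lambda>\<xi>. \<kappa> (inverse R * \<xi>) * \<kappa> (c * \<xi>)) = K 0" by (simp add: K_def[abs_def])
    \<comment> \<open>\<open>B s j\<close> is the \<open>j\<close>-th derivative of the kernel
      centred at \<open>s\<close>. Integration by parts is done for each fixed \<open>s\<close>, and
      the result is then integrated against \<open>g s\<close>.\<close>
    define B where "B s j x = inv_fourier (K j) (x - s)" for s x :: real and j
    have B: "\<forall>j x. (B s j has_vector_derivative B s (Suc j) x) (at x)" for s
    proof (intro allI)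
      fix j x
      have "K (Suc j) = (\<lambda>\<xi>. \<i> * of_real \<xi> * K j \<xi>)" by (auto simp: K_def)
      then have D: "(inv_fourier (K j) has_vector_derivative inv_fourier (K (Suc j)) (x - s)) (at (x - s))"
        using has_vector_derivative_inv_fourier[of "K j" "x - s"] symbol_continuous[OF K[of j]] K[of j]
        by (simp add: symbol_def)
      have "((\<lambda>x. x - s) has_vector_derivative 1) (at x)"
        by (auto intro!: derivative_eq_intros)
      from vector_diff_chain_at[OF this D]
      show "(B s j has_vector_derivative B s (Suc j) x) (at x)"
        by (simp add: B_def[abs_def] o_def)
    qed
    have pair_s: "norm (\<integral>y. weight (W 0) y * inv_fourier (K 0) (clip y - s) \<partial>lborel)
       \<le> C0 * (\<Sum>j\<le>N. \<integral>y. indicator {l..r} y * (norm (inv_fourier (K j) (clip y - s)) * norm (W N y)) \<partial>lborel)"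
      for s
    proof -
      have contB: "continuous_on UNIV (B s j)" for j
        using B by (auto intro!: continuous_at_imp_continuous_on intro: has_vector_derivative_continuous)
      have "integral {l..r} (\<lambda>y. norm (B s j (\<theta> y)) * norm (W N y))
         = (\<integral>y. indicator {l..r} y * (norm (inv_fourier (K j) (clip y - s)) * norm (W N y)) \<partial>lborel)" for j
      proof -
        have "continuous_on {l..r} (\<lambda>y. norm (B s j (\<theta> y)) * norm (W N y))"
          using contB WN by (intro continuous_intros continuous_compose_\<theta>) (auto intro: continuous_on_subset)
        from integral_eq_lborel(1)[OF this] show ?thesis
          by (auto intro!: Bochner_Integration.integral_cong simp: B_def clip_def indicator_def)
      qed
      moreover have "(\<integral>y. weight (W 0) y * inv_fourier (K 0) (clip y - s) \<partial>lborel)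
         = integral {l..r} (\<lambda>y. \<eta> y * B s 0 (\<theta> y) * W 0 y)"
        using pairing_eq_integral[OF W0 contB[of 0]] by (simp add: pairing_def B_def)
      ultimately show ?thesis using C0(2)[OF B[of s] W] by simp
    qed
    have [measurable]: "(\<lambda>p::real \<times> real. g (snd p)) \<in> borel_measurable borel"
      unfolding borel_prod[symmetric] by measurable
    note kernel = integrable_inv_fourier[OF K[of 0]] integrable_weight[OF W0] clip_measurable this
    have Fub: "pairing (W 0) (convolve g (inv_fourier (K 0)))
       = (\<integral>s. g s * (\<integral>y. weight (W 0) y * inv_fourier (K 0) (clip y - s) \<partial>lborel) \<partial>lborel)"
    proof -
      have "pairing (W 0) (convolve g (inv_fourier (K 0)))
         = (\<integral>y. (\<integral>s. weight (W 0) y * inv_fourier (K 0) (clip y - s) * g s \<partial>lborel) \<partial>lborel)"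
        unfolding pairing_def convolve_def by (simp add: mult_ac flip: integral_mult_right_zero)
      also have "\<dots> = (\<integral>s. (\<integral>y. weight (W 0) y * inv_fourier (K 0) (clip y - s) * g s \<partial>lborel) \<partial>lborel)"
        using Fubini_kernel[OF kernel, of M] M by simp
      finally show ?thesis by (simp add: mult.commute)
    qed
    let ?I = "\<lambda>j s. \<integral>y. indicator {l..r} y * (norm (inv_fourier (K j) (clip y - s)) * norm (W N y)) \<partial>lborel"
    have I0: "?I j s \<ge> 0" for j s by (intro Bochner_Integration.integral_nonneg) auto
    note ints = integral_local_kernel[OF K WN]
    have "norm (pairing (W 0) (convolve g (inv_fourier (K 0))))
       \<le> (\<integral>s. norm (g s * (\<integral>y. weight (W 0) y * inv_fourier (K 0) (clip y - s) \<partial>lborel)) \<partial>lborel)"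
      unfolding Fub by (rule integral_norm_bound)
    also have "\<dots> \<le> (\<integral>s. M * (C0 * (\<Sum>j\<le>N. ?I j s)) \<partial>lborel)"
    proof (rule integral_mono')
      show "integrable lborel (\<lambda>s. M * (C0 * (\<Sum>j\<le>N. ?I j s)))"
        by (intro integrable_mult_right Bochner_Integration.integrable_sum ints)
      show "norm (g s * (\<integral>y. weight (W 0) y * inv_fourier (K 0) (clip y - s) \<partial>lborel))
          \<le> M * (C0 * (\<Sum>j\<le>N. ?I j s))" for s
        unfolding norm_mult using M M0 pair_s by (intro mult_mono) auto
      show "0 \<le> M * (C0 * (\<Sum>j\<le>N. ?I j s))" for s
        using M0 C0(1) I0 by (intro mult_nonneg_nonneg sum_nonneg) auto
    qed
    also have "\<dots> = M * (C0 * (\<Sum>j\<le>N. inv_fourier_L1 (K j) * local_L1 (W N)))"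
      using ints by (simp add: Bochner_Integration.integral_sum)
    also have "\<dots> \<le> M * (C0 * (\<Sum>j\<le>N. (R ^ N * F j) * local_L1 (W N)))"
    proof (intro mult_left_mono sum_mono mult_right_mono)
      fix j assume "j \<in> {..N}"
      then have "R ^ j \<le> R ^ N" using R by (intro power_increasing) auto
      then have "R ^ j * F j \<le> R ^ N * F j" using F0 by (intro mult_right_mono) auto
      then show "inv_fourier_L1 (K j) \<le> R ^ N * F j"
        using inv_fourier_L1_derivative_le[OF \<kappa> R c, of j] by (simp add: K_def[abs_def] F_def)
    qed (use M0 C0 in auto)
    also have "\<dots> = M * (C0 * (\<Sum>j\<le>N. F j) * R ^ N * local_L1 (W N))"
      by (simp add: sum_distrib_left sum_distrib_right mult_ac)
    finally show "norm (pairing (W 0) (convolve g (inv_fourier (\<lambda>\<xi>. \<kappa> (inverse R * \<xi>) * \<kappa> (c * \<xi>)))))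
       \<le> M * (C0 * (\<Sum>j\<le>N. F j) * R ^ N * local_L1 (W N))"
      unfolding K0 .
  qed (use C0 F0 in \<open>auto intro!: mult_nonneg_nonneg sum_nonneg\<close>)
qed

end

section \<open>Decomposition along a partition of unity\<close>

lemma norm_le_sup_norm:
  assumes "\<And>x. norm (h x) \<le> M"
  shows "norm (h x) \<le> enn2real (sup_norm h)" and "sup_norm h = ennreal (enn2real (sup_norm h))"
proof -
  have "sup_norm h \<le> ennreal M"
    unfolding sup_norm_def using assms by (intro SUP_least ennreal_leI)
  then have "sup_norm h < top" using ennreal_less_top le_less_trans by blast
  then show eq: "sup_norm h = ennreal (enn2real (sup_norm h))" by simp
  have "ennreal (norm (h x)) \<le> sup_norm h" unfolding sup_norm_def by (rule SUP_upper) simp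
  then have "ennreal (norm (h x)) \<le> ennreal (enn2real (sup_norm h))" using eq by simp
  then show "norm (h x) \<le> enn2real (sup_norm h)" by simp
qed

lemma sup_norm_leI: "(\<And>x. ennreal (norm (h x)) \<le> C) \<Longrightarrow> sup_norm h \<le> C"
  unfolding sup_norm_def by (rule SUP_least)

lemma ennreal_sum_le_infsum:
  fixes f :: "'a \<Rightarrow> ennreal"
  assumes "finite F"
  shows "sum f F \<le> infsum f UNIV"
  using infsum_mono_neutral[of f F f UNIV] assms
  by (simp add: nonneg_summable_on_complete)

text \<open>The radii are at least 1 so that \<open>R i ^ N\<close> dominates the lower powers in
  the Bernstein bound. By local finiteness a mollifier with bounded symbol support meets only
  finitely many blocks.\<close>

locale partition =
  fixes q :: "int \<Rightarrow> real \<Rightarrow> complex" and R :: "int \<Rightarrow> real"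
  assumes symbol_q: "\<And>i. symbol (q i)" and R_ge_1: "\<And>i. R i \<ge> 1"
    and supp_q: "\<And>i x. q i x \<noteq> 0 \<Longrightarrow> \<bar>x\<bar> \<le> R i"
    and locally_finite: "\<And>T. finite {i. \<exists>x. \<bar>x\<bar> \<le> T \<and> q i x \<noteq> 0}"
    and sum_q: "\<And>x. ((\<lambda>i. q i x) has_sum 1) UNIV"
begin

lemma sum_finite:
  assumes "\<bar>x\<bar> \<le> T"
  shows "(\<Sum>i | \<exists>x. \<bar>x\<bar> \<le> T \<and> q i x \<noteq> 0. q i x) = 1"
proof -
  have "((\<lambda>i. q i x) has_sum 1) {i. \<exists>x. \<bar>x\<bar> \<le> T \<and> q i x \<noteq> 0}"
    using sum_q[of x] by (rule has_sum_cong_neutral[THEN iffD1, rotated -1]) (use assms in auto)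
  then show ?thesis
    using has_sum_finite[OF locally_finite[of T], of "\<lambda>i. q i x"] has_sum_unique by blast
qed

end

locale localized_partition = localization + partition +
  fixes \<kappa> :: "real \<Rightarrow> complex"
  assumes \<kappa>: "symbol \<kappa>" "\<And>x. \<bar>x\<bar> \<le> 1 \<Longrightarrow> \<kappa> x = 1"
begin

text \<open>Mollifying first leaves only finitely many pieces; the bound for them is uniform in \<open>c\<close>.\<close>

lemma mollified_eq_sum:
  assumes c: "c > 0" and g [measurable]: "g \<in> borel_measurable borel" and M: "\<And>x. norm (g x) \<le> M"
  shows "\<exists>F. finite F \<and> (\<forall>x. convolve g (inv_fourier (\<lambda>\<xi>. \<kappa> (c * \<xi>))) x =
    (\<Sum>i\<in>F. convolve (convolve g (inv_fourier (q i)))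
       (inv_fourier (\<lambda>\<xi>. \<kappa> (inverse (R i) * \<xi>) * \<kappa> (c * \<xi>))) x))"
proof -
  have "bounded_support (\<lambda>\<xi>. \<kappa> (c * \<xi>))"
    using symbol_scale[OF \<kappa>(1), of c] c by (simp add: symbol_def)
  then obtain T where T: "\<And>\<xi>. \<bar>\<xi>\<bar> \<ge> T \<Longrightarrow> \<kappa> (c * \<xi>) = 0" using bounded_supportE by blast
  define F where "F = {i. \<exists>x. \<bar>x\<bar> \<le> T \<and> q i x \<noteq> 0}"
  have F: "finite F" using locally_finite by (simp add: F_def)
  define a where "a i \<xi> = \<kappa> (inverse (R i) * \<xi>) * \<kappa> (c * \<xi>)" for i \<xi>
  have Ri: "inverse (R i) \<noteq> 0" for i using R_ge_1[of i] by simp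
  have a: "symbol (a i)" for i
    unfolding a_def[abs_def] using c Ri by (intro symbol_mult symbol_scale \<kappa>) auto
  have qa: "symbol (\<lambda>\<xi>. q i \<xi> * a i \<xi>)" for i by (intro symbol_mult symbol_q a)
  \<comment> \<open>The dilated cutoff equals 1 on the support of \<open>q i\<close>, so inserting
    it changes nothing; its kernel is the one that will be differentiated.\<close>
  have q\<kappa>: "q i \<xi> * a i \<xi> = q i \<xi> * \<kappa> (c * \<xi>)" for i \<xi>
  proof (cases "q i \<xi> = 0")
    case False
    then have "\<bar>inverse (R i) * \<xi>\<bar> \<le> 1"
      using supp_q[of i \<xi>] R_ge_1[of i] by (simp add: abs_mult field_simps)
    then show ?thesis using \<kappa>(2) by (simp add: a_def)
  qed simp
  have \<kappa>_eq: "\<kappa> (c * \<xi>) = (\<Sum>i\<in>F. q i \<xi> * a i \<xi>)" for \<xi>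
  proof -
    have "(\<Sum>i\<in>F. q i \<xi> * a i \<xi>) = (\<Sum>i\<in>F. q i \<xi>) * \<kappa> (c * \<xi>)"
      by (simp only: q\<kappa> sum_distrib_right)
    then show ?thesis using sum_finite[of \<xi> T] T[of \<xi>] by (cases "\<bar>\<xi>\<bar> \<le> T") (simp_all add: F_def)
  qed
  have inv: "inv_fourier (\<lambda>\<xi>. \<kappa> (c * \<xi>)) x = (\<Sum>i\<in>F. inv_fourier (\<lambda>\<xi>. q i \<xi> * a i \<xi>) x)" for x
  proof -
    have "integrable lborel (\<lambda>\<xi>. cis (x * \<xi>) * (q i \<xi> * a i \<xi>))" for i
      using integrable_norm[OF symbol_integrable[OF qa[of i]]]
        borel_measurable_continuous_onI[OF symbol_continuous[OF qa[of i]]]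
      by (intro Bochner_Integration.integrable_bound[OF symbol_integrable[OF qa[of i]]])
        (auto simp: norm_mult intro!: borel_measurable_times)
    then show ?thesis
      by (simp add: inv_fourier_def \<kappa>_eq sum_distrib_left Bochner_Integration.integral_sum)
  qed
  have "convolve g (inv_fourier (\<lambda>\<xi>. \<kappa> (c * \<xi>))) x =
    (\<Sum>i\<in>F. convolve (convolve g (inv_fourier (q i))) (inv_fourier (a i)) x)" for x
  proof -
    have "integrable lborel (\<lambda>y. g y * inv_fourier (\<lambda>\<xi>. q i \<xi> * a i \<xi>) (x - y))" for i
    proof (rule Bochner_Integration.integrable_bound)
      show "integrable lborel (\<lambda>y. M * norm (inv_fourier (\<lambda>\<xi>. q i \<xi> * a i \<xi>) (x - y)))"
        using integrable_reflect_shift[OF integrable_norm[OF integrable_inv_fourier[OF qa]]] by simp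
      show "(\<lambda>y. g y * inv_fourier (\<lambda>\<xi>. q i \<xi> * a i \<xi>) (x - y)) \<in> borel_measurable lborel"
        using inv_fourier_measurable[OF qa[of i]] by measurable
      show "AE y in lborel. norm (g y * inv_fourier (\<lambda>\<xi>. q i \<xi> * a i \<xi>) (x - y))
          \<le> norm (M * norm (inv_fourier (\<lambda>\<xi>. q i \<xi> * a i \<xi>) (x - y)))"
      proof (rule AE_I2)
        fix y
        have "norm (g y) \<le> \<bar>M\<bar>" using M[of y] by linarith
        then show "norm (g y * inv_fourier (\<lambda>\<xi>. q i \<xi> * a i \<xi>) (x - y))
          \<le> norm (M * norm (inv_fourier (\<lambda>\<xi>. q i \<xi> * a i \<xi>) (x - y)))"
          by (simp add: norm_mult abs_mult mult_right_mono)
      qed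
    qed
    then have "convolve g (inv_fourier (\<lambda>\<xi>. \<kappa> (c * \<xi>))) x
      = (\<Sum>i\<in>F. convolve g (inv_fourier (\<lambda>\<xi>. q i \<xi> * a i \<xi>)) x)"
      unfolding convolve_def inv by (simp add: sum_distrib_left Bochner_Integration.integral_sum)
    then show ?thesis using convolve_assoc[OF symbol_q a g M] by simp
  qed
  then show ?thesis using F unfolding a_def[abs_def] by blast
qed

text \<open>Assumption \<open>D\<close> is applied with \<open>h\<close> the \<open>i\<close>-th
  frequency piece and \<open>B\<close> its sup norm. The mollified \<open>g\<close> is a finite sum
  of such contributions, bounded independently of the scale \<open>1 / (n + 1)\<close>, and
  dominated convergence then removes the mollifier.\<close>

lemma pairing_sum_bound:
  assumes w: "continuous_on UNIV w" and g: "continuous_on UNIV g" and M: "\<And>x. norm (g x) \<le> M"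
    and D0: "\<And>i. D i \<ge> 0"
    and D: "\<And>i c h B. c > 0 \<Longrightarrow> h \<in> borel_measurable borel \<Longrightarrow> (\<And>x. norm (h x) \<le> B) \<Longrightarrow>
      norm (pairing w (convolve h (inv_fourier (\<lambda>\<xi>. \<kappa> (inverse (R i) * \<xi>) * \<kappa> (c * \<xi>))))) \<le> B * D i"
  shows "ennreal (norm (pairing w g)) \<le>
    (\<Sum>\<^sub>\<infinity>i. sup_norm (convolve g (inv_fourier (q i))) * ennreal (D i))"
proof -
  note [measurable] = borel_measurable_continuous_onI[OF g]
  define b where "b i = convolve g (inv_fourier (q i))" for i
  have bm [measurable]: "b i \<in> borel_measurable borel" for i
    unfolding b_def using inv_fourier_measurable[OF symbol_q] by measurable
  have bM: "norm (b i x) \<le> M * inv_fourier_L1 (q i)" for i x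
    unfolding b_def by (rule norm_convolve_le[OF symbol_q]) (use M in auto)
  define A where "A i = enn2real (sup_norm (b i))" for i
  have A: "norm (b i x) \<le> A i" "sup_norm (b i) = ennreal (A i)" for i x
    using norm_le_sup_norm[OF bM] by (auto simp: A_def)
  have A0: "A i \<ge> 0" for i by (simp add: A_def)
  define m where "m n = convolve g (inv_fourier (\<lambda>\<xi>. \<kappa> (inverse (real (Suc n)) * \<xi>)))" for n
  have \<kappa>n: "symbol (\<lambda>\<xi>. \<kappa> (inverse (real (Suc n)) * \<xi>))" for n
    by (rule symbol_scale[OF \<kappa>(1)]) simp
  have mm [measurable]: "m n \<in> borel_measurable borel" for n
    unfolding m_def using inv_fourier_measurable[OF \<kappa>n] by measurable
  have mM: "norm (m n x) \<le> M * inv_fourier_L1 \<kappa>" for n x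
    using norm_convolve_le[OF \<kappa>n[of n], of g M x] M inv_fourier_L1_scale[of "inverse (real (Suc n))" \<kappa>]
    by (simp add: m_def)
  have "ennreal (norm (pairing w (m n))) \<le> (\<Sum>\<^sub>\<infinity>i. sup_norm (b i) * ennreal (D i))" for n
  proof -
    let ?c = "inverse (real (Suc n))"
    let ?k = "\<lambda>i. inv_fourier (\<lambda>\<xi>. \<kappa> (inverse (R i) * \<xi>) * \<kappa> (?c * \<xi>))"
    have cpos: "?c > 0" by simp
    obtain F where F: "finite F" "\<And>x. m n x = (\<Sum>i\<in>F. convolve (b i) (?k i) x)"
      using mollified_eq_sum[OF cpos borel_measurable_continuous_onI[OF g] M]
      unfolding m_def b_def by blast
    have k: "symbol (\<lambda>\<xi>. \<kappa> (inverse (R i) * \<xi>) * \<kappa> (?c * \<xi>))" for i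
      using R_ge_1[of i] by (intro symbol_mult symbol_scale \<kappa>) auto
    have "pairing w (m n) = (\<Sum>i\<in>F. pairing w (convolve (b i) (?k i)))"
    proof -
      have "integrable lborel (\<lambda>y. weight w y * convolve (b i) (?k i) (clip y))" for i
        by (rule integrable_pairing[OF w _ norm_convolve_le[OF k bm A(1)]])
          (use inv_fourier_measurable[OF k[of i]] in measurable)
      then show ?thesis
        unfolding pairing_def F(2) by (simp add: sum_distrib_left Bochner_Integration.integral_sum)
    qed
    then have "norm (pairing w (m n)) \<le> (\<Sum>i\<in>F. A i * D i)"
      using D[OF cpos bm A(1)] by (simp add: sum_norm_le)
    then have "ennreal (norm (pairing w (m n))) \<le> ennreal (\<Sum>i\<in>F. A i * D i)"
      by (rule ennreal_leI)
    also have "\<dots> = (\<Sum>i\<in>F. sup_norm (b i) * ennreal (D i))"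
      using A0 D0 by (simp add: A(2) ennreal_mult flip: sum_ennreal)
    also have "\<dots> \<le> (\<Sum>\<^sub>\<infinity>i. sup_norm (b i) * ennreal (D i))"
      by (rule ennreal_sum_le_infsum[OF F(1)])
    finally show ?thesis .
  qed
  note bound = this
  have "(\<lambda>n. pairing w (m n)) \<longlonglongrightarrow> pairing w g"
    unfolding pairing_def
  proof (rule integral_dominated_convergence[where w = "\<lambda>y. M * inv_fourier_L1 \<kappa> * norm (weight w y)"])
    note [measurable] = weight_measurable[OF w]
    show "(\<lambda>y. weight w y * g (clip y)) \<in> borel_measurable lborel"
      "(\<lambda>y. weight w y * m n (clip y)) \<in> borel_measurable lborel" for n by measurable
    show "integrable lborel (\<lambda>y. M * inv_fourier_L1 \<kappa> * norm (weight w y))"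
      using integrable_weight[OF w] by simp
    show "AE y in lborel. (\<lambda>n. weight w y * m n (clip y)) \<longlonglongrightarrow> weight w y * g (clip y)"
      unfolding m_def using \<kappa>(2)[of 0]
      by (intro AE_I2 tendsto_intros convolve_approx_identity[OF \<kappa>(1) _ g M]) auto
    show "AE y in lborel. norm (weight w y * m n (clip y)) \<le> M * inv_fourier_L1 \<kappa> * norm (weight w y)" for n
      using mM by (intro AE_I2) (simp add: norm_mult mult.commute[of "norm (weight w _)"] mult_right_mono)
  qed
  then have "(\<lambda>n. ennreal (norm (pairing w (m n)))) \<longlonglongrightarrow> ennreal (norm (pairing w g))"
    by (intro tendsto_ennrealI tendsto_norm)
  from LIMSEQ_le_const2[OF this] bound show ?thesis unfolding b_def by blast
qed

end

section \<open>Infinite sums in the extended nonnegative reals\<close>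

lemma ennreal_summable_on [simp]: "(f :: 'a \<Rightarrow> ennreal) summable_on A"
  by (rule nonneg_summable_on_complete) simp

lemma infsum_ennreal_cmult_le:
  fixes f :: "'a \<Rightarrow> ennreal"
  shows "(\<Sum>\<^sub>\<infinity>x. c * f x) \<le> c * infsum f UNIV"
  by (rule infsum_le_finite_sums)
    (auto simp flip: sum_distrib_left intro!: mult_left_mono ennreal_sum_le_infsum)

lemma infsum_ennreal_mono:
  fixes f g :: "'a \<Rightarrow> ennreal"
  shows "(\<And>x. f x \<le> g x) \<Longrightarrow> infsum f UNIV \<le> infsum g UNIV"
  by (rule infsum_mono) auto

lemma infsum_ennreal_sum:
  fixes f :: "'k \<Rightarrow> 'a \<Rightarrow> ennreal"
  shows "finite F \<Longrightarrow> (\<Sum>k\<in>F. \<Sum>\<^sub>\<infinity>n. f k n) = (\<Sum>\<^sub>\<infinity>n. \<Sum>k\<in>F. f k n)"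
proof (induction F rule: finite_induct)
  case (insert x F)
  then show ?case by (simp add: infsum_add[symmetric])
qed simp

lemma infsum_int_ennreal_finite:
  assumes "summable g" and nonneg: "\<And>n. g n \<ge> 0"
  obtains Z :: real where "Z \<ge> 0" "(\<Sum>\<^sub>\<infinity>n::int. ennreal (g (nat \<bar>n\<bar>))) \<le> ennreal Z"
proof -
  have g: "g summable_on UNIV"
    using assms by (intro norm_summable_imp_summable_on) simp
  let ?h = "\<lambda>n::int. g (nat \<bar>n\<bar>)"
  have "?h summable_on range int" "?h summable_on range (\<lambda>n. - int n)"
    by (subst summable_on_reindex; auto simp: inj_def o_def g)+
  then have "?h summable_on (range int \<union> range (\<lambda>n. - int n))" by (rule summable_on_union)
  moreover have "range int \<union> range (\<lambda>n. - int n) = UNIV"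
    by (auto simp: image_iff) (metis int_cases2)
  ultimately have h: "?h summable_on UNIV" by simp
  show ?thesis
  proof (rule that)
    show "infsum ?h UNIV \<ge> 0" using nonneg by (intro infsum_nonneg) auto
    show "(\<Sum>\<^sub>\<infinity>n::int. ennreal (?h n)) \<le> ennreal (infsum ?h UNIV)"
    proof (rule infsum_le_finite_sums)
      fix F :: "int set" assume "finite F"
      then show "(\<Sum>n\<in>F. ennreal (?h n)) \<le> ennreal (infsum ?h UNIV)"
        using finite_sum_le_infsum[OF h, of F] nonneg by (auto simp: sum_ennreal intro!: ennreal_leI)
    qed simp
  qed
qed

section \<open>The partitions of unity\<close>

lemma test_function_times_diff_on: "f \<in> test_functions \<Longrightarrow> times_diff_on U n f"
  using smooth_imp_times_diff_on times_diff_on_subset unfolding test_functions_def by blast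

lemma fun_support_subsetD: "fun_support f \<subseteq> S \<Longrightarrow> f x \<noteq> 0 \<Longrightarrow> x \<in> S"
  unfolding fun_support_def using closure_subset by fast

lemma symbol_test_function:
  assumes "f \<in> test_functions" "fun_support f \<subseteq> {s..t}"
  shows "symbol f"
proof -
  have "f x = 0" if "\<bar>x\<bar> > max \<bar>s\<bar> \<bar>t\<bar>" for x
    using fun_support_subsetD[OF assms(2), of x] that by (auto simp: abs_real_def split: if_splits)
  then show ?thesis using test_function_times_diff_on[OF assms(1)]
    unfolding symbol_def bounded_support_def by blast
qed

lemma symbol_translate:
  assumes "symbol a"
  shows "symbol (\<lambda>x. a (x - d))"
proof -
  obtain M where M: "M > 0" "\<And>x. \<bar>x\<bar> \<ge> M \<Longrightarrow> a x = 0"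
    using assms bounded_supportE symbol_def by blast
  have "a (x - d) = 0" if "\<bar>x\<bar> > M + \<bar>d\<bar>" for x using that by (intro M) linarith
  then have "bounded_support (\<lambda>x. a (x - d))" unfolding bounded_support_def by blast
  then show ?thesis
    using assms times_diff_on_affine[of 2 a 1 "- d"] by (simp add: symbol_def)
qed

lemma partition_equidistant:
  assumes "equidistant_partition \<phi>"
  shows "partition (equidistant_block \<phi>) (\<lambda>n. 1 + of_int \<bar>n\<bar>)"
proof
  have \<phi>: "\<phi> \<in> test_functions" "fun_support \<phi> \<subseteq> {-1..1}"
    and sum1: "\<forall>x. ((\<lambda>n. equidistant_block \<phi> n x) has_sum 1) UNIV"
    using assms by (auto simp: equidistant_partition_def)
  show "symbol (equidistant_block \<phi> n)" for n
    unfolding equidistant_block_def by (intro symbol_translate symbol_test_function[OF \<phi>])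
  show "1 \<le> 1 + real_of_int \<bar>n\<bar>" for n by simp
  show supp: "\<bar>x\<bar> \<le> 1 + real_of_int \<bar>n\<bar>" if "equidistant_block \<phi> n x \<noteq> 0" for n x
    using fun_support_subsetD[OF \<phi>(2), of "x - of_int n"] that by (auto simp: equidistant_block_def)
  show "finite {n. \<exists>x. \<bar>x\<bar> \<le> T \<and> equidistant_block \<phi> n x \<noteq> 0}" for T
  proof (rule finite_subset)
    show "{n. \<exists>x. \<bar>x\<bar> \<le> T \<and> equidistant_block \<phi> n x \<noteq> 0} \<subseteq> {- \<lceil>T + 1\<rceil>..\<lceil>T + 1\<rceil>}"
    proof clarify
      fix n x assume "\<bar>x\<bar> \<le> T" "equidistant_block \<phi> n x \<noteq> 0"
      then have "real_of_int \<bar>n\<bar> \<le> T + 1"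
        using fun_support_subsetD[OF \<phi>(2), of "x - of_int n"] by (auto simp: equidistant_block_def)
      then have "\<bar>n\<bar> \<le> \<lceil>T + 1\<rceil>" by linarith
      then show "n \<in> {- \<lceil>T + 1\<rceil>..\<lceil>T + 1\<rceil>}" by auto
    qed
  qed simp
  show "((\<lambda>n. equidistant_block \<phi> n x) has_sum 1) UNIV" for x using sum1 by blast
qed

text \<open>Used both as the fattened frequency cutoff in Bernstein's inequality and as the mollifier.\<close>

definition plateau :: "(real \<Rightarrow> complex) \<Rightarrow> real \<Rightarrow> complex" where
  "plateau \<phi> x = (\<Sum>n\<in>{-2..2}. equidistant_block \<phi> n x)"

lemma symbol_add: "symbol a \<Longrightarrow> symbol b \<Longrightarrow> symbol (\<lambda>x. a x + b x)"
proof -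
  assume a: "symbol a" and b: "symbol b"
  obtain M N where "\<And>x. \<bar>x\<bar> \<ge> M \<Longrightarrow> a x = 0" "\<And>x. \<bar>x\<bar> \<ge> N \<Longrightarrow> b x = 0"
    using a b bounded_supportE unfolding symbol_def by metis
  then have "a x + b x = 0" if "\<bar>x\<bar> > max M N" for x using that by simp
  then show ?thesis
    using a b times_diff_on_add unfolding symbol_def bounded_support_def by blast
qed

lemma symbol_plateau:
  assumes "equidistant_partition \<phi>"
  shows "symbol (plateau \<phi>)"
proof -
  interpret partition "equidistant_block \<phi>" "\<lambda>n. 1 + of_int \<bar>n\<bar>"
    using partition_equidistant[OF assms] .
  have "symbol (\<lambda>x. \<Sum>n\<in>I. equidistant_block \<phi> n x)" if "finite I" for I
    using that
  proof (induction I rule: finite_induct)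
    case empty
    show ?case by (simp add: symbol_def bounded_support_def)
  next
    case (insert i I)
    then show ?case using symbol_add[OF symbol_q[of i]] by simp
  qed
  then show ?thesis unfolding plateau_def[abs_def] by simp
qed

text \<open>A block with \<open>\<bar>n\<bar> \<ge> 3\<close> lives where
  \<open>\<bar>x\<bar> \<ge> 2\<close>, so on \<open>[-1, 1]\<close> the five blocks kept already
  exhaust the sum.\<close>

lemma plateau_eq_1:
  assumes "equidistant_partition \<phi>" "\<bar>x\<bar> \<le> 1"
  shows "plateau \<phi> x = 1"
proof -
  have \<phi>: "fun_support \<phi> \<subseteq> {-1..1}" and sum1: "((\<lambda>n. equidistant_block \<phi> n x) has_sum 1) UNIV"
    using assms by (auto simp: equidistant_partition_def)
  have "n \<in> {-2..2}" if "equidistant_block \<phi> n x \<noteq> 0" for n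
    using fun_support_subsetD[OF \<phi>, of "x - of_int n"] that assms(2)
    by (auto simp: equidistant_block_def)
  then have "((\<lambda>n. equidistant_block \<phi> n x) has_sum 1) {-2..2}"
    using sum1 by (intro has_sum_cong_neutral[THEN iffD1, OF _ _ _ sum1]) auto
  then show ?thesis
    unfolding plateau_def using has_sum_finite[of "{-2..2::int}" "\<lambda>n. equidistant_block \<phi> n x"] has_sum_unique
    by blast
qed

text \<open>Putting the reflection into the sign of the dilation factor lets both halves of the
  frequency axis be treated by the scaling lemmas at once.\<close>

lemma fourier_block_eq_scale:
  assumes "n \<noteq> 0"
  shows "fourier_block \<psi>0 \<psi>1 n = (\<lambda>x. \<psi>1 (of_int (sgn n) * 2 powr (1 - of_int \<bar>n\<bar>) * x))"
  using assms by (auto simp: fourier_block_def powr_real_of_int' sgn_if powr_minus powr_diff power_int_diff power_int_add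
    field_simps simp flip: powr_real_of_int)

lemma partition_fourier:
  assumes "fourier_partition \<psi>0 \<psi>1"
  shows "partition (fourier_block \<psi>0 \<psi>1) (\<lambda>n. 2 powr of_int \<bar>n\<bar>)"
proof
  have \<psi>0: "\<psi>0 \<in> test_functions" "fun_support \<psi>0 \<subseteq> {-1..1}"
    and \<psi>1: "\<psi>1 \<in> test_functions" "fun_support \<psi>1 \<subseteq> {1/2..2}"
    and sum1: "\<forall>x. ((\<lambda>n. fourier_block \<psi>0 \<psi>1 n x) has_sum 1) UNIV"
    using assms by (auto simp: fourier_partition_def)
  \<comment> \<open>Dilating \<open>[1/2, 2]\<close> by \<open>2 powr (\<bar>n\<bar> - 1)\<close>
    gives this annulus. The outer edge is the radius of the partition, the inner one yields local
    finiteness.\<close>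
  have supp1: "2 powr (of_int \<bar>n\<bar> - 2) \<le> \<bar>x\<bar> \<and> \<bar>x\<bar> \<le> 2 powr of_int \<bar>n\<bar>"
    if "fourier_block \<psi>0 \<psi>1 n x \<noteq> 0" "n \<noteq> 0" for n x
  proof -
    have "of_int (sgn n) * 2 powr (1 - of_int \<bar>n\<bar>) * x \<in> {1/2..2}"
      using fun_support_subsetD[OF \<psi>1(2)] that by (simp add: fourier_block_eq_scale)
    then have "\<bar>of_int (sgn n) * 2 powr (1 - of_int \<bar>n\<bar>) * x\<bar> \<in> {1/2..2}" by auto
    moreover have "\<bar>real_of_int (sgn n)\<bar> = 1" using that(2) by (auto simp: sgn_if)
    ultimately show ?thesis
      by (auto simp: abs_mult powr_diff field_simps)
  qed
  have supp0: "\<bar>x\<bar> \<le> 1" if "fourier_block \<psi>0 \<psi>1 0 x \<noteq> 0" for x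
    using fun_support_subsetD[OF \<psi>0(2), of x] that by (auto simp: fourier_block_def)
  show "symbol (fourier_block \<psi>0 \<psi>1 n)" for n
  proof (cases "n = 0")
    case True
    then show ?thesis using symbol_test_function[OF \<psi>0] by (simp add: fourier_block_def)
  next
    case False
    then show ?thesis unfolding fourier_block_eq_scale[OF False]
      by (intro symbol_scale symbol_test_function[OF \<psi>1]) (auto simp: sgn_if)
  qed
  show "1 \<le> 2 powr real_of_int \<bar>n\<bar>" for n by (intro ge_one_powr_ge_zero) auto
  show "\<bar>x\<bar> \<le> 2 powr real_of_int \<bar>n\<bar>" if "fourier_block \<psi>0 \<psi>1 n x \<noteq> 0" for n x
    using supp0[of x] supp1[of n x] that by (cases "n = 0") auto
  show "finite {n. \<exists>x. \<bar>x\<bar> \<le> T \<and> fourier_block \<psi>0 \<psi>1 n x \<noteq> 0}" for T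
  proof (rule finite_subset)
    show "{n. \<exists>x. \<bar>x\<bar> \<le> T \<and> fourier_block \<psi>0 \<psi>1 n x \<noteq> 0} \<subseteq> {- \<lceil>4 * \<bar>T\<bar>\<rceil>..\<lceil>4 * \<bar>T\<bar>\<rceil>}"
    proof clarify
      fix n x assume *: "\<bar>x\<bar> \<le> T" "fourier_block \<psi>0 \<psi>1 n x \<noteq> 0"
      \<comment> \<open>A crude bound from \<open>\<bar>n\<bar> \<le> 2 ^ \<bar>n\<bar>\<close>; the
        factor 4 compensates the exponent \<open>\<bar>n\<bar> - 2\<close> of the inner
        edge.\<close>
      have "real_of_int \<bar>n\<bar> \<le> 4 * \<bar>T\<bar>"
      proof (cases "n = 0")
        case False
        have "real_of_int \<bar>n\<bar> = real (nat \<bar>n\<bar>)" by simp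
        also have "\<dots> \<le> 2 ^ nat \<bar>n\<bar>" by (intro less_imp_le of_nat_less_two_power)
        also have "\<dots> = 4 * 2 powr (of_int \<bar>n\<bar> - 2)"
          by (simp add: powr_diff powr_realpow[symmetric])
        also have "\<dots> \<le> 4 * \<bar>T\<bar>" using supp1[OF *(2) False] *(1) by simp
        finally show ?thesis .
      qed simp
      then have "\<bar>n\<bar> \<le> \<lceil>4 * \<bar>T\<bar>\<rceil>" by linarith
      then show "n \<in> {- \<lceil>4 * \<bar>T\<bar>\<rceil>..\<lceil>4 * \<bar>T\<bar>\<rceil>}" by auto
    qed
  qed simp
  show "((\<lambda>n. fourier_block \<psi>0 \<psi>1 n x) has_sum 1) UNIV" for x using sum1 by blast
qed

section \<open>Antiderivatives of the kernels\<close>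

text \<open>The symbol of a \<open>j\<close>-th antiderivative of the kernel of \<open>a\<close>. At
  frequency 0 the convention \<open>inverse 0 = 0\<close> yields 0 for \<open>j > 0\<close>, and
  \<open>a 0\<close> for \<open>j = 0\<close>.\<close>

definition divide_iota :: "(real \<Rightarrow> complex) \<Rightarrow> nat \<Rightarrow> real \<Rightarrow> complex" where
  "divide_iota a j \<xi> = a \<xi> * inverse (\<i> * of_real \<xi>) ^ j"

text \<open>Away from 0 this is a product of differentiable functions; vanishing near 0 permits the
  extension across the singularity.\<close>

lemma symbol_divide_iota:
  assumes a: "symbol a" and \<delta>: "\<delta> > 0" "\<And>\<xi>. \<bar>\<xi>\<bar> < \<delta> \<Longrightarrow> a \<xi> = 0"
  shows "symbol (divide_iota a j)"
proof -
  have "times_diff_on (- {0}) 2 (\<lambda>\<xi>. a \<xi> * ((- \<i>) * inverse (of_real \<xi>)) ^ j)"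
    using a by (intro times_diff_on_mult times_diff_on_power times_diff_on_inverse)
      (auto simp: symbol_def intro: times_diff_on_subset)
  moreover have "(\<lambda>\<xi>. a \<xi> * ((- \<i>) * inverse (of_real \<xi>)) ^ j) = divide_iota a j"
    by (auto simp: divide_iota_def)
  ultimately have 1: "times_diff_on (- {0}) 2 (divide_iota a j)" by simp
  have "times_diff_on UNIV 2 (divide_iota a j)"
  proof (rule times_diff_on_extend[OF _ _ _ 1])
    show "closed {\<xi>. \<delta> \<le> \<bar>\<xi>\<bar>}" by (intro closed_Collect_le continuous_intros)
  qed (use \<delta> in \<open>auto simp: divide_iota_def\<close>)
  moreover have "bounded_support (divide_iota a j)"
    using a by (auto simp: symbol_def bounded_support_def divide_iota_def)
  ultimately show ?thesis by (simp add: symbol_def)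
qed

text \<open>The variable enters as \<open>x - y\<close>, so each integration in \<open>y\<close>
  contributes a sign. For \<open>N = 0\<close> continuity of the kernel is all that is
  claimed.\<close>

lemma iterated_antiderivs_kernel:
  assumes a: "symbol a" and N: "N = 0 \<or> (\<exists>\<delta>>0. \<forall>\<xi>. \<bar>\<xi>\<bar> < \<delta> \<longrightarrow> a \<xi> = 0)"
  shows "iterated_antiderivs N (\<lambda>j y. (-1) ^ j * inv_fourier (divide_iota a j) (x - y))"
proof -
  have sym: "symbol (divide_iota a j)" if "j \<le> N" for j
  proof (cases "N = 0")
    case True
    then show ?thesis using that a by (simp add: divide_iota_def[abs_def])
  next
    case False
    then show ?thesis using N symbol_divide_iota[OF a] by blast
  qed
  have cont: "continuous_on UNIV (inv_fourier (divide_iota a j))" if "j \<le> N" for j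
    using sym[OF that] symbol_continuous inv_fourier_continuous symbol_def by blast
  have deriv: "((\<lambda>y. (-1) ^ Suc j * inv_fourier (divide_iota a (Suc j)) (x - y)) has_vector_derivative
      (-1) ^ j * inv_fourier (divide_iota a j) (x - y)) (at y)" if "j < N" for j y
  proof -
    \<comment> \<open>Needed at \<open>\<xi> = 0\<close> with \<open>j = 0\<close>: there the left
      side of the next identity vanishes and the right side is \<open>a 0\<close>.\<close>
    have "a 0 = 0" using N that by auto
    have "\<i> * of_real \<xi> * divide_iota a (Suc j) \<xi> = divide_iota a j \<xi>" for \<xi>
    proof (cases "\<xi> = 0")
      case False
      have "\<i> * of_real \<xi> * divide_iota a (Suc j) \<xi>
          = (\<i> * of_real \<xi> * inverse (\<i> * of_real \<xi>)) * divide_iota a j \<xi>"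
        by (simp only: divide_iota_def power_Suc mult_ac)
      then show ?thesis using False by (simp del: inverse_mult_distrib)
    qed (use \<open>a 0 = 0\<close> in \<open>simp add: divide_iota_def\<close>)
    then have "(\<lambda>\<xi>. \<i> * of_real \<xi> * divide_iota a (Suc j) \<xi>) = divide_iota a j" by blast
    then have D: "(inv_fourier (divide_iota a (Suc j)) has_vector_derivative
        inv_fourier (divide_iota a j) (x - y)) (at (x - y))"
      using has_vector_derivative_inv_fourier[of "divide_iota a (Suc j)" "x - y"] that sym[of "Suc j"]
        symbol_continuous symbol_def by auto
    have "((\<lambda>y. x - y) has_vector_derivative -1) (at y)" by (auto intro!: derivative_eq_intros)
    from vector_diff_chain_at[OF this D]
    have "((\<lambda>y. inv_fourier (divide_iota a (Suc j)) (x - y)) has_vector_derivative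
       - inv_fourier (divide_iota a j) (x - y)) (at y)" by (simp add: o_def)
    from has_vector_derivative_mult_right[OF this, of "(-1) ^ Suc j"] show ?thesis by simp
  qed
  show ?thesis unfolding iterated_antiderivs_def
    using deriv by (auto intro!: continuous_intros continuous_on_compose2[OF cont])
qed

lemma convolve_translate:
  "convolve (\<lambda>s. g (s + c)) h x = convolve g h (x + c)"
  unfolding convolve_def using integral_shift[of "\<lambda>y. g y * h (x + c - y)" c]
  by (simp add: algebra_simps)

text \<open>Applied to shifts by \<open>k ln 2\<close>, this makes the frequency pieces of
  \<open>f (2 powi k * exp s)\<close> as large as those of \<open>f (exp s)\<close>, uniformly in
  \<open>k\<close>.\<close>

lemma sup_norm_convolve_translate: "sup_norm (convolve (\<lambda>s. g (s + c)) h) = sup_norm (convolve g h)"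
proof (rule antisym)
  show "sup_norm (convolve (\<lambda>s. g (s + c)) h) \<le> sup_norm (convolve g h)"
    unfolding sup_norm_def convolve_translate by (intro SUP_least SUP_upper) simp
  have "ennreal (norm (convolve g h x)) = ennreal (norm (convolve (\<lambda>s. g (s + c)) h (x - c)))" for x
    by (simp add: convolve_translate)
  then show "sup_norm (convolve g h) \<le> sup_norm (convolve (\<lambda>s. g (s + c)) h)"
    unfolding sup_norm_def by (auto intro!: SUP_least SUP_upper)
qed

lemma inverse_bracket_sum_finite:
  assumes "s > 1"
  obtains Z :: real where "Z \<ge> 0" "(\<Sum>\<^sub>\<infinity>n::int. ennreal ((1 + of_int \<bar>n\<bar>) powr - s)) \<le> ennreal Z"
proof -
  have "summable (\<lambda>n. real n powr - s)" using assms by (simp add: summable_real_powr_iff)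
  then have "summable (\<lambda>n. real (Suc n) powr - s)" by (subst summable_Suc_iff)
  then have 1: "summable (\<lambda>n. (1 + real n) powr - s)" by (simp add: add.commute)
  obtain Z where "Z \<ge> 0" "(\<Sum>\<^sub>\<infinity>n::int. ennreal ((1 + real (nat \<bar>n\<bar>)) powr - s)) \<le> ennreal Z"
    using infsum_int_ennreal_finite[OF 1] by auto
  then show ?thesis using that by simp
qed

lemma geometric_sum_finite:
  assumes "s > 0"
  obtains Z :: real where "Z \<ge> 0" "(\<Sum>\<^sub>\<infinity>n::int. ennreal (2 powr - (of_int \<bar>n\<bar> * s))) \<le> ennreal Z"
proof -
  have "2 powr - (real n * s) = (2 powr - s) ^ n" for n
    by (simp add: powr_powr[symmetric] mult.commute flip: powr_realpow) 
      (simp add: powr_powr mult.commute)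
  moreover have "norm (2 powr - s :: real) < 1" using assms powr_less_mono[of "- s" 0 2] by simp
  ultimately have 1: "summable (\<lambda>n. 2 powr - (real n * s) :: real)"
    using summable_geometric by simp
  obtain Z where "Z \<ge> 0" "(\<Sum>\<^sub>\<infinity>n::int. ennreal (2 powr - (real (nat \<bar>n\<bar>) * s))) \<le> ennreal Z"
    using infsum_int_ennreal_finite[OF 1] by auto
  then show ?thesis using that by simp
qed

lemma (in localization) local_L1_le:
  assumes "\<And>y. norm (w y) \<le> B"
  shows "local_L1 w \<le> (r - l) * B"
proof -
  have "B \<ge> 0" using assms norm_ge_zero order_trans by blast
  then have "local_L1 w \<le> (\<integral>y. indicator {l..r} y * B \<partial>lborel)"
    unfolding local_L1_def using assms integral_eq_lborel(2)[of "\<lambda>_. B"]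
    by (intro integral_mono') (auto simp: indicator_def cong: if_cong)
  also have "\<dots> = (r - l) * B" using bounds by simp
  finally show ?thesis .
qed

lemma divide_iota_0 [simp]: "divide_iota a 0 = a"
  by (simp add: divide_iota_def[abs_def])

lemma exp_add_int_ln2: "exp (s + of_int k * ln 2) = 2 powi k * exp (s :: real)"
  using powr_real_of_int'[of 2 k] by (simp add: exp_add powr_def)

text \<open>The integers concerned lie within 4 of \<open>s / L\<close>, leaving at most
  \<open>2 * 4 + 1 = 9\<close> candidates. With \<open>L = ln 2\<close> this counts overlapping
  windows of dyadic pieces.\<close>

lemma card_int_near:
  fixes s L :: real
  assumes "finite F" "L > 0"
  shows "(\<Sum>k\<in>F. of_bool (\<bar>s - of_int k * L\<bar> \<le> 4 * L)) \<le> (9::real)"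
proof -
  have "(\<Sum>k\<in>F. of_bool (\<bar>s - of_int k * L\<bar> \<le> 4 * L) :: real)
      = card {k\<in>F. \<bar>s - of_int k * L\<bar> \<le> 4 * L}"
    using assms by (simp add: Int_def flip: sum.inter_filter)
  also have "\<dots> \<le> card {\<lceil>s / L\<rceil> - 4..\<lceil>s / L\<rceil> + 4}"
  proof (intro of_nat_mono card_mono)
    show "{k \<in> F. \<bar>s - of_int k * L\<bar> \<le> 4 * L} \<subseteq> {\<lceil>s / L\<rceil> - 4..\<lceil>s / L\<rceil> + 4}"
    proof clarify
      fix k assume "\<bar>s - of_int k * L\<bar> \<le> 4 * L"
      then have "s \<le> (of_int k + 4) * L" "(of_int k - 4) * L \<le> s" by (auto simp: algebra_simps)
      then have "s / L \<le> of_int k + 4" "of_int k - 4 \<le> s / L"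
        using assms by (auto simp: field_simps)
      then show "k \<in> {\<lceil>s / L\<rceil> - 4..\<lceil>s / L\<rceil> + 4}" by simp linarith
    qed
  qed simp
  also have "\<dots> = 9" by simp
  finally show ?thesis by simp
qed

section \<open>The three partitions together and the two instances of the localization\<close>

locale partitions_of_unity =
  fixes \<phi> \<phi>' \<psi>0 \<psi>1 :: "real \<Rightarrow> complex"
  assumes equi: "equidistant_partition \<phi>" and dyad: "dyadic_partition \<phi>'"
    and four: "fourier_partition \<psi>0 \<psi>1"
begin

lemma \<phi>_facts: "symbol \<phi>" "\<phi> x \<noteq> 0 \<Longrightarrow> \<bar>x\<bar> \<le> 1"
  using equi symbol_test_function[of \<phi> "-1" 1] fun_support_subsetD[of \<phi> "{-1..1}" x]
  by (auto simp: equidistant_partition_def)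

lemma \<phi>'_facts: "times_diff_on UNIV n \<phi>'" "symbol \<phi>'" "\<phi>' x \<noteq> 0 \<Longrightarrow> x \<in> {1/2..2}"
  using dyad symbol_test_function[of \<phi>' "1/2" 2] fun_support_subsetD[of \<phi>' "{1/2..2}" x]
    test_function_times_diff_on
  by (auto simp: dyadic_partition_def)

lemma \<psi>_facts: "symbol \<psi>0" "symbol \<psi>1" "\<psi>1 x \<noteq> 0 \<Longrightarrow> x \<in> {1/2..2}"
  using four symbol_test_function[of \<psi>0 "-1" 1] symbol_test_function[of \<psi>1 "1/2" 2]
    fun_support_subsetD[of \<psi>1 "{1/2..2}" x]
  by (auto simp: fourier_partition_def)

lemma dyadic_block_exp: "dyadic_block \<phi>' k (exp s) = \<phi>' (exp (s - of_int k * ln 2))"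
  using exp_add_int_ln2[of s "- k"] by (simp add: dyadic_block_def)

lemma dyadic_block_exp_support:
  assumes "dyadic_block \<phi>' k (exp s) \<noteq> 0"
  shows "\<bar>s - of_int k * ln 2\<bar> \<le> ln 2"
proof -
  have "exp (s - of_int k * ln 2) \<in> {1/2..2}"
    using \<phi>'_facts(3) assms by (simp add: dyadic_block_exp)
  then have "exp (- ln 2) \<le> exp (s - of_int k * ln 2)" "exp (s - of_int k * ln 2) \<le> exp (ln 2)"
    by (auto simp: exp_minus)
  then show ?thesis unfolding exp_le_cancel_iff by linarith
qed

text \<open>The frequency pieces of a function supported in \<open>[1/2, 2]\<close> are not compactly supported, so a
  second cutoff, equal to 1 on that support, is inserted before decomposing.\<close>

definition log_cutoff :: "real \<Rightarrow> complex" where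
  "log_cutoff u = (\<Sum>j\<in>{-2..2}. dyadic_block \<phi>' j (exp u))"

lemma log_cutoff_eq_1:
  assumes "\<phi>' (exp u) \<noteq> 0"
  shows "log_cutoff u = 1" "u \<in> {- (4 * ln 2)..4 * ln 2}"
proof -
  have u: "\<bar>u\<bar> \<le> ln 2" using dyadic_block_exp_support[of 0 u] assms by (simp add: dyadic_block_def)
  have "u \<le> 4 * ln 2" "- (4 * ln 2) \<le> u" using u ln_gt_zero[of "2::real"] by (simp_all add: abs_le_iff)
  then show "u \<in> {- (4 * ln 2)..4 * ln 2}" by simp
  have sum1: "((\<lambda>j. dyadic_block \<phi>' j (exp u)) has_sum 1) UNIV"
    using dyad by (simp add: dyadic_partition_def)
  have "j \<in> {-2..2}" if "dyadic_block \<phi>' j (exp u) \<noteq> 0" for j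
  proof -
    have "\<bar>of_int j * ln 2\<bar> \<le> (2 * ln 2 :: real)" using dyadic_block_exp_support[OF that] u by linarith
    then have "\<bar>of_int j\<bar> * ln 2 \<le> (2 * ln 2 :: real)" by (simp add: abs_mult)
    then have "real_of_int \<bar>j\<bar> \<le> 2" by simp
    then show ?thesis by auto
  qed
  then have "((\<lambda>j. dyadic_block \<phi>' j (exp u)) has_sum 1) {-2..2}"
    by (intro has_sum_cong_neutral[THEN iffD1, OF _ _ _ sum1]) auto
  then show "log_cutoff u = 1"
    unfolding log_cutoff_def
    using has_sum_finite[of "{-2..2::int}" "\<lambda>j. dyadic_block \<phi>' j (exp u)"] has_sum_unique by blast
qed

text \<open>Here the cutoff is \<open>\<phi>'\<close> itself, supported in \<open>[1/2, 2]\<close>;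
  \<open>[1/4, 4]\<close> is a convenient larger interval inside the domain of
  \<open>ln\<close>.\<close>

sublocale log: localized_partition "{0<..}" "1/4" "1/2" 2 4 ln inverse \<phi>' "fourier_block \<psi>0 \<psi>1"
  "\<lambda>n. 2 powr of_int \<bar>n\<bar>" "plateau \<phi>"
proof (intro localized_partition.intro localization.intro partition_fourier[OF four]
    localized_partition_axioms.intro symbol_plateau[OF equi] plateau_eq_1[OF equi])
  show "times_diff_on {0<..} m (\<lambda>x. complex_of_real (inverse x))" for m
    using times_diff_on_subset[OF times_diff_on_inverse[of m]] by (simp add: subset_iff)
  show "times_diff_on {0<..} m \<phi>'" for m
    using \<phi>'_facts(1) times_diff_on_subset by blast
  show "\<phi>' x = 0" if "x \<notin> {1/2..2}" for x using \<phi>'_facts(3) that by blast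
qed (auto intro!: DERIV_ln)

text \<open>The blocks in \<open>log_cutoff\<close> sit within \<open>ln 2\<close> of
  \<open>j ln 2\<close> with \<open>\<bar>j\<bar> \<le> 2\<close>, hence the inner interval of
  half-length \<open>3 ln 2\<close>; one more \<open>ln 2\<close> is the margin. The outer
  half-length \<open>4 ln 2\<close> is the window of the overlap count.\<close>

sublocale expo: localized_partition UNIV "- (4 * ln 2)" "- (3 * ln 2)" "3 * ln 2" "4 * ln 2" exp exp log_cutoff
  "equidistant_block \<phi>" "\<lambda>n. 1 + of_int \<bar>n\<bar>" "plateau \<phi>"
proof (intro localized_partition.intro localization.intro partition_equidistant[OF equi]
    localized_partition_axioms.intro symbol_plateau[OF equi] plateau_eq_1[OF equi])
  show "times_diff_on UNIV m (\<lambda>x. complex_of_real (exp x))" for m by (rule times_diff_on_exp)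
  show "times_diff_on UNIV m log_cutoff" for m
    unfolding log_cutoff_def[abs_def] dyadic_block_def
    using times_diff_on_subset[OF times_diff_on_affine[OF \<phi>'_facts(1), of m _ 0]]
    by (intro times_diff_on_sum times_diff_on_compose_exp) auto
  show "log_cutoff x = 0" if "x \<notin> {- (3 * ln 2)..3 * ln 2}" for x
    unfolding log_cutoff_def
  proof (rule sum.neutral, rule ballI, rule ccontr)
    fix j :: int assume j: "j \<in> {-2..2}" and "dyadic_block \<phi>' j (exp x) \<noteq> 0"
    then have x: "\<bar>x - of_int j * ln 2\<bar> \<le> ln 2" using dyadic_block_exp_support by blast
    have "of_int j * ln 2 \<le> 2 * (ln 2 :: real)" "- 2 * ln 2 \<le> of_int j * (ln 2 :: real)"
      using j by (intro mult_right_mono; auto)+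
    then have "x \<le> 3 * ln 2" "- (3 * ln 2) \<le> x" using x unfolding abs_le_iff by linarith+
    then show False using that by simp
  qed
qed (auto intro!: derivative_eq_intros)

section \<open>The first embedding\<close>

text \<open>On the support \<open>\<bar>\<xi>\<bar> \<ge> \<bar>n\<bar> - 1\<close>, which for
  \<open>\<bar>n\<bar> \<ge> 2\<close> is at least \<open>(1 + \<bar>n\<bar>) / 3\<close>, with
  equality at \<open>\<bar>n\<bar> = 2\<close>. Each division by \<open>\<i> \<xi>\<close> thus
  gains a factor \<open>3 / (1 + \<bar>n\<bar>)\<close>.\<close>

lemma norm_inv_fourier_equidistant_antideriv:
  assumes "N = 0 \<or> \<bar>n\<bar> \<ge> 2"
  shows "norm (inv_fourier (divide_iota (equidistant_block \<phi> n) N) x)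
    \<le> (3 / (1 + of_int \<bar>n\<bar>)) ^ N * (\<integral>\<xi>. norm (\<phi> \<xi>) \<partial>lborel)"
proof -
  let ?a = "equidistant_block \<phi> n"
  have "norm (inv_fourier (divide_iota ?a N) x) \<le> (\<integral>\<xi>. norm (divide_iota ?a N \<xi>) \<partial>lborel)"
    by (rule norm_inv_fourier_le)
  also have "\<dots> \<le> (\<integral>\<xi>. (3 / (1 + of_int \<bar>n\<bar>)) ^ N * norm (?a \<xi>) \<partial>lborel)"
  proof (rule integral_mono')
    show "integrable lborel (\<lambda>\<xi>. (3 / (1 + of_int \<bar>n\<bar>)) ^ N * norm (?a \<xi>))"
      using symbol_integrable[OF expo.symbol_q[of n]] by simp
    show "norm (divide_iota ?a N \<xi>) \<le> (3 / (1 + of_int \<bar>n\<bar>)) ^ N * norm (?a \<xi>)" for \<xi>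
    proof (cases "N = 0 \<or> ?a \<xi> = 0")
      case True
      then show ?thesis by (auto simp: divide_iota_def)
    next
      case False
      then have "\<bar>\<xi> - of_int n\<bar> \<le> 1" "\<bar>n\<bar> \<ge> 2"
        using \<phi>_facts(2) assms by (auto simp: equidistant_block_def)
      then have "1 + of_int \<bar>n\<bar> \<le> 3 * \<bar>\<xi>\<bar>" "\<bar>\<xi>\<bar> > 0" by linarith+
      then have "inverse \<bar>\<xi>\<bar> \<le> 3 / (1 + of_int \<bar>n\<bar>)" by (simp add: field_simps)
      then have "inverse \<bar>\<xi>\<bar> ^ N \<le> (3 / (1 + of_int \<bar>n\<bar>)) ^ N" by (intro power_mono) auto
      then have "inverse \<bar>\<xi>\<bar> ^ N * norm (?a \<xi>) \<le> (3 / (1 + of_int \<bar>n\<bar>)) ^ N * norm (?a \<xi>)"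
        by (rule mult_right_mono) simp
      then show ?thesis
        by (simp add: divide_iota_def norm_mult norm_power norm_inverse mult.commute
            del: inverse_mult_distrib)
    qed
  qed auto
  also have "\<dots> = (3 / (1 + of_int \<bar>n\<bar>)) ^ N * (\<integral>\<xi>. norm (\<phi> \<xi>) \<partial>lborel)"
    using integral_shift[of "\<lambda>\<xi>. norm (\<phi> \<xi>)" "- of_int n"] by (simp add: equidistant_block_def)
  finally show ?thesis .
qed

lemma log_kernel_bound:
  assumes "\<beta> \<ge> 0"
  shows "\<exists>C\<ge>0. \<forall>n m x c h B. c > 0 \<longrightarrow> h \<in> borel_measurable borel \<longrightarrow> (\<forall>x. norm (h x) \<le> B) \<longrightarrow>
    norm (log.pairing (\<lambda>y. inv_fourier (equidistant_block \<phi> n) (x - y))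
        (convolve h (inv_fourier (\<lambda>\<xi>. plateau \<phi> (inverse (2 powr of_int \<bar>m::int\<bar>) * \<xi>) * plateau \<phi> (c * \<xi>)))))
      \<le> B * (C * (2 powr of_int \<bar>m\<bar> / (1 + of_int \<bar>n\<bar>)) powr \<beta>)"
proof -
  define N where "N = nat \<lceil>\<beta>\<rceil>"
  have N: "\<beta> \<le> real N" unfolding N_def by linarith
  obtain C0 where C0: "C0 \<ge> 0" "\<And>R c W g M. R \<ge> 1 \<Longrightarrow> c > 0 \<Longrightarrow> iterated_antiderivs 0 W \<Longrightarrow>
     g \<in> borel_measurable borel \<Longrightarrow> (\<forall>x. norm (g x) \<le> M) \<Longrightarrow>
     norm (log.pairing (W 0) (convolve g (inv_fourier (\<lambda>\<xi>. plateau \<phi> (inverse R * \<xi>) * plateau \<phi> (c * \<xi>)))))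
       \<le> M * (C0 * R ^ 0 * log.local_L1 (W 0))"
    using log.pairing_kernel_bound[OF symbol_plateau[OF equi], of 0] by blast
  obtain CN where CN: "CN \<ge> 0" "\<And>R c W g M. R \<ge> 1 \<Longrightarrow> c > 0 \<Longrightarrow> iterated_antiderivs N W \<Longrightarrow>
     g \<in> borel_measurable borel \<Longrightarrow> (\<forall>x. norm (g x) \<le> M) \<Longrightarrow>
     norm (log.pairing (W 0) (convolve g (inv_fourier (\<lambda>\<xi>. plateau \<phi> (inverse R * \<xi>) * plateau \<phi> (c * \<xi>)))))
       \<le> M * (CN * R ^ N * log.local_L1 (W N))"
    using log.pairing_kernel_bound[OF symbol_plateau[OF equi], of N] by blast
  define S where "S = (\<integral>\<xi>. norm (\<phi> \<xi>) \<partial>lborel)"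
  have S: "S \<ge> 0" unfolding S_def by (intro Bochner_Integration.integral_nonneg) auto
  \<comment> \<open>\<open>15 / 4\<close> is the length of \<open>[1/4, 4]\<close>; the two summands
    serve the two cases below.\<close>
  define C where "C = (15 / 4) * S * (CN * 3 ^ N + C0 * 3 powr \<beta>)"
  show ?thesis
  proof (intro exI[of _ C] conjI allI impI)
    fix n m :: int and x c B :: real and h :: "real \<Rightarrow> complex"
    assume c: "c > 0" and h: "h \<in> borel_measurable borel" "\<forall>x. norm (h x) \<le> B"
    have B: "B \<ge> 0" using h(2) norm_ge_zero order_trans by blast
    let ?a = "equidistant_block \<phi> n"
    let ?W = "\<lambda>j y. (-1) ^ j * inv_fourier (divide_iota ?a j) (x - y)"
    define R where "R = (2::real) powr of_int \<bar>m\<bar>"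
    define \<rho> where "\<rho> = R / (1 + of_int \<bar>n\<bar>)"
    have R: "R \<ge> 1" unfolding R_def by (rule log.R_ge_1)
    have \<rho>: "\<rho> > 0" using R by (simp add: \<rho>_def)
    have L1: "log.local_L1 (?W j) \<le> 15 / 4 * ((3 / (1 + of_int \<bar>n\<bar>)) ^ j * S)"
      if "j = 0 \<or> \<bar>n\<bar> \<ge> 2" for j
      using log.local_L1_le[of "?W j", OF _] norm_inv_fourier_equidistant_antideriv[OF that]
      by (simp add: norm_mult norm_power S_def)
    let ?P = "norm (log.pairing (?W 0)
        (convolve h (inv_fourier (\<lambda>\<xi>. plateau \<phi> (inverse R * \<xi>) * plateau \<phi> (c * \<xi>)))))"
    have "?P \<le> B * (C * \<rho> powr \<beta>)"
    \<comment> \<open>In the first case \<open>N\<close> integrations give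
      \<open>\<rho> ^ N\<close>, at most \<open>\<rho> powr \<beta>\<close> as
      \<open>\<rho> \<le> 1\<close> and \<open>\<beta> \<le> N\<close>. In the second none is made,
      and the trivial bound must be compared with \<open>(3 \<rho>) powr \<beta>\<close>.\<close>
    proof (cases "\<bar>n\<bar> \<ge> 2 \<and> \<rho> \<le> 1")
      case True
      have "\<exists>\<delta>>0. \<forall>\<xi>. \<bar>\<xi>\<bar> < \<delta> \<longrightarrow> ?a \<xi> = 0"
      proof (intro exI[of _ "1::real"] conjI allI impI)
        fix \<xi> :: real assume "\<bar>\<xi>\<bar> < 1"
        then have "\<bar>\<xi> - of_int n\<bar> > 1" using True by linarith
        then show "?a \<xi> = 0" using \<phi>_facts(2)[of "\<xi> - of_int n"] by (force simp: equidistant_block_def)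
      qed simp
      then have "iterated_antiderivs N ?W" by (intro iterated_antiderivs_kernel expo.symbol_q) blast
      from CN(2)[OF R c this h] have "?P \<le> B * (CN * R ^ N * log.local_L1 (?W N))" by simp
      also have "\<dots> \<le> B * (CN * R ^ N * (15 / 4 * ((3 / (1 + of_int \<bar>n\<bar>)) ^ N * S)))"
        using True R CN(1) B by (intro mult_left_mono L1) auto
      also have "\<dots> = B * ((15 / 4 * S * (CN * 3 ^ N)) * \<rho> ^ N)"
        by (simp add: \<rho>_def power_divide)
      also have "\<dots> \<le> B * ((15 / 4 * S * (CN * 3 ^ N)) * \<rho> powr \<beta>)"
      proof (intro mult_left_mono)
        show "\<rho> ^ N \<le> \<rho> powr \<beta>"
          using powr_mono'[OF N, of \<rho>] \<rho> True by (simp add: powr_realpow)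
      qed (use S CN B in auto)
      also have "\<dots> \<le> B * (C * \<rho> powr \<beta>)"
        unfolding C_def using S CN C0 B by (intro mult_left_mono mult_right_mono) auto
      finally show ?thesis .
    next
      case False
      have "iterated_antiderivs 0 ?W" by (intro iterated_antiderivs_kernel expo.symbol_q) simp
      from C0(2)[OF R c this h] have "?P \<le> B * (C0 * log.local_L1 (?W 0))" by simp
      also have "\<dots> \<le> B * (C0 * (15 / 4 * S))"
        using C0(1) B L1[of 0] by (intro mult_left_mono) auto
      also have "\<dots> \<le> B * ((C0 * (15 / 4 * S)) * (3 powr \<beta> * \<rho> powr \<beta>))"
      proof -
        \<comment> \<open>If \<open>\<rho> \<le> 1\<close>, then \<open>\<bar>n\<bar> < 2\<close>,
          so \<open>\<rho> \<ge> R / 2 \<ge> 1 / 2\<close>.\<close>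
        have "1 \<le> 3 * \<rho>"
        proof (cases "\<rho> \<le> 1")
          case True
          then have "\<bar>n\<bar> < 2" using False by simp
          then have "1 + real_of_int \<bar>n\<bar> \<le> 2" by linarith
          then show ?thesis using R by (simp add: \<rho>_def field_simps)
        qed simp
        then have "1 \<le> (3 * \<rho>) powr \<beta>" using assms by (rule ge_one_powr_ge_zero)
        then have "1 \<le> 3 powr \<beta> * \<rho> powr \<beta>" using \<rho> by (simp add: powr_mult)
        then show ?thesis
          using C0(1) S B mult_left_mono[of 1 "3 powr \<beta> * \<rho> powr \<beta>" "C0 * (15 / 4 * S)"]
          by (intro mult_left_mono) auto
      qed
      also have "\<dots> = B * (((15 / 4) * S * (C0 * 3 powr \<beta>)) * \<rho> powr \<beta>)" by simp
      also have "\<dots> \<le> B * (C * \<rho> powr \<beta>)"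
        unfolding C_def using S CN C0 B by (intro mult_left_mono mult_right_mono) auto
      finally show ?thesis .
    qed
    then show "norm (log.pairing (\<lambda>y. inv_fourier ?a (x - y))
        (convolve h (inv_fourier (\<lambda>\<xi>. plateau \<phi> (inverse (2 powr of_int \<bar>m\<bar>) * \<xi>) * plateau \<phi> (c * \<xi>)))))
      \<le> B * (C * (2 powr of_int \<bar>m\<bar> / (1 + of_int \<bar>n\<bar>)) powr \<beta>)"
      by (simp add: R_def \<rho>_def)
  next
    show "C \<ge> 0" unfolding C_def using S C0 CN by simp
  qed
qed

abbreviation (input) rescaled :: "(real \<Rightarrow> complex) \<Rightarrow> int \<Rightarrow> real \<Rightarrow> complex" where
  "rescaled f k \<equiv> (\<lambda>x. if 0 < x then f (2 powi k * x) * dyadic_block \<phi>' 0 x else 0)"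

text \<open>In the variable \<open>ln y\<close> the dilation by \<open>2 powi k\<close> is a shift
  by \<open>k ln 2\<close>. Replacing \<open>ln\<close> by \<open>log.clip\<close> is harmless,
  since \<open>\<phi>'\<close> vanishes outside \<open>[1/4, 4]\<close>.\<close>

lemma convolve_rescaled_eq_pairing:
  "convolve (rescaled f k) h x = log.pairing (\<lambda>y. h (x - y)) (\<lambda>s. f (exp (s + of_int k * ln 2)))"
  unfolding convolve_def log.pairing_def
proof (rule Bochner_Integration.integral_cong[OF refl])
  fix y
  show "rescaled f k y * h (x - y) = log.weight (\<lambda>y. h (x - y)) y * f (exp (log.clip y + of_int k * ln 2))"
  proof (cases "y \<in> {1/4..4}")
    case True
    then show ?thesis
      by (simp add: log.weight_def log.clip_def exp_add_int_ln2 dyadic_block_def)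
  next
    case False
    then have "\<phi>' y = 0" using \<phi>'_facts(3)[of y] by force
    then show ?thesis using False by (auto simp: log.weight_def dyadic_block_def)
  qed
qed

text \<open>The estimate for one \<open>n\<close> does not depend on \<open>k\<close>, because the
  norms of the frequency pieces are translation invariant. The weight \<open>\<alpha>\<close>
  against the decay \<open>\<beta>\<close> leaves the exponent \<open>- (1 + \<epsilon>)\<close>,
  just summable over the integers.\<close>

lemma first_embedding:
  assumes \<alpha>: "\<alpha> > 0" and \<epsilon>: "\<epsilon> > 0"
  shows "\<exists>C\<ge>0. \<forall>f. (\<lambda>s. f (exp s)) \<in> bcontfun \<longrightarrow>
    E_unif_norm \<phi> \<phi>' \<alpha> f \<le> ennreal C * M_norm \<psi>0 \<psi>1 (\<alpha> + 1 + \<epsilon>) f"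
proof -
  define \<beta> where "\<beta> = \<alpha> + 1 + \<epsilon>"
  obtain C where C: "C \<ge> 0" "\<And>n m x c h B. c > 0 \<Longrightarrow> h \<in> borel_measurable borel \<Longrightarrow> (\<forall>x. norm (h x) \<le> B) \<Longrightarrow>
    norm (log.pairing (\<lambda>y. inv_fourier (equidistant_block \<phi> n) (x - y))
        (convolve h (inv_fourier (\<lambda>\<xi>. plateau \<phi> (inverse (2 powr of_int \<bar>m::int\<bar>) * \<xi>) * plateau \<phi> (c * \<xi>)))))
      \<le> B * (C * (2 powr of_int \<bar>m\<bar> / (1 + of_int \<bar>n\<bar>)) powr \<beta>)"
    using log_kernel_bound[of \<beta>] \<alpha> \<epsilon> unfolding \<beta>_def by fastforce
  have "1 + \<epsilon> > 1" using \<epsilon> by simp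
  from inverse_bracket_sum_finite[OF this] obtain Z where
    Z: "Z \<ge> 0" "(\<Sum>\<^sub>\<infinity>n::int. ennreal ((1 + of_int \<bar>n\<bar>) powr - (1 + \<epsilon>))) \<le> ennreal Z" .
  show ?thesis
  proof (intro exI[of _ "C * Z"] conjI allI impI)
    fix f :: "real \<Rightarrow> complex" assume f: "(\<lambda>s. f (exp s)) \<in> bcontfun"
    let ?g = "\<lambda>s. f (exp s)"
    have cont: "continuous_on UNIV ?g" and bdd: "bounded (range ?g)" using f by (auto simp: bcontfun_def)
    obtain M where M: "\<And>s. norm (?g s) \<le> M" using bdd by (auto simp: bounded_iff)
    let ?M = "M_norm \<psi>0 \<psi>1 \<beta> f"
    define s where "s m = sup_norm (convolve ?g (inv_fourier (fourier_block \<psi>0 \<psi>1 m)))" for m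
    have bound: "sup_norm (convolve (rescaled f k) (inv_fourier (equidistant_block \<phi> n)))
        \<le> ennreal (C * (1 + of_int \<bar>n\<bar>) powr - \<beta>) * ?M" for k n
    proof (rule sup_norm_leI)
      fix x
      let ?w = "\<lambda>y. inv_fourier (equidistant_block \<phi> n) (x - y)"
      let ?gk = "\<lambda>s. ?g (s + of_int k * ln 2)"
      have w: "continuous_on UNIV ?w"
        using expo.symbol_q[of n] symbol_continuous symbol_def
        by (intro continuous_on_compose2[OF inv_fourier_continuous[of _ UNIV]] continuous_intros) auto
      have gk: "continuous_on UNIV ?gk"
        by (rule continuous_on_compose2[OF cont]) (auto intro!: continuous_intros)
      have "ennreal (norm (log.pairing ?w ?gk))
        \<le> (\<Sum>\<^sub>\<infinity>m. sup_norm (convolve ?gk (inv_fourier (fourier_block \<psi>0 \<psi>1 m)))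
              * ennreal (C * (2 powr of_int \<bar>m\<bar> / (1 + of_int \<bar>n\<bar>)) powr \<beta>))"
        using C M by (intro log.pairing_sum_bound[OF w gk]) auto
      also have "\<dots> = (\<Sum>\<^sub>\<infinity>m. ennreal (C * (1 + of_int \<bar>n\<bar>) powr - \<beta>) *
          (ennreal (2 powr (of_int \<bar>m\<bar> * \<beta>)) * s m))"
      proof (rule infsum_cong)
        fix m :: int
        have eq: "C * (2 powr of_int \<bar>m\<bar> / (1 + of_int \<bar>n\<bar>)) powr \<beta>
            = (C * (1 + of_int \<bar>n\<bar>) powr - \<beta>) * 2 powr (of_int \<bar>m\<bar> * \<beta>)"
          by (simp add: powr_divide powr_powr powr_minus field_simps)
        show "sup_norm (convolve ?gk (inv_fourier (fourier_block \<psi>0 \<psi>1 m)))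
              * ennreal (C * (2 powr of_int \<bar>m\<bar> / (1 + of_int \<bar>n\<bar>)) powr \<beta>)
            = ennreal (C * (1 + of_int \<bar>n\<bar>) powr - \<beta>) * (ennreal (2 powr (of_int \<bar>m\<bar> * \<beta>)) * s m)"
          unfolding eq using C(1) sup_norm_convolve_translate[of ?g "of_int k * ln 2"]
          by (simp add: s_def ennreal_mult mult_ac)
      qed
      also have "\<dots> \<le> ennreal (C * (1 + of_int \<bar>n\<bar>) powr - \<beta>) * ?M"
        unfolding M_norm_def B_norm_def s_def by (rule infsum_ennreal_cmult_le)
      finally show "ennreal (norm (convolve (rescaled f k) (inv_fourier (equidistant_block \<phi> n)) x))
          \<le> ennreal (C * (1 + of_int \<bar>n\<bar>) powr - \<beta>) * ?M"
        unfolding convolve_rescaled_eq_pairing .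
    qed
    have "E_unif_norm \<phi> \<phi>' \<alpha> f \<le> (\<Sum>\<^sub>\<infinity>n::int. (ennreal C * ?M) * ennreal ((1 + of_int \<bar>n\<bar>) powr - (1 + \<epsilon>)))"
      unfolding E_unif_norm_def
    proof (rule infsum_ennreal_mono)
      fix n :: int
      have "ennreal ((1 + of_int \<bar>n\<bar>) powr \<alpha>) *
          (SUP k. sup_norm (convolve (rescaled f k) (inv_fourier (equidistant_block \<phi> n))))
        \<le> ennreal ((1 + of_int \<bar>n\<bar>) powr \<alpha>) * (ennreal (C * (1 + of_int \<bar>n\<bar>) powr - \<beta>) * ?M)"
        by (intro mult_left_mono SUP_least bound) auto
      also have "\<dots> = ennreal ((1 + of_int \<bar>n\<bar>) powr \<alpha> * (C * (1 + of_int \<bar>n\<bar>) powr - \<beta>)) * ?M"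
        using C(1) by (simp add: ennreal_mult mult.assoc)
      also have "(1 + of_int \<bar>n\<bar>) powr \<alpha> * (C * (1 + of_int \<bar>n\<bar>) powr - \<beta>)
          = C * (1 + of_int \<bar>n\<bar>) powr - (1 + \<epsilon>)"
      proof -
        have "- (1 + \<epsilon>) = \<alpha> + - \<beta>" by (simp add: \<beta>_def)
        then show ?thesis by (simp only: powr_add) simp
      qed
      also have "ennreal (C * (1 + of_int \<bar>n\<bar>) powr - (1 + \<epsilon>)) * ?M
          = (ennreal C * ?M) * ennreal ((1 + of_int \<bar>n\<bar>) powr - (1 + \<epsilon>))"
        using C(1) by (simp add: ennreal_mult mult_ac)
      finally show "ennreal ((1 + of_int \<bar>n\<bar>) powr \<alpha>) *
          (SUP k. sup_norm (convolve (rescaled f k) (inv_fourier (equidistant_block \<phi> n))))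
        \<le> (ennreal C * ?M) * ennreal ((1 + of_int \<bar>n\<bar>) powr - (1 + \<epsilon>))" .
    qed
    also have "\<dots> \<le> (ennreal C * ?M) * (\<Sum>\<^sub>\<infinity>n::int. ennreal ((1 + of_int \<bar>n\<bar>) powr - (1 + \<epsilon>)))"
      by (rule infsum_ennreal_cmult_le)
    also have "\<dots> \<le> (ennreal C * ?M) * ennreal Z" by (intro mult_left_mono Z) auto
    also have "\<dots> = ennreal (C * Z) * ?M" using C(1) Z(1) by (simp add: ennreal_mult mult_ac)
    finally show "E_unif_norm \<phi> \<phi>' \<alpha> f \<le> ennreal (C * Z) * M_norm \<psi>0 \<psi>1 (\<alpha> + 1 + \<epsilon>) f"
      by (simp add: \<beta>_def)
  qed (use C Z in simp)
qed

end

section \<open>The second embedding\<close>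

context partitions_of_unity begin

text \<open>Shifting the \<open>k\<close>-th term by \<open>k ln 2\<close> turns the sum into
  integrals of one function over moving windows, and every point lies in at most 9 of them. This
  makes the sum over all dyadic pieces cost only a constant.\<close>

lemma sum_local_L1_translates:
  assumes F: "finite F" and w: "continuous_on UNIV w" "integrable lborel w"
  shows "(\<Sum>k\<in>F. expo.local_L1 (\<lambda>u. w (t - of_int k * ln 2 - u))) \<le> 9 * (\<integral>x. norm (w x) \<partial>lborel)"
proof -
  let ?L = "ln 2 :: real"
  let ?i = "\<lambda>k v. of_bool (\<bar>v - of_int k * ?L\<bar> \<le> 4 * ?L) :: real"
  have iw: "integrable lborel (\<lambda>v. norm (w (t - v)))"
    using integrable_reflect_shift[OF integrable_norm[OF w(2)]] .
  have wm: "w \<in> borel_measurable borel" using w(1) by (rule borel_measurable_continuous_onI)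
  have "expo.local_L1 (\<lambda>u. w (t - of_int k * ?L - u)) = (\<integral>v. ?i k v * norm (w (t - v)) \<partial>lborel)" for k
  proof -
    have "expo.local_L1 (\<lambda>u. w (t - of_int k * ?L - u))
       = (\<integral>u. ?i k (u + of_int k * ?L) * norm (w (t - (u + of_int k * ?L))) \<partial>lborel)"
      unfolding expo.local_L1_def
      by (intro Bochner_Integration.integral_cong) (auto simp: indicator_def abs_le_iff algebra_simps)
    then show ?thesis
      using integral_shift[of "\<lambda>v. ?i k v * norm (w (t - v))" "of_int k * ?L"] by simp
  qed
  moreover have int: "integrable lborel (\<lambda>v. ?i k v * norm (w (t - v)))" for k
    using wm by (intro Bochner_Integration.integrable_bound[OF iw]) (auto split: split_of_bool)
  ultimately have "(\<Sum>k\<in>F. expo.local_L1 (\<lambda>u. w (t - of_int k * ln 2 - u)))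
      = (\<Sum>k\<in>F. \<integral>v. ?i k v * norm (w (t - v)) \<partial>lborel)" by simp
  also have "\<dots> = (\<integral>v. (\<Sum>k\<in>F. ?i k v * norm (w (t - v))) \<partial>lborel)"
    by (rule Bochner_Integration.integral_sum[symmetric]) (rule int)
  also have "\<dots> = (\<integral>v. (\<Sum>k\<in>F. ?i k v) * norm (w (t - v)) \<partial>lborel)"
    by (simp only: sum_distrib_right)
  also have "\<dots> \<le> (\<integral>v. 9 * norm (w (t - v)) \<partial>lborel)"
    using iw card_int_near[OF F, of ?L] by (intro integral_mono') (auto intro!: mult_right_mono)
  also have "\<dots> = 9 * (\<integral>x. norm (w x) \<partial>lborel)"
    using integral_reflect_shift[of "\<lambda>v. norm (w v)" t] by simp
  finally show ?thesis .
qed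

text \<open>For \<open>m \<noteq> 0\<close> the block is \<open>\<psi>1\<close> dilated by a factor
  \<open>c\<close> with \<open>\<bar>c\<bar> = 2 / 2 powr \<bar>m\<bar>\<close>. Each division by
  \<open>\<i> \<xi>\<close> releases one factor \<open>c\<close>, and the dilation itself leaves the
  L1 norm unchanged. The central block is excluded because it may be nonzero near 0.\<close>

lemma inv_fourier_L1_fourier_antideriv:
  assumes "m \<noteq> 0"
  shows "symbol (divide_iota (fourier_block \<psi>0 \<psi>1 m) N)"
    and "\<exists>\<delta>>0. \<forall>\<xi>. \<bar>\<xi>\<bar> < \<delta> \<longrightarrow> fourier_block \<psi>0 \<psi>1 m \<xi> = 0"
    and "inv_fourier_L1 (divide_iota (fourier_block \<psi>0 \<psi>1 m) N)
      = (2 / 2 powr of_int \<bar>m\<bar>) ^ N * inv_fourier_L1 (divide_iota \<psi>1 N)"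
proof -
  define c :: real where "c = of_int (sgn m) * 2 powr (1 - of_int \<bar>m\<bar>)"
  have abs_c: "\<bar>c\<bar> = 2 / 2 powr of_int \<bar>m\<bar>" and c0: "c \<noteq> 0"
    using assms by (auto simp: c_def abs_mult powr_diff sgn_if)
  have block: "fourier_block \<psi>0 \<psi>1 m = (\<lambda>\<xi>. \<psi>1 (c * \<xi>))"
    unfolding c_def by (rule fourier_block_eq_scale[OF assms])
  have \<psi>1_zero: "\<psi>1 \<xi> = 0" if "\<bar>\<xi>\<bar> < 1 / 2" for \<xi>
    using \<psi>_facts(3)[of \<xi>] that by force
  show zero: "\<exists>\<delta>>0. \<forall>\<xi>. \<bar>\<xi>\<bar> < \<delta> \<longrightarrow> fourier_block \<psi>0 \<psi>1 m \<xi> = 0"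
  proof (intro exI[of _ "1 / (2 * \<bar>c\<bar>)"] conjI allI impI)
    fix \<xi> assume "\<bar>\<xi>\<bar> < 1 / (2 * \<bar>c\<bar>)"
    then have "\<bar>c * \<xi>\<bar> < 1 / 2" using c0 by (simp add: abs_mult field_simps)
    then show "fourier_block \<psi>0 \<psi>1 m \<xi> = 0" unfolding block by (rule \<psi>1_zero)
  qed (use c0 in simp)
  then show "symbol (divide_iota (fourier_block \<psi>0 \<psi>1 m) N)"
    using symbol_divide_iota[OF log.symbol_q[of m]] by blast
  have "divide_iota (fourier_block \<psi>0 \<psi>1 m) N = (\<lambda>\<xi>. of_real (c ^ N) * divide_iota \<psi>1 N (c * \<xi>))"
  proof
    fix \<xi>
    have "inverse (\<i> * complex_of_real \<xi>) = of_real c * inverse (\<i> * of_real (c * \<xi>))"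
      using c0 by simp
    then have "inverse (\<i> * complex_of_real \<xi>) ^ N = of_real (c ^ N) * inverse (\<i> * of_real (c * \<xi>)) ^ N"
      by (simp only: power_mult_distrib of_real_power)
    then show "divide_iota (fourier_block \<psi>0 \<psi>1 m) N \<xi> = of_real (c ^ N) * divide_iota \<psi>1 N (c * \<xi>)"
      unfolding block divide_iota_def by (simp only: mult_ac)
  qed
  then have "inv_fourier_L1 (divide_iota (fourier_block \<psi>0 \<psi>1 m) N)
      = norm (complex_of_real (c ^ N)) * inv_fourier_L1 (\<lambda>\<xi>. divide_iota \<psi>1 N (c * \<xi>))"
    by (simp only: inv_fourier_L1_cmult)
  also have "\<dots> = \<bar>c\<bar> ^ N * inv_fourier_L1 (divide_iota \<psi>1 N)"
    using inv_fourier_L1_scale[OF c0] by (simp add: norm_power)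
  finally show "inv_fourier_L1 (divide_iota (fourier_block \<psi>0 \<psi>1 m) N)
      = (2 / 2 powr of_int \<bar>m\<bar>) ^ N * inv_fourier_L1 (divide_iota \<psi>1 N)"
    by (simp add: abs_c)
qed

lemma inv_fourier_L1_fourier_block:
  "inv_fourier_L1 (fourier_block \<psi>0 \<psi>1 m) \<le> inv_fourier_L1 \<psi>0 + inv_fourier_L1 \<psi>1"
  using inv_fourier_L1_fourier_antideriv(3)[of m 0] by (cases "m = 0") (auto simp: fourier_block_def)

text \<open>A bound for each \<open>k\<close> that ignores its window could not be summed over
  \<open>k\<close>. So \<open>D k n\<close> retains the L1 mass of the kernel on the window of the
  \<open>k\<close>-th piece, and only the sum over \<open>F\<close> is controlled, by a
  \<open>G\<close> chosen before \<open>m\<close>, \<open>t\<close> and \<open>F\<close>.\<close>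

lemma expo_kernel_bound:
  assumes "\<beta> \<ge> 0"
  shows "\<exists>G\<ge>0. \<forall>m t F. finite F \<longrightarrow> (\<exists>D :: int \<Rightarrow> int \<Rightarrow> real. (\<forall>k n. D k n \<ge> 0) \<and>
    (\<forall>k n c h B. c > 0 \<longrightarrow> h \<in> borel_measurable borel \<longrightarrow> (\<forall>x. norm (h x) \<le> B) \<longrightarrow>
      norm (expo.pairing (\<lambda>u. inv_fourier (fourier_block \<psi>0 \<psi>1 m) (t - of_int k * ln 2 - u))
        (convolve h (inv_fourier (\<lambda>\<xi>. plateau \<phi> (inverse (1 + of_int \<bar>n\<bar>) * \<xi>) * plateau \<phi> (c * \<xi>)))))
      \<le> B * D k n) \<and>
    (\<forall>n. (\<Sum>k\<in>F. D k n) \<le> G * ((1 + of_int \<bar>n\<bar>) / 2 powr of_int \<bar>m\<bar>) powr \<beta>))"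
proof -
  define N where "N = nat \<lceil>\<beta>\<rceil>"
  have N: "\<beta> \<le> real N" unfolding N_def by linarith
  obtain C0 where C0: "C0 \<ge> 0" "\<And>R c W g M. R \<ge> 1 \<Longrightarrow> c > 0 \<Longrightarrow> iterated_antiderivs 0 W \<Longrightarrow>
     g \<in> borel_measurable borel \<Longrightarrow> (\<forall>x. norm (g x) \<le> M) \<Longrightarrow>
     norm (expo.pairing (W 0) (convolve g (inv_fourier (\<lambda>\<xi>. plateau \<phi> (inverse R * \<xi>) * plateau \<phi> (c * \<xi>)))))
       \<le> M * (C0 * R ^ 0 * expo.local_L1 (W 0))"
    using expo.pairing_kernel_bound[OF symbol_plateau[OF equi], of 0] by blast
  obtain CN where CN: "CN \<ge> 0" "\<And>R c W g M. R \<ge> 1 \<Longrightarrow> c > 0 \<Longrightarrow> iterated_antiderivs N W \<Longrightarrow>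
     g \<in> borel_measurable borel \<Longrightarrow> (\<forall>x. norm (g x) \<le> M) \<Longrightarrow>
     norm (expo.pairing (W 0) (convolve g (inv_fourier (\<lambda>\<xi>. plateau \<phi> (inverse R * \<xi>) * plateau \<phi> (c * \<xi>)))))
       \<le> M * (CN * R ^ N * expo.local_L1 (W N))"
    using expo.pairing_kernel_bound[OF symbol_plateau[OF equi], of N] by blast
  define A where "A = 9 * CN * 2 ^ N * inv_fourier_L1 (divide_iota \<psi>1 N)"
  define A' where "A' = 9 * C0 * (inv_fourier_L1 \<psi>0 + inv_fourier_L1 \<psi>1)"
  have A: "A \<ge> 0" "A' \<ge> 0" using C0(1) CN(1) by (auto simp: A_def A'_def)
  show ?thesis
  proof (intro exI[of _ "A + A'"] conjI allI impI)
    fix m :: int and t :: real and F :: "int set" assume F: "finite F"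
    let ?a = "fourier_block \<psi>0 \<psi>1 m"
    let ?W = "\<lambda>k j u. (-1) ^ j * inv_fourier (divide_iota ?a j) (t - of_int k * ln 2 - u)"
    let ?\<rho> = "\<lambda>n::int. (1 + of_int \<bar>n\<bar>) / 2 powr real_of_int \<bar>m\<bar>"
    \<comment> \<open>Integration by parts is used only if it gains
      (\<open>?\<rho> n \<le> 1\<close>) and the antiderivatives exist
      (\<open>m \<noteq> 0\<close>).\<close>
    define D where "D k n = (if m \<noteq> 0 \<and> ?\<rho> n \<le> 1
      then CN * (1 + of_int \<bar>n\<bar>) ^ N * expo.local_L1 (?W k N) else C0 * expo.local_L1 (?W k 0))" for k n :: int
    have sumL1: "(\<Sum>k\<in>F. expo.local_L1 (?W k j)) \<le> 9 * inv_fourier_L1 (divide_iota ?a j)"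
      if "symbol (divide_iota ?a j)" for j
    proof -
      have "expo.local_L1 (?W k j)
          = expo.local_L1 (\<lambda>u. inv_fourier (divide_iota ?a j) (t - of_int k * ln 2 - u))" for k
        unfolding expo.local_L1_def by (simp add: norm_mult norm_power)
      then have "(\<Sum>k\<in>F. expo.local_L1 (?W k j))
          = (\<Sum>k\<in>F. expo.local_L1 (\<lambda>u. inv_fourier (divide_iota ?a j) (t - of_int k * ln 2 - u)))"
        by (intro sum.cong refl)
      also have "\<dots> \<le> 9 * inv_fourier_L1 (divide_iota ?a j)"
        unfolding inv_fourier_L1_def using that symbol_continuous symbol_def
        by (intro sum_local_L1_translates[OF F] integrable_inv_fourier inv_fourier_continuous) auto
      finally show ?thesis .
    qed
    show "\<exists>D :: int \<Rightarrow> int \<Rightarrow> real. (\<forall>k n. D k n \<ge> 0) \<and>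
      (\<forall>k n c h B. c > 0 \<longrightarrow> h \<in> borel_measurable borel \<longrightarrow> (\<forall>x. norm (h x) \<le> B) \<longrightarrow>
        norm (expo.pairing (\<lambda>u. inv_fourier (fourier_block \<psi>0 \<psi>1 m) (t - of_int k * ln 2 - u))
          (convolve h (inv_fourier (\<lambda>\<xi>. plateau \<phi> (inverse (1 + of_int \<bar>n\<bar>) * \<xi>) * plateau \<phi> (c * \<xi>)))))
        \<le> B * D k n) \<and>
      (\<forall>n. (\<Sum>k\<in>F. D k n) \<le> (A + A') * ((1 + of_int \<bar>n\<bar>) / 2 powr of_int \<bar>m\<bar>) powr \<beta>)"
    proof (intro exI[of _ D] conjI allI impI)
      show "D k n \<ge> 0" for k n
        using C0(1) CN(1) unfolding D_def by (auto intro!: mult_nonneg_nonneg)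
    next
      fix k n :: int and c B :: real and h :: "real \<Rightarrow> complex"
      assume c: "c > 0" and h: "h \<in> borel_measurable borel" "\<forall>x. norm (h x) \<le> B"
      show "norm (expo.pairing (\<lambda>u. inv_fourier ?a (t - of_int k * ln 2 - u))
          (convolve h (inv_fourier (\<lambda>\<xi>. plateau \<phi> (inverse (1 + of_int \<bar>n\<bar>) * \<xi>) * plateau \<phi> (c * \<xi>)))))
        \<le> B * D k n"
      proof (cases "m \<noteq> 0 \<and> ?\<rho> n \<le> 1")
        case True
        then have "iterated_antiderivs N (?W k)"
          using inv_fourier_L1_fourier_antideriv(2)[of m]
          by (intro iterated_antiderivs_kernel log.symbol_q) blast
        from CN(2)[OF expo.R_ge_1[of n] c this h] show ?thesis unfolding D_def if_P[OF True] by simp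
      next
        case False
        have "iterated_antiderivs 0 (?W k)" by (intro iterated_antiderivs_kernel log.symbol_q) simp
        from C0(2)[OF expo.R_ge_1[of n] c this h] show ?thesis unfolding D_def if_not_P[OF False] by simp
      qed
    next
      fix n :: int
      have \<rho>: "?\<rho> n > 0" by simp
      show "(\<Sum>k\<in>F. D k n) \<le> (A + A') * ?\<rho> n powr \<beta>"
      proof (cases "m \<noteq> 0 \<and> ?\<rho> n \<le> 1")
        case True
        have "(\<Sum>k\<in>F. D k n) = CN * (1 + of_int \<bar>n\<bar>) ^ N * (\<Sum>k\<in>F. expo.local_L1 (?W k N))"
          unfolding D_def if_P[OF True] by (simp only: sum_distrib_left)
        also have "\<dots> \<le> CN * (1 + of_int \<bar>n\<bar>) ^ N *
            (9 * ((2 / 2 powr of_int \<bar>m\<bar>) ^ N * inv_fourier_L1 (divide_iota \<psi>1 N)))"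
          using sumL1[of N] inv_fourier_L1_fourier_antideriv(1,3)[of m N] True CN(1)
          by (intro mult_left_mono) auto
        also have "\<dots> = A * ?\<rho> n ^ N"
          by (simp add: A_def power_divide)
        also have "\<dots> \<le> A * ?\<rho> n powr \<beta>"
        proof (intro mult_left_mono A)
          have "?\<rho> n powr real N \<le> ?\<rho> n powr \<beta>"
            using \<rho> conjunct2[OF True] by (intro powr_mono'[OF N]) simp_all
          then show "?\<rho> n ^ N \<le> ?\<rho> n powr \<beta>" unfolding powr_realpow[OF \<rho>] .
        qed
        also have "\<dots> \<le> (A + A') * ?\<rho> n powr \<beta>" using A by (intro mult_right_mono) auto
        finally show ?thesis .
      next
        case False
        have "(\<Sum>k\<in>F. D k n) = C0 * (\<Sum>k\<in>F. expo.local_L1 (?W k 0))"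
          unfolding D_def if_not_P[OF False] by (simp only: sum_distrib_left)
        also have "\<dots> \<le> C0 * (9 * (inv_fourier_L1 \<psi>0 + inv_fourier_L1 \<psi>1))"
          using sumL1[of 0] log.symbol_q[of m] inv_fourier_L1_fourier_block[of m] C0(1)
          by (intro mult_left_mono) auto
        also have "\<dots> = A' * 1" by (simp add: A'_def)
        also have "\<dots> \<le> (A + A') * ?\<rho> n powr \<beta>"
        proof (intro mult_mono)
          \<comment> \<open>For \<open>m = 0\<close> the ratio is
            \<open>1 + \<bar>n\<bar>\<close>.\<close>
          have "1 \<le> ?\<rho> n" using False by (cases "m = 0") auto
          then show "1 \<le> ?\<rho> n powr \<beta>" using assms by (rule ge_one_powr_ge_zero)
        qed (use A in auto)
        finally show ?thesis .
      qed
    qed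
  qed (use A in simp)
qed

lemma continuous_rescaled:
  assumes "continuous_on {0<..} f"
  shows "continuous_on UNIV (rescaled f k)"
proof -
  have "continuous_on {0<..} (\<lambda>x. f (2 powi k * x) * dyadic_block \<phi>' 0 x)"
    using symbol_continuous[OF \<phi>'_facts(2)]
    by (intro continuous_intros continuous_on_compose2[OF assms]) (auto simp: dyadic_block_def intro: continuous_on_subset)
  then have "times_diff_on {0<..} 0 (rescaled f k)"
    unfolding times_diff_on.simps by (rule continuous_on_eq) simp
  then have "times_diff_on UNIV 0 (rescaled f k)"
  proof (rule times_diff_on_extend[of "{0<..}" "{1/2..2}", rotated 3])
    show "rescaled f k x = 0" if "x \<notin> {1/2..2}" for x
      using \<phi>'_facts(3)[of x] that by (force simp: dyadic_block_def)
  qed auto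
  then show ?thesis by simp
qed

text \<open>Substituting \<open>s = u + k ln 2\<close> undoes the rescaling. The inserted cutoff
  drops out because it equals 1 wherever \<open>\<phi>' (exp u)\<close> is nonzero.\<close>

lemma pairing_rescaled:
  "expo.pairing (\<lambda>u. w (t - of_int k * ln 2 - u)) (rescaled f k)
    = (\<integral>s. f (exp s) * dyadic_block \<phi>' k (exp s) * w (t - s) \<partial>lborel)"
proof -
  have "expo.pairing (\<lambda>u. w (t - of_int k * ln 2 - u)) (rescaled f k)
    = (\<integral>u. f (exp (u + of_int k * ln 2)) * dyadic_block \<phi>' k (exp (u + of_int k * ln 2))
        * w (t - (u + of_int k * ln 2)) \<partial>lborel)"
    unfolding expo.pairing_def
  proof (rule Bochner_Integration.integral_cong[OF refl])
    fix u
    have 1: "dyadic_block \<phi>' k (exp (u + of_int k * ln 2)) = \<phi>' (exp u)"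
      by (simp add: dyadic_block_exp)
    have 2: "w (t - (u + of_int k * ln 2)) = w (t - of_int k * ln 2 - u)" by (simp add: algebra_simps)
    show "expo.weight (\<lambda>u. w (t - of_int k * ln 2 - u)) u * rescaled f k (expo.clip u)
      = f (exp (u + of_int k * ln 2)) * dyadic_block \<phi>' k (exp (u + of_int k * ln 2))
        * w (t - (u + of_int k * ln 2))"
    proof (cases "u \<in> {- (4 * ln 2)..4 * ln 2}")
      case True
      then have "expo.clip u = exp u"
        "expo.weight (\<lambda>u. w (t - of_int k * ln 2 - u)) u = log_cutoff u * w (t - of_int k * ln 2 - u)"
        unfolding expo.clip_def expo.weight_def by auto
      then show ?thesis
        unfolding 1 2 using log_cutoff_eq_1(1)[of u]
        by (cases "\<phi>' (exp u) = 0") (simp_all add: exp_add_int_ln2 dyadic_block_def)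
    next
      case False
      then have "\<phi>' (exp u) = 0" using log_cutoff_eq_1(2) by blast
      moreover have "expo.weight (\<lambda>u. w (t - of_int k * ln 2 - u)) u = 0"
        using False unfolding expo.weight_def by auto
      ultimately show ?thesis unfolding 1 by simp
    qed
  qed
  then show ?thesis
    using integral_shift[of "\<lambda>s. f (exp s) * dyadic_block \<phi>' k (exp s) * w (t - s)" "of_int k * ln 2"]
    by simp
qed

text \<open>Reassembles the convolution from its dyadic pieces by dominated convergence: partial
  sums of the blocks converge to 1 pointwise and stay bounded, since at most 9 blocks contribute at
  any point.\<close>

lemma sum_pairing_tendsto:
  assumes f: "continuous_on UNIV (\<lambda>s. f (exp s))" "\<And>s. norm (f (exp s)) \<le> M"
    and w: "continuous_on UNIV w" "integrable lborel w"
  shows "(\<lambda>K. \<Sum>k\<in>{- int K..int K}. expo.pairing (\<lambda>u. w (t - of_int k * ln 2 - u)) (rescaled f k))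
    \<longlonglongrightarrow> convolve (\<lambda>s. f (exp s)) w t"
proof -
  have cont\<phi>: "continuous_on UNIV \<phi>'" by (rule symbol_continuous[OF \<phi>'_facts(2)])
  have "bounded (\<phi>' ` {1/2..2})"
    using cont\<phi> continuous_on_subset by (intro compact_imp_bounded compact_continuous_image) blast+
  then obtain P where P: "P > 0" "\<And>x. x \<in> {1/2..2} \<Longrightarrow> norm (\<phi>' x) \<le> P" unfolding bounded_pos by blast
  have P': "norm (\<phi>' x) \<le> P" for x
    using P \<phi>'_facts(3)[of x] by (cases "\<phi>' x = 0") auto
  have M: "M \<ge> 0" using f(2) norm_ge_zero order_trans by blast
  have dm: "continuous_on UNIV (\<lambda>s. dyadic_block \<phi>' k (exp s))" for k
    unfolding dyadic_block_exp by (intro continuous_on_compose2[OF cont\<phi>] continuous_intros) auto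
  have iw: "integrable lborel (\<lambda>s. w (t - s))" using integrable_reflect_shift[OF w(2)] .
  have wm: "continuous_on UNIV (\<lambda>s. w (t - s))"
    by (intro continuous_on_compose2[OF w(1)] continuous_intros) auto
  let ?S = "\<lambda>K s. \<Sum>k\<in>{- int K..int K}. dyadic_block \<phi>' k (exp s)"
  have dP: "norm (dyadic_block \<phi>' k (exp s)) \<le> P * of_bool (\<bar>s - of_int k * ln 2\<bar> \<le> 4 * ln 2)" for k s
  proof (cases "dyadic_block \<phi>' k (exp s) = 0")
    case False
    then have "\<bar>s - of_int k * ln 2\<bar> \<le> 4 * ln 2"
      using dyadic_block_exp_support[OF False] ln_gt_zero[of "2::real"] by linarith
    then show ?thesis using P' by (simp add: dyadic_block_exp)
  qed (use P in auto)
  have S9: "norm (?S K s) \<le> P * 9" for K s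
  proof -
    have "norm (?S K s) \<le> (\<Sum>k\<in>{- int K..int K}. P * of_bool (\<bar>s - of_int k * ln 2\<bar> \<le> 4 * ln 2))"
      by (intro sum_norm_le dP)
    also have "\<dots> \<le> P * 9"
      unfolding sum_distrib_left[symmetric] using P by (intro mult_left_mono card_int_near) auto
    finally show ?thesis .
  qed
  have int: "integrable lborel (\<lambda>s. f (exp s) * dyadic_block \<phi>' k (exp s) * w (t - s))" for k
  proof (rule Bochner_Integration.integrable_bound[OF integrable_mult_right[OF integrable_norm[OF iw], of "M * P"]])
    show "(\<lambda>s. f (exp s) * dyadic_block \<phi>' k (exp s) * w (t - s)) \<in> borel_measurable lborel"
      using f(1) dm wm by (simp add: borel_measurable_continuous_onI continuous_on_mult)
    show "AE s in lborel. norm (f (exp s) * dyadic_block \<phi>' k (exp s) * w (t - s))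
        \<le> norm (M * P * norm (w (t - s)))"
      using f(2) P' P M by (intro AE_I2) (auto simp: norm_mult dyadic_block_exp intro!: mult_mono)
  qed
  have "(\<Sum>k\<in>{- int K..int K}. expo.pairing (\<lambda>u. w (t - of_int k * ln 2 - u)) (rescaled f k))
      = (\<integral>s. f (exp s) * ?S K s * w (t - s) \<partial>lborel)" for K
  proof -
    have "(\<Sum>k\<in>{- int K..int K}. expo.pairing (\<lambda>u. w (t - of_int k * ln 2 - u)) (rescaled f k))
      = (\<integral>s. (\<Sum>k\<in>{- int K..int K}. f (exp s) * dyadic_block \<phi>' k (exp s) * w (t - s)) \<partial>lborel)"
      unfolding pairing_rescaled
      by (rule Bochner_Integration.integral_sum[symmetric]) (rule int)
    then show ?thesis by (simp only: sum_distrib_left sum_distrib_right)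
  qed
  moreover have "(\<lambda>K. \<integral>s. f (exp s) * ?S K s * w (t - s) \<partial>lborel)
      \<longlonglongrightarrow> (\<integral>s. f (exp s) * 1 * w (t - s) \<partial>lborel)"
  proof (rule integral_dominated_convergence[where w = "\<lambda>s. M * (P * 9) * norm (w (t - s))"])
    show "integrable lborel (\<lambda>s. M * (P * 9) * norm (w (t - s)))" using iw by simp
    show "(\<lambda>s. f (exp s) * 1 * w (t - s)) \<in> borel_measurable lborel"
      using f(1) wm by (simp add: borel_measurable_continuous_onI continuous_on_mult)
    show "(\<lambda>s. f (exp s) * ?S K s * w (t - s)) \<in> borel_measurable lborel" for K
      using f(1) wm dm by (simp add: borel_measurable_continuous_onI continuous_on_mult continuous_on_sum)
    show "AE s in lborel. norm (f (exp s) * ?S K s * w (t - s)) \<le> M * (P * 9) * norm (w (t - s))" for K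
      using f(2) S9 P M by (intro AE_I2) (auto simp: norm_mult intro!: mult_mono)
    show "AE s in lborel. (\<lambda>K. f (exp s) * ?S K s * w (t - s)) \<longlonglongrightarrow> f (exp s) * 1 * w (t - s)"
    proof (intro AE_I2 tendsto_intros)
      fix s :: real
      have "((\<lambda>k. dyadic_block \<phi>' k (exp s)) has_sum 1) UNIV"
        using dyad by (simp add: dyadic_partition_def)
      moreover have "filterlim (\<lambda>K. {- int K..int K}) (finite_subsets_at_top UNIV) sequentially"
        unfolding filterlim_finite_subsets_at_top
      proof (intro allI impI)
        fix X :: "int set" assume X: "finite X \<and> X \<subseteq> UNIV"
        show "\<forall>\<^sub>F K in sequentially. finite {- int K..int K} \<and> X \<subseteq> {- int K..int K} \<and> {- int K..int K} \<subseteq> UNIV"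
          unfolding eventually_sequentially
        \<comment> \<open>The sum of the absolute values over a finite set bounds each single
          one.\<close>
        proof (intro exI[of _ "nat (\<Sum>x\<in>X. \<bar>x\<bar>)"] allI impI)
          fix K assume K: "nat (\<Sum>x\<in>X. \<bar>x\<bar>) \<le> K"
          have "\<bar>x\<bar> \<le> int K" if "x \<in> X" for x
            using member_le_sum[OF that, of "\<lambda>x. \<bar>x\<bar>"] X K by auto
          then show "finite {- int K..int K} \<and> X \<subseteq> {- int K..int K} \<and> {- int K..int K} \<subseteq> UNIV"
            by (auto simp: abs_le_iff) force
        qed
      qed
      ultimately show "(\<lambda>K. ?S K s) \<longlonglongrightarrow> 1" unfolding has_sum_def by (rule filterlim_compose)
    qed
  qed
  ultimately show ?thesis by (simp add: convolve_def)
qed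

text \<open>For a finite set of dyadic pieces the sums over \<open>k\<close> and \<open>n\<close>
  are exchanged, so that the bounded overlap acts for each fixed \<open>n\<close>; the bound is
  independent of the set and passes to the limit. The weight \<open>\<alpha> - \<epsilon>\<close>
  against the decay \<open>\<alpha>\<close> leaves a geometric series in
  \<open>\<bar>m\<bar>\<close>.\<close>

lemma second_embedding:
  assumes \<alpha>: "\<alpha> > 0" and \<epsilon>: "\<epsilon> > 0"
  shows "\<exists>C\<ge>0. \<forall>f. continuous_on {0<..} f \<longrightarrow> bounded (f ` {0<..}) \<longrightarrow>
    M_norm \<psi>0 \<psi>1 (\<alpha> - \<epsilon>) f \<le> ennreal C * E_unif_norm \<phi> \<phi>' \<alpha> f"
proof -
  from expo_kernel_bound[OF less_imp_le[OF \<alpha>]]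
  obtain G where G: "G \<ge> 0" "\<forall>m t F. finite F \<longrightarrow> (\<exists>D :: int \<Rightarrow> int \<Rightarrow> real. (\<forall>k n. D k n \<ge> 0) \<and>
    (\<forall>k n c h B. c > 0 \<longrightarrow> h \<in> borel_measurable borel \<longrightarrow> (\<forall>x. norm (h x) \<le> B) \<longrightarrow>
      norm (expo.pairing (\<lambda>u. inv_fourier (fourier_block \<psi>0 \<psi>1 m) (t - of_int k * ln 2 - u))
        (convolve h (inv_fourier (\<lambda>\<xi>. plateau \<phi> (inverse (1 + of_int \<bar>n\<bar>) * \<xi>) * plateau \<phi> (c * \<xi>)))))
      \<le> B * D k n) \<and>
    (\<forall>n. (\<Sum>k\<in>F. D k n) \<le> G * ((1 + of_int \<bar>n\<bar>) / 2 powr of_int \<bar>m\<bar>) powr \<alpha>))"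
    by (elim exE conjE) (rule that)
  obtain Z where Z: "Z \<ge> 0" "(\<Sum>\<^sub>\<infinity>m::int. ennreal (2 powr - (of_int \<bar>m\<bar> * \<epsilon>))) \<le> ennreal Z"
    using geometric_sum_finite[OF \<epsilon>] .
  show ?thesis
  proof (intro exI[of _ "G * Z"] conjI allI impI)
    fix f :: "real \<Rightarrow> complex"
    assume cf: "continuous_on {0<..} f" and bf: "bounded (f ` {0<..})"
    obtain M where M: "\<And>x. x > 0 \<Longrightarrow> norm (f x) \<le> M" using bf by (auto simp: bounded_iff)
    have cfe: "continuous_on UNIV (\<lambda>s. f (exp s))"
      by (rule continuous_on_compose2[OF cf]) (auto intro!: continuous_intros)
    have ch: "continuous_on UNIV (rescaled f k)" for k by (rule continuous_rescaled[OF cf])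
    have bh: "bounded (range (rescaled f k))" for k
    proof -
      have "bounded (rescaled f k ` {1/2..2})"
        using ch continuous_on_subset by (intro compact_imp_bounded compact_continuous_image) blast+
      moreover have "range (rescaled f k) \<subseteq> insert 0 (rescaled f k ` {1/2..2})"
      proof clarify
        fix x assume "rescaled f k x \<notin> rescaled f k ` {1/2..2}"
        then have "x \<notin> {1/2..2}" by blast
        then show "rescaled f k x = 0"
          using \<phi>'_facts(3)[of x] by (force simp: dyadic_block_def)
      qed
      ultimately show ?thesis by (meson bounded_insert bounded_subset)
    qed
    have "\<exists>B. \<forall>x. norm (rescaled f k x) \<le> B" for k
      using bh[of k] unfolding bounded_iff by blast
    then have "\<forall>k. \<exists>B. \<forall>x. norm (rescaled f k x) \<le> B" by blast
    from choice[OF this] obtain B where B: "\<And>k x. norm (rescaled f k x) \<le> B k" by blast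
    \<comment> \<open>Replacing the norm of the \<open>k\<close>-th piece by its supremum over
      \<open>k\<close> frees the factor from \<open>k\<close>, so that only \<open>D k n\<close>
      remains to be summed. This is where the uniformity in \<open>E_unif_norm\<close>
      enters.\<close>
    define a where "a n = (SUP k. sup_norm (convolve (rescaled f k) (inv_fourier (equidistant_block \<phi> n))))" for n
    let ?E = "E_unif_norm \<phi> \<phi>' \<alpha> f"
    have bound: "sup_norm (convolve (\<lambda>s. f (exp s)) (inv_fourier (fourier_block \<psi>0 \<psi>1 m)))
        \<le> ennreal (G * 2 powr - (of_int \<bar>m\<bar> * \<alpha>)) * ?E" for m
    proof (rule sup_norm_leI)
      fix t
      let ?w = "inv_fourier (fourier_block \<psi>0 \<psi>1 m)"
      have w: "continuous_on UNIV ?w" "integrable lborel ?w"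
        using log.symbol_q[of m] symbol_continuous symbol_def inv_fourier_continuous integrable_inv_fourier
        by blast+
      let ?p = "\<lambda>k. expo.pairing (\<lambda>u. ?w (t - of_int k * ln 2 - u)) (rescaled f k)"
      have wk: "continuous_on UNIV (\<lambda>u. ?w (t - of_int k * ln 2 - u))" for k
        by (rule continuous_on_compose2[OF w(1)]) (auto intro!: continuous_intros)
      have fin: "ennreal (norm (\<Sum>k\<in>F. ?p k)) \<le> ennreal (G * 2 powr - (of_int \<bar>m\<bar> * \<alpha>)) * ?E"
        if F: "finite F" for F
      proof -
        from G(2)[rule_format, OF F, of m t]
        obtain D where D: "\<forall>k n. D k n \<ge> 0"
          "\<forall>k n c h B. c > 0 \<longrightarrow> h \<in> borel_measurable borel \<longrightarrow> (\<forall>x. norm (h x) \<le> B) \<longrightarrow>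
            norm (expo.pairing (\<lambda>u. ?w (t - of_int k * ln 2 - u))
              (convolve h (inv_fourier (\<lambda>\<xi>. plateau \<phi> (inverse (1 + of_int \<bar>n\<bar>) * \<xi>) * plateau \<phi> (c * \<xi>)))))
            \<le> B * D k n"
          "\<forall>n::int. (\<Sum>k\<in>F. D k n) \<le> G * ((1 + of_int \<bar>n\<bar>) / 2 powr of_int \<bar>m\<bar>) powr \<alpha>"
          by (elim exE conjE) (rule that)
        note D = D[rule_format]
        have "ennreal (norm (\<Sum>k\<in>F. ?p k)) \<le> (\<Sum>k\<in>F. ennreal (norm (?p k)))"
          by (simp add: sum_ennreal ennreal_leI norm_sum)
        also have "\<dots> \<le> (\<Sum>k\<in>F. \<Sum>\<^sub>\<infinity>n. a n * ennreal (D k n))"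
        proof (rule sum_mono)
          fix k
          have "ennreal (norm (?p k)) \<le> (\<Sum>\<^sub>\<infinity>n.
              sup_norm (convolve (rescaled f k) (inv_fourier (equidistant_block \<phi> n))) * ennreal (D k n))"
            by (rule expo.pairing_sum_bound[OF wk ch B D(1) D(2)])
          also have "\<dots> \<le> (\<Sum>\<^sub>\<infinity>n. a n * ennreal (D k n))"
            unfolding a_def by (intro infsum_ennreal_mono mult_right_mono SUP_upper) auto
          finally show "ennreal (norm (?p k)) \<le> (\<Sum>\<^sub>\<infinity>n. a n * ennreal (D k n))" .
        qed
        also have "\<dots> = (\<Sum>\<^sub>\<infinity>n. \<Sum>k\<in>F. a n * ennreal (D k n))" by (rule infsum_ennreal_sum[OF F])
        also have "\<dots> \<le> (\<Sum>\<^sub>\<infinity>n. ennreal (G * 2 powr - (of_int \<bar>m\<bar> * \<alpha>)) * (ennreal ((1 + of_int \<bar>n\<bar>) powr \<alpha>) * a n))"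
        proof (rule infsum_ennreal_mono)
          fix n :: int
          have "(\<Sum>k\<in>F. a n * ennreal (D k n)) = a n * ennreal (\<Sum>k\<in>F. D k n)"
            using D(1) by (simp add: sum_distrib_left flip: sum_ennreal)
          also have "\<dots> \<le> a n * ennreal (G * ((1 + of_int \<bar>n\<bar>) / 2 powr of_int \<bar>m\<bar>) powr \<alpha>)"
            using D(3) by (intro mult_left_mono ennreal_leI) auto
          also have "G * ((1 + of_int \<bar>n\<bar>) / 2 powr of_int \<bar>m\<bar>) powr \<alpha>
              = (G * 2 powr - (of_int \<bar>m\<bar> * \<alpha>)) * (1 + of_int \<bar>n\<bar>) powr \<alpha>"
            by (simp add: powr_divide powr_powr powr_minus field_simps)
          also have "a n * ennreal \<dots> = ennreal (G * 2 powr - (of_int \<bar>m\<bar> * \<alpha>)) * (ennreal ((1 + of_int \<bar>n\<bar>) powr \<alpha>) * a n)"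
            using G(1) by (simp add: ennreal_mult mult_ac)
          finally show "(\<Sum>k\<in>F. a n * ennreal (D k n))
            \<le> ennreal (G * 2 powr - (of_int \<bar>m\<bar> * \<alpha>)) * (ennreal ((1 + of_int \<bar>n\<bar>) powr \<alpha>) * a n)" .
        qed
        also have "\<dots> \<le> ennreal (G * 2 powr - (of_int \<bar>m\<bar> * \<alpha>)) * ?E"
          unfolding E_unif_norm_def a_def by (rule infsum_ennreal_cmult_le)
        finally show ?thesis .
      qed
      have "(\<lambda>K. \<Sum>k\<in>{- int K..int K}. ?p k) \<longlonglongrightarrow> convolve (\<lambda>s. f (exp s)) ?w t"
        by (rule sum_pairing_tendsto[OF cfe M[OF exp_gt_zero] w])
      then have "(\<lambda>K. ennreal (norm (\<Sum>k\<in>{- int K..int K}. ?p k)))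
          \<longlonglongrightarrow> ennreal (norm (convolve (\<lambda>s. f (exp s)) ?w t))"
        by (intro tendsto_ennrealI tendsto_norm)
      from LIMSEQ_le_const2[OF this] fin
      show "ennreal (norm (convolve (\<lambda>s. f (exp s)) ?w t)) \<le> ennreal (G * 2 powr - (of_int \<bar>m\<bar> * \<alpha>)) * ?E"
        by blast
    qed
    have "M_norm \<psi>0 \<psi>1 (\<alpha> - \<epsilon>) f \<le> (\<Sum>\<^sub>\<infinity>m::int. (ennreal G * ?E) * ennreal (2 powr - (of_int \<bar>m\<bar> * \<epsilon>)))"
      unfolding M_norm_def B_norm_def
    proof (rule infsum_ennreal_mono)
      fix m :: int
      have "ennreal (2 powr (of_int \<bar>m\<bar> * (\<alpha> - \<epsilon>))) *
          sup_norm (convolve (\<lambda>s. f (exp s)) (inv_fourier (fourier_block \<psi>0 \<psi>1 m)))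
        \<le> ennreal (2 powr (of_int \<bar>m\<bar> * (\<alpha> - \<epsilon>))) * (ennreal (G * 2 powr - (of_int \<bar>m\<bar> * \<alpha>)) * ?E)"
        by (intro mult_left_mono bound) auto
      also have "\<dots> = ennreal (2 powr (of_int \<bar>m\<bar> * (\<alpha> - \<epsilon>)) * (G * 2 powr - (of_int \<bar>m\<bar> * \<alpha>))) * ?E"
        using G(1) by (simp add: ennreal_mult mult.assoc)
      also have "2 powr (of_int \<bar>m\<bar> * (\<alpha> - \<epsilon>)) * (G * 2 powr - (of_int \<bar>m\<bar> * \<alpha>)) = G * 2 powr - (of_int \<bar>m\<bar> * \<epsilon>)"
      proof -
        have "- (of_int \<bar>m\<bar> * \<epsilon>) = of_int \<bar>m\<bar> * (\<alpha> - \<epsilon>) + - (of_int \<bar>m\<bar> * \<alpha>)" by (simp add: algebra_simps)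
        then show ?thesis by (simp only: powr_add) simp
      qed
      also have "ennreal (G * 2 powr - (of_int \<bar>m\<bar> * \<epsilon>)) * ?E = (ennreal G * ?E) * ennreal (2 powr - (of_int \<bar>m\<bar> * \<epsilon>))"
        using G(1) by (simp add: ennreal_mult mult_ac)
      finally show "ennreal (2 powr (of_int \<bar>m\<bar> * (\<alpha> - \<epsilon>))) *
          sup_norm (convolve (\<lambda>s. f (exp s)) (inv_fourier (fourier_block \<psi>0 \<psi>1 m)))
        \<le> (ennreal G * ?E) * ennreal (2 powr - (of_int \<bar>m\<bar> * \<epsilon>))" .
    qed
    also have "\<dots> \<le> (ennreal G * ?E) * (\<Sum>\<^sub>\<infinity>m::int. ennreal (2 powr - (of_int \<bar>m\<bar> * \<epsilon>)))"
      by (rule infsum_ennreal_cmult_le)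
    also have "\<dots> \<le> (ennreal G * ?E) * ennreal Z" by (intro mult_left_mono Z) auto
    also have "\<dots> = ennreal (G * Z) * ?E" using G(1) Z(1) by (simp add: ennreal_mult mult_ac)
    finally show "M_norm \<psi>0 \<psi>1 (\<alpha> - \<epsilon>) f \<le> ennreal (G * Z) * ?E" .
  qed (use G Z in simp)
qed

end

lemma ennreal_bound_less_top: "x \<le> ennreal C * y \<Longrightarrow> y < \<infinity> \<Longrightarrow> x < \<infinity>"
  using ennreal_mult_less_top le_less_trans by (metis ennreal_less_top infinity_ennreal_def)

theorem proposition3p4:
  fixes \<phi> \<phi>' \<psi>0 \<psi>1 :: "real \<Rightarrow> complex" and \<alpha> \<epsilon> :: real
  assumes "equidistant_partition \<phi>"
    and "dyadic_partition \<phi>'"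
    and "fourier_partition \<psi>0 \<psi>1"
    and "\<alpha> > 0" and "\<epsilon> > 0"
  shows "continuously_embedded
           (M_space \<psi>0 \<psi>1 (\<alpha> + 1 + \<epsilon>)) (M_norm \<psi>0 \<psi>1 (\<alpha> + 1 + \<epsilon>))
           (E_unif \<phi> \<phi>' \<alpha>) (E_unif_norm \<phi> \<phi>' \<alpha>) \<and>
         (\<epsilon> < \<alpha> \<longrightarrow>
           continuously_embedded
             (E_unif \<phi> \<phi>' \<alpha>) (E_unif_norm \<phi> \<phi>' \<alpha>)
             (M_space \<psi>0 \<psi>1 (\<alpha> - \<epsilon>)) (M_norm \<psi>0 \<psi>1 (\<alpha> - \<epsilon>)))"
proof (intro conjI impI)
  interpret partitions_of_unity \<phi> \<phi>' \<psi>0 \<psi>1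
    using assms by unfold_locales
  obtain C where C: "C \<ge> 0" "\<And>f. (\<lambda>s. f (exp s)) \<in> bcontfun \<Longrightarrow>
      E_unif_norm \<phi> \<phi>' \<alpha> f \<le> ennreal C * M_norm \<psi>0 \<psi>1 (\<alpha> + 1 + \<epsilon>) f"
    using first_embedding[OF assms(4,5)] by blast
  have "M_space \<psi>0 \<psi>1 (\<alpha> + 1 + \<epsilon>) \<subseteq> E_unif \<phi> \<phi>' \<alpha>"
  proof
    fix f assume f: "f \<in> M_space \<psi>0 \<psi>1 (\<alpha> + 1 + \<epsilon>)"
    then have fe: "(\<lambda>s. f (exp s)) \<in> bcontfun" and norm: "M_norm \<psi>0 \<psi>1 (\<alpha> + 1 + \<epsilon>) f < \<infinity>"
      and half: "f \<in> half_line_functions"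
      by (auto simp: M_space_def B_space_def M_norm_def)
    have c: "continuous_on UNIV (\<lambda>s. f (exp s))" and b: "bounded (range (\<lambda>s. f (exp s)))"
      using fe by (auto simp: bcontfun_def)
    \<comment> \<open>Continuity on the half line is recovered by composing \<open>f (exp s)\<close>
      with \<open>ln\<close>.\<close>
    have "continuous_on {0<..} (\<lambda>x. f (exp (ln x)))"
      by (rule continuous_on_compose2[OF c]) (auto intro!: continuous_intros)
    then have "continuous_on {0<..} f" by (rule continuous_on_eq) simp
    moreover have "f ` {0<..} \<subseteq> range (\<lambda>s. f (exp s))" by (auto simp: image_iff) (metis exp_ln)
    then have "bounded (f ` {0<..})" using b bounded_subset by blast
    moreover have "E_unif_norm \<phi> \<phi>' \<alpha> f < \<infinity>"
      using C(2)[OF fe] norm by (rule ennreal_bound_less_top)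
    ultimately show "f \<in> E_unif \<phi> \<phi>' \<alpha>" using half by (simp add: E_unif_def)
  qed
  then show "continuously_embedded (M_space \<psi>0 \<psi>1 (\<alpha> + 1 + \<epsilon>)) (M_norm \<psi>0 \<psi>1 (\<alpha> + 1 + \<epsilon>))
      (E_unif \<phi> \<phi>' \<alpha>) (E_unif_norm \<phi> \<phi>' \<alpha>)"
    unfolding continuously_embedded_def using C
    by (auto intro!: exI[of _ C] simp: M_space_def B_space_def)
next
  interpret partitions_of_unity \<phi> \<phi>' \<psi>0 \<psi>1
    using assms by unfold_locales
  obtain C where C: "C \<ge> 0" "\<And>f. continuous_on {0<..} f \<Longrightarrow> bounded (f ` {0<..}) \<Longrightarrow>
      M_norm \<psi>0 \<psi>1 (\<alpha> - \<epsilon>) f \<le> ennreal C * E_unif_norm \<phi> \<phi>' \<alpha> f"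
    using second_embedding[OF assms(4,5)] by blast
  have "E_unif \<phi> \<phi>' \<alpha> \<subseteq> M_space \<psi>0 \<psi>1 (\<alpha> - \<epsilon>)"
  proof
    fix f assume f: "f \<in> E_unif \<phi> \<phi>' \<alpha>"
    then have c: "continuous_on {0<..} f" and b: "bounded (f ` {0<..})"
      and norm: "E_unif_norm \<phi> \<phi>' \<alpha> f < \<infinity>" and half: "f \<in> half_line_functions"
      by (auto simp: E_unif_def)
    have "continuous_on UNIV (\<lambda>s. f (exp s))"
      by (rule continuous_on_compose2[OF c]) (auto intro!: continuous_intros)
    moreover have "bounded (range (\<lambda>s. f (exp s)))"
      by (rule bounded_subset[OF b]) auto
    ultimately have "(\<lambda>s. f (exp s)) \<in> bcontfun" by (simp add: bcontfun_def)
    moreover have "M_norm \<psi>0 \<psi>1 (\<alpha> - \<epsilon>) f < \<infinity>"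
      using C(2)[OF c b] norm by (rule ennreal_bound_less_top)
    ultimately show "f \<in> M_space \<psi>0 \<psi>1 (\<alpha> - \<epsilon>)"
      using half by (simp add: M_space_def B_space_def M_norm_def)
  qed
  then show "continuously_embedded (E_unif \<phi> \<phi>' \<alpha>) (E_unif_norm \<phi> \<phi>' \<alpha>)
      (M_space \<psi>0 \<psi>1 (\<alpha> - \<epsilon>)) (M_norm \<psi>0 \<psi>1 (\<alpha> - \<epsilon>))"
    unfolding continuously_embedded_def using C by (auto intro!: exI[of _ C] simp: E_unif_def)
qed

end
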